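(* Let $\gamma>0$, let $f_\gamma(z)=\lfloor(\log(\|z\|_\infty\vee 1))^{\gamma}\rfloor$ for $z\in\mathbb Z^2$, and let $G=\mathrm{Comb}(\mathbb Z^2,f_\gamma)$. Then: (1) if $\gamma\le 1$, then $G$ has the infinite collision property; (2) if $\gamma>1$, then $G$ has the finite collision property.
   Context: $\mathbb N=\{0,1,2,\dots\}$; $\mathbb Z^2$ is regarded as a graph with nearest-neighbour edges; $\|z\|_\infty=|z_1|\vee|z_2|$, where $a\vee b=\max(a,b)$. Comb graph: for a connected, locally finite, infinite graph $\tilde G=(\tilde V,\tilde E)$ and $f:\tilde V\to\mathbb N\cup\{\infty\}$, $\mathrm{Comb}(\tilde G,f)$ is the graph with vertex set $V=\{(v,n)\in\tilde V\times\mathbb N: 0\le n\le f(v)\}$ and edges $\{(u,0),(v,0)\}$ for $\{u,v\}\in\tilde E$ together with $\{(v,m),(v,n)\}$ for $v\in\tilde V$, $|m-n|=1$ (both endpoints in $V$). Collisions: let $X,Y$ be independent discrete-time simple random walks on $G$ (at each step moving to a uniformly chosen neighbour), with law $\mathbb P_{x,y}=\mathbb P_x\otimes\mathbb P_y$ when started at $x,y\in V$, and let $\mathcal Z=|\{n\in\mathbb N: X_n=Y_n\}|$. $G$ has the infinite collision property if $\mathbb P_{x,x}(\mathcal Z=\infty)=1$ for all $x\in V$, and the finite collision property if $\mathbb P_{x,x}(\mathcal Z<\infty)=1$ for all $x\in V$. *)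

theory Defs
  imports "HOL-Probability.Probability" "HOL-Library.Extended_Nat"
begin

text \<open>Undirected graphs. An edge is the unordered pair of its endpoints.\<close>

record 'v ugraph =
  verts :: "'v set"
  edges :: "'v set set"

definition nbrs :: "'v ugraph \<Rightarrow> 'v \<Rightarrow> 'v set" where
  "nbrs G v = {w. {v, w} \<in> edges G}"

definition Comb :: "'v ugraph \<Rightarrow> ('v \<Rightarrow> enat) \<Rightarrow> ('v \<times> nat) ugraph" where
  "Comb G f = \<lparr>
     verts = {(v, n). v \<in> verts G \<and> enat n \<le> f v},
     edges = {{(u, 0), (v, 0)} | u v. {u, v} \<in> edges G} \<union>
             {{(v, m), (v, n)} | v m n. v \<in> verts G \<and> \<bar>int m - int n\<bar> = 1 \<and>
                                        enat m \<le> f v \<and> enat n \<le> f v} \<rparr>"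

definition Z2 :: "(int \<times> int) ugraph" where
  "Z2 = \<lparr> verts = UNIV,
          edges = {{z, w} | z w. \<bar>fst z - fst w\<bar> + \<bar>snd z - snd w\<bar> = 1} \<rparr>"

definition sup_norm :: "int \<times> int \<Rightarrow> int" where
  "sup_norm z = max \<bar>fst z\<bar> \<bar>snd z\<bar>"

text \<open>
  The base of the power may be 0 (for sup norm at most 1). For positive exponents the
  convention \<open>0 powr \<gamma> = 0\<close> is the usual one. The floor is nonnegative, so \<open>nat\<close> does not
  truncate.
\<close>

definition comb_height :: "real \<Rightarrow> int \<times> int \<Rightarrow> enat" where
  "comb_height \<gamma> z = enat (nat \<lfloor>(ln (max (real_of_int (sup_norm z)) 1)) powr \<gamma>\<rfloor>)"

text \<open>
  Simple random walk. \<open>pmf_of_set\<close> is the uniform distribution only on finite nonempty sets, so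
  the definitions below are meaningful on locally finite graphs without isolated vertices.
  The law of the walk on the path space \<open>nat \<Rightarrow> 'v\<close> (with the product of the discrete
  sigma-algebras) is obtained from the Ionescu-Tulcea theorem: \<open>srw_kernel G x n \<omega>\<close> is the
  distribution of the position at time \<open>n\<close> given the positions \<open>\<omega> 0, \<dots>, \<omega> (n - 1)\<close>.
\<close>

definition srw_step :: "'v ugraph \<Rightarrow> 'v \<Rightarrow> 'v pmf" where
  "srw_step G v = pmf_of_set (nbrs G v)"

primrec srw_kernel :: "'v ugraph \<Rightarrow> 'v \<Rightarrow> nat \<Rightarrow> (nat \<Rightarrow> 'v) \<Rightarrow> 'v measure" where
  "srw_kernel G x 0 = (\<lambda>\<omega>. measure_pmf (return_pmf x))"
| "srw_kernel G x (Suc n) = (\<lambda>\<omega>. measure_pmf (srw_step G (\<omega> n)))"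

interpretation srw: Ionescu_Tulcea "srw_kernel G x" "\<lambda>_. count_space UNIV" for G x
proof (rule Ionescu_Tulcea.intro)
  fix i
  show "srw_kernel G x i \<in> measurable (PiM {0..<i} (\<lambda>_. count_space UNIV))
          (subprob_algebra (count_space UNIV))"
  proof (cases i)
    case 0
    then show ?thesis
      using measure_pmf.subprob_space_axioms[of "return_pmf x"]
      by (auto simp: space_subprob_algebra simp del: return_pmf.rep_eq intro!: measurable_const)
  next
    case (Suc n)
    have "(\<lambda>v. measure_pmf (srw_step G v)) \<in>
        measurable (count_space UNIV) (subprob_algebra (count_space UNIV))"
      by (auto simp: space_subprob_algebra measure_pmf.subprob_space_axioms)
    from measurable_compose[OF _ this] show ?thesis
      unfolding Suc by (auto intro!: measurable_component_singleton)
  qed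
next
  fix i \<omega>
  show "prob_space (srw_kernel G x i \<omega>)"
    by (cases i) (auto intro: measure_pmf.prob_space_axioms)
qed

definition srw_law :: "'v ugraph \<Rightarrow> 'v \<Rightarrow> (nat \<Rightarrow> 'v) measure" where
  "srw_law G x = srw.PF.lim G x"

definition two_walks :: "'v ugraph \<Rightarrow> 'v \<Rightarrow> 'v \<Rightarrow> ((nat \<Rightarrow> 'v) \<times> (nat \<Rightarrow> 'v)) measure" where
  "two_walks G x y = srw_law G x \<Otimes>\<^sub>M srw_law G y"

definition num_collisions :: "(nat \<Rightarrow> 'v) \<Rightarrow> (nat \<Rightarrow> 'v) \<Rightarrow> enat" where
  "num_collisions X Y =
     (if finite {n. X n = Y n} then enat (card {n. X n = Y n}) else \<infinity>)"

definition infinite_collision_property :: "'v ugraph \<Rightarrow> bool" where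
  "infinite_collision_property G \<longleftrightarrow>
     (\<forall>x \<in> verts G. \<P>(w in two_walks G x x. num_collisions (fst w) (snd w) = \<infinity>) = 1)"

definition finite_collision_property :: "'v ugraph \<Rightarrow> bool" where
  "finite_collision_property G \<longleftrightarrow>
     (\<forall>x \<in> verts G. \<P>(w in two_walks G x x. num_collisions (fst w) (snd w) < \<infinity>) = 1)"

lemma sets_srw_law: "sets (srw_law G x) = sets (PiM UNIV (\<lambda>_. count_space UNIV))"
  by (simp add: srw_law_def)

lemma space_srw_law: "space (srw_law G x) = UNIV"
  using sets_eq_imp_space_eq[OF sets_srw_law] by (simp add: space_PiM)

lemma prob_space_srw_law: "prob_space (srw_law G x)"
  unfolding srw_law_def
proof (rule prob_spaceI)
  have E: "srw.PF.emb UNIV {} {\<lambda>_::nat. undefined::'a} = UNIV"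
    by (auto simp: prod_emb_def space_PiM restrict_def)
  have "emeasure (srw.PF.lim G x) (srw.PF.emb UNIV {} {\<lambda>_. undefined}) =
      emeasure (srw.CI G x {}) {\<lambda>_. undefined}"
    by (rule srw.lim) (auto simp: sets_PiM_empty)
  also have "\<dots> = 1"
    using prob_space.emeasure_space_1[OF srw.PF.prob_space_P[of "{}" G x]]
    by (simp add: space_PiM_empty srw.CI_def)
  finally show "emeasure (srw.PF.lim G x) (space (srw.PF.lim G x)) = 1"
    using space_srw_law[of G x] E by (simp add: srw_law_def)
qed

lemma emeasure_srw_C:
  fixes p :: "nat \<Rightarrow> 'v::countable"
  shows "emeasure (srw.C G x 0 n (\<lambda>_. undefined)) {restrict p {0..<n}} =
           (\<Prod>i<n. emeasure (srw_kernel G x i p) {p i})"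
proof (induction n)
  case 0
  then show ?case
    by (simp add: restrict_def sets_PiM_empty)
next
  case (Suc n)
  let ?M = "\<lambda>n. PiM {0..<n} (\<lambda>_. count_space UNIV) :: (nat \<Rightarrow> 'v) measure"
  let ?u = "\<lambda>_::nat. undefined :: 'v"
  have S: "{restrict p {0..<m}} \<in> sets (?M m)" for m
  proof -
    have "{restrict p {0..<m}} = PiE {0..<m} (\<lambda>i. {p i})"
      using PiE_singleton[of "restrict p {0..<m}" "{0..<m}"]
        PiE_cong[of "{0..<m}" "\<lambda>i. {restrict p {0..<m} i}" "\<lambda>i. {p i}"] by simp
    then show ?thesis by (auto intro!: sets_PiM_I_finite)
  qed
  have u: "?u \<in> space (?M 0)" by (simp add: space_PiM)
  have K: "emeasure (srw.eP G x n \<omega>) {restrict p {0..<Suc n}} =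
      emeasure (srw_kernel G x n p) {p n} * indicator {restrict p {0..<n}} \<omega>"
    if \<omega>: "\<omega> \<in> space (?M n)" for \<omega>
  proof -
    have ext: "\<omega> \<in> extensional {0..<n}" using \<omega> by (simp add: space_PiM PiE_iff)
    have eq: "(\<lambda>v. fun_upd \<omega> n v) -` {restrict p {0..<Suc n}} =
        (if \<omega> = restrict p {0..<n} then {p n} else {})"
    proof -
      have *: "(fun_upd \<omega> n v = restrict p {0..<Suc n}) \<longleftrightarrow> v = p n \<and> \<omega> = restrict p {0..<n}" for v
        using ext by (auto simp: fun_eq_iff extensional_def restrict_def less_Suc_eq split: if_splits)
      show ?thesis
        by (rule set_eqI) (simp only: vimage_eq singleton_iff * if_distrib[of "(\<in>) _"] empty_iff split: if_split, blast)
    qed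
    have ker: "srw_kernel G x n (restrict p {0..<n}) = srw_kernel G x n p"
      by (cases n) auto
    show ?thesis
      unfolding srw.emeasure_eP[OF \<omega> S[of "Suc n"]] eq using ker
      by (cases "\<omega> = restrict p {0..<n}") simp_all
  qed
  have "emeasure (srw.C G x 0 (Suc n) ?u) {restrict p {0..<Suc n}} =
      (\<integral>\<^sup>+\<omega>. emeasure (srw.eP G x n \<omega>) {restrict p {0..<Suc n}} \<partial>srw.C G x 0 n ?u)"
    unfolding srw.C.simps(2) add_0
  proof (rule emeasure_bind[where N = "?M (Suc n)"])
    show "space (srw.C G x 0 n ?u) \<noteq> {}"
      using prob_space.not_empty[OF srw.prob_space_C[OF u]] .
    have "sets (srw.C G x 0 n ?u) = sets (?M n)"
      using srw.sets_C[OF u, of G x n] by (simp only: add_0)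
    then show "srw.eP G x n \<in> measurable (srw.C G x 0 n ?u) (subprob_algebra (?M (Suc n)))"
      using srw.measurable_eP[of G x n] measurable_cong_sets by blast
  qed (rule S)
  also have "\<dots> = (\<integral>\<^sup>+\<omega>. emeasure (srw_kernel G x n p) {p n} * indicator {restrict p {0..<n}} \<omega>
      \<partial>srw.C G x 0 n ?u)"
    using srw.space_C[OF u, of G x n] K by (intro nn_integral_cong) simp
  also have "\<dots> = emeasure (srw_kernel G x n p) {p n} *
      emeasure (srw.C G x 0 n ?u) {restrict p {0..<n}}"
    using srw.sets_C[OF u, of G x n] S[of n] by (intro nn_integral_cmult_indicator) simp
  finally show ?case by (simp only: Suc.IH prod.lessThan_Suc mult.commute)
qed

text \<open>
  The finite-dimensional distributions, which characterise \<open>srw_law G x\<close> as the law of the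
  Markov chain started at \<open>x\<close> with transition kernel \<open>srw_step G\<close>.
\<close>

lemma emeasure_srw_law_path:
  fixes p :: "nat \<Rightarrow> 'v::countable"
  shows "emeasure (srw_law G x) {\<omega>. \<forall>i\<le>n. \<omega> i = p i} =
           (if p 0 = x then \<Prod>i<n. ennreal (pmf (srw_step G (p i)) (p (Suc i))) else 0)"
proof -
  let ?J = "{0..<Suc n}"
  let ?X = "{restrict p ?J}"
  have "?X = PiE ?J (\<lambda>i. {p i})"
    using PiE_singleton[of "restrict p ?J" ?J]
      PiE_cong[of ?J "\<lambda>i. {restrict p ?J i}" "\<lambda>i. {p i}"] by simp
  then have X: "?X \<in> sets (PiM ?J (\<lambda>_. count_space UNIV))"
    by (auto intro!: sets_PiM_I_finite)
  have "{\<omega>. \<forall>i\<le>n. \<omega> i = p i} = srw.PF.emb UNIV ?J ?X"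
    by (auto simp: prod_emb_def space_PiM fun_eq_iff restrict_def less_Suc_eq_le) metis
  then have "emeasure (srw_law G x) {\<omega>. \<forall>i\<le>n. \<omega> i = p i} = emeasure (srw.CI G x ?J) ?X"
    using srw.lim[OF _ X, of G x] by (simp add: srw_law_def)
  also have "\<dots> = emeasure (srw.C G x 0 (Suc n) (\<lambda>_. undefined)) (srw.PF.emb ?J ?J ?X)"
    by (rule srw.emeasure_CI) (use X in auto)
  also have "srw.PF.emb ?J ?J ?X = ?X"
    using X sets.sets_into_space[OF X] by (simp add: prod_emb_id space_PiM)
  also have "emeasure (srw.C G x 0 (Suc n) (\<lambda>_. undefined)) ?X =
      (\<Prod>i<Suc n. emeasure (srw_kernel G x i p) {p i})"
    by (rule emeasure_srw_C)
  also have "\<dots> = (if p 0 = x then \<Prod>i<n. ennreal (pmf (srw_step G (p i)) (p (Suc i))) else 0)"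
    by (subst prod.lessThan_Suc_shift) (auto simp: emeasure_pmf_single indicator_def)
  finally show ?thesis .
qed

lemma finite_nbrs_Comb_Z2: "finite (nbrs (Comb Z2 f) v)"
proof (rule finite_subset)
  show "nbrs (Comb Z2 f) v \<subseteq>
      ({fst (fst v) - 1..fst (fst v) + 1} \<times> {snd (fst v) - 1..snd (fst v) + 1}) \<times> {..snd v + 1}"
    by (cases v) (auto simp: nbrs_def Comb_def Z2_def doubleton_eq_iff)
qed auto

lemma nbrs_Comb_Z2_nonempty:
  assumes "v \<in> verts (Comb Z2 f)"
  shows "nbrs (Comb Z2 f) v \<noteq> {}"
proof (cases v)
  case (Pair z n)
  show ?thesis
  proof (cases n)
    case 0
    have "\<exists>u v. {z, (fst z + 1, snd z)} = {u, v} \<and> \<bar>fst u - fst v\<bar> + \<bar>snd u - snd v\<bar> = 1"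
      by (intro exI[of _ z] exI[of _ "(fst z + 1, snd z)"]) simp
    then have "{z, (fst z + 1, snd z)} \<in> edges Z2"
      unfolding Z2_def by simp
    then have "{(z, 0::nat), ((fst z + 1, snd z), 0)} \<in> edges (Comb Z2 f)"
      unfolding Comb_def ugraph.simps by blast
    then show ?thesis using Pair 0 by (auto simp: nbrs_def)
  next
    case (Suc m)
    have "enat m \<le> f z"
      using assms Pair Suc by (auto simp: Comb_def intro: order_trans[of "enat m" "enat n"])
    then have "{(z, n), (z, m)} \<in> edges (Comb Z2 f)"
      using assms Pair Suc unfolding Comb_def ugraph.simps
      by (intro UnI2 CollectI exI[of _ z] exI[of _ n] exI[of _ m]) simp
    then show ?thesis unfolding Pair nbrs_def by blast
  qed
qed

lemma sets_infinitely_many_collisions: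
  fixes x y :: "'v::countable"
  shows "{w \<in> space (two_walks G x y). num_collisions (fst w) (snd w) = \<infinity>} \<in> sets (two_walks G x y)"
proof -
  have c: "(\<lambda>\<omega>. \<omega> n) \<in> measurable (srw_law G z) (count_space UNIV)" for z :: 'v and n
    by (subst measurable_cong_sets[OF sets_srw_law refl]) (rule measurable_component_singleton, simp)
  have 1: "(\<lambda>w. fst w n) \<in> measurable (two_walks G x y) (count_space UNIV)" for n
    unfolding two_walks_def by (rule measurable_compose[OF measurable_fst c])
  have 2: "(\<lambda>w. snd w n) \<in> measurable (two_walks G x y) (count_space UNIV)" for n
    unfolding two_walks_def by (rule measurable_compose[OF measurable_snd c])
  let ?P = "two_walks G x y"
  have e: "{w \<in> space ?P. fst w n = snd w n} \<in> sets ?P" for n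
  proof -
    have "{w \<in> space ?P. fst w n = snd w n} =
        (\<Union>v. ((\<lambda>w. fst w n) -` {v} \<inter> space ?P) \<inter> ((\<lambda>w. snd w n) -` {v} \<inter> space ?P))"
      by auto
    also have "\<dots> \<in> sets ?P"
      by (intro sets.countable_UN'' sets.Int measurable_sets[OF 1] measurable_sets[OF 2]) auto
    finally show ?thesis .
  qed
  have "{w \<in> space ?P. num_collisions (fst w) (snd w) = \<infinity>} =
      (\<Inter>m. \<Union>n\<in>{m..}. {w \<in> space ?P. fst w n = snd w n})"
    by (auto simp: num_collisions_def infinite_nat_iff_unbounded_le)
  also have "\<dots> \<in> sets ?P"
  proof (rule sets.countable_INT'')
    have "space ?P = UNIV" by (simp add: two_walks_def space_pair_measure space_srw_law)
    then show "UNIV \<in> sets ?P" using sets.top[of ?P] by simp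
  qed (use e in \<open>auto intro!: sets.countable_UN'\<close>)
  finally show ?thesis .
qed

end

theory Submission
  imports Defs "HOL-Real_Asymp.Real_Asymp"
begin

text \<open>
  Everything rests on a first-collision decomposition: after a first collision at \<open>v\<close> the expected
  number of further (weighted) collisions is that of two walks started at \<open>(v, v)\<close>, so a collision
  probability is an expected number of collisions divided by a bound on the latter. By reversibility
  expected numbers of collisions are sums of return probabilities \<open>p\<^bsub>2n\<^esub>\<close> of one walk. These are
  controlled by potentials on the comb built from the truncated Green function of the planar walk
  (constant along the teeth) and, on the tooth of the target, a concave function of the height.

  For \<open>\<gamma> \<le> 1\<close> the teeth within distance \<open>T\<close> have height \<open>O(log T)\<close>, so from every \<open>(v, v)\<close> there are
  \<open>O(log T)\<close> collisions expected up to time \<open>T\<close>, whereas from any pair of equal parity there are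
  eventually at least \<open>c log T\<close>. So the two walks meet with probability bounded below from every
  such pair, hence almost surely, hence infinitely often.

  For \<open>\<gamma> > 1\<close> collisions at height \<open>h\<close> get weight \<open>1 / (h + 1)\<close>, for which the expected total weight
  from \<open>(v, v)\<close> is bounded below. Since \<open>p\<^sub>n(x, v) = O(log log n / n)\<close>, and the mean weight seen by the
  walk at time about \<open>n\<close> is \<open>O(log log n / (log n)\<^sup>\<gamma>)\<close> because heights are nearly uniform on teeth of
  height about \<open>(log n)\<^sup>\<gamma>\<close>, the total expected weight is finite.
\<close>

section \<open>Averaging operators and kernels\<close>

text \<open>The obstacle: the comb is recurrent for every exponent, so the plain number of
  collisions has infinite expectation in both cases and cannot separate them. A collision high in a
  tooth brings many others with it, and the weight removes this clustering. The full planar Green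
  function diverges, so it is cut at a time \<open>M\<close>, and its value at the end of the walk
  has to be controlled. This is done by bootstrapping: a crude bound on occupation times, of the
  order of height plus log time, bounds the time spent in any one tooth. As the cut potential has
  total mass at most \<open>M\<close> over the plane, its mean along \<open>T\<close> steps is at
  most polylogarithmic times \<open>M / T\<close>. With \<open>M\<close> near the square root of
  \<open>T\<close> this vanishes while a fixed share of the logarithm survives. With
  \<open>M\<close> equal to \<open>T\<close> over a power of \<open>log T\<close>, what remains is
  the log log factor, which the strict inequality in the second case absorbs.\<close>

text \<open>Where \<open>N x\<close> is empty or infinite, \<open>avg N u x\<close> is 0, so \<open>avg N\<close> is a positive operator without
  any assumption on \<open>N\<close>.\<close>

definition avg :: "('a \<Rightarrow> 'a set) \<Rightarrow> ('a \<Rightarrow> real) \<Rightarrow> 'a \<Rightarrow> real" where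
  "avg N u x = (\<Sum>w\<in>N x. u w) / real (card (N x))"

abbreviation iter :: "('a \<Rightarrow> 'a set) \<Rightarrow> nat \<Rightarrow> ('a \<Rightarrow> real) \<Rightarrow> 'a \<Rightarrow> real" where
  "iter N n \<equiv> avg N ^^ n"

definition ker :: "('a \<Rightarrow> 'a set) \<Rightarrow> nat \<Rightarrow> 'a \<Rightarrow> 'a \<Rightarrow> real" where
  "ker N n x y = iter N n (indicat_real {y}) x"

primrec reach :: "('a \<Rightarrow> 'a set) \<Rightarrow> nat \<Rightarrow> 'a \<Rightarrow> 'a set" where
  "reach N 0 x = {x}"
| "reach N (Suc n) x = (\<Union>w\<in>N x. reach N n w)"

lemma iter_Suc: "iter N (Suc n) u x = avg N (iter N n u) x"
  by simp

lemma iter_Suc2: "iter N (Suc n) u x = iter N n (avg N u) x"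
  by (simp add: funpow_swap1)

lemma iter_add: "iter N (m + n) u x = iter N m (iter N n u) x"
  by (simp add: funpow_add)

lemma avg_cong: "(\<And>w. w \<in> N x \<Longrightarrow> u w = v w) \<Longrightarrow> avg N u x = avg N v x"
  by (simp add: avg_def)

lemma avg_mono: "(\<And>w. w \<in> N x \<Longrightarrow> u w \<le> v w) \<Longrightarrow> avg N u x \<le> avg N v x"
  by (simp add: avg_def divide_right_mono sum_mono)

lemma avg_add: "avg N (\<lambda>w. u w + v w) x = avg N u x + avg N v x"
  by (simp add: avg_def sum.distrib add_divide_distrib)

lemma avg_diff: "avg N (\<lambda>w. u w - v w) x = avg N u x - avg N v x"
  by (simp add: avg_def sum_subtractf diff_divide_distrib)

lemma avg_cmult: "avg N (\<lambda>w. c * u w) x = c * avg N u x"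
  by (simp add: avg_def sum_distrib_left)

lemma avg_sum: "avg N (\<lambda>w. \<Sum>i\<in>I. u i w) x = (\<Sum>i\<in>I. avg N (u i) x)"
  by (simp add: avg_def sum_divide_distrib sum.swap[of _ "N x" I])

lemma avg_const: "finite (N x) \<Longrightarrow> N x \<noteq> {} \<Longrightarrow> avg N (\<lambda>_. c) x = c"
  by (simp add: avg_def)

lemma avg_zero [simp]: "avg N (\<lambda>_. 0) x = 0"
  by (simp add: avg_def)

lemma iter_mono_reach:
  "(\<And>w. w \<in> reach N n x \<Longrightarrow> u w \<le> v w) \<Longrightarrow> iter N n u x \<le> iter N n v x"
proof (induction n arbitrary: x)
  case (Suc n)
  show ?case unfolding iter_Suc
    by (rule avg_mono, rule Suc.IH, rule Suc.prems) auto
qed simp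

lemma iter_cong_reach:
  "(\<And>w. w \<in> reach N n x \<Longrightarrow> u w = v w) \<Longrightarrow> iter N n u x = iter N n v x"
  by (intro antisym iter_mono_reach) auto

lemma iter_mono: "(\<And>w. u w \<le> v w) \<Longrightarrow> iter N n u x \<le> iter N n v x"
  by (rule iter_mono_reach)

lemma iter_add_fun: "iter N n (\<lambda>w. u w + v w) x = iter N n u x + iter N n v x"
proof (induction n arbitrary: x)
  case (Suc n)
  show ?case unfolding iter_Suc by (subst avg_cong[OF Suc.IH]) (simp add: avg_add)
qed simp

lemma iter_cmult: "iter N n (\<lambda>w. c * u w) x = c * iter N n u x"
proof (induction n arbitrary: x)
  case (Suc n)
  show ?case unfolding iter_Suc by (subst avg_cong[OF Suc.IH]) (simp add: avg_cmult)
qed simp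

lemma iter_diff: "iter N n (\<lambda>w. u w - v w) x = iter N n u x - iter N n v x"
  using iter_add_fun[of n N u "\<lambda>w. (-1) * v w" x] iter_cmult[of n N "-1" v x] by simp

lemma iter_sum: "iter N n (\<lambda>w. \<Sum>i\<in>I. u i w) x = (\<Sum>i\<in>I. iter N n (u i) x)"
proof (induction n arbitrary: x)
  case (Suc n)
  show ?case unfolding iter_Suc by (subst avg_cong[OF Suc.IH]) (simp add: avg_sum)
qed simp

lemma iter_zero [simp]: "iter N n (\<lambda>_. 0) x = 0"
  using iter_cmult[of n N 0 "\<lambda>_. 0" x] by simp

lemma iter_nonneg: "(\<And>w. 0 \<le> u w) \<Longrightarrow> 0 \<le> iter N n u x"
  using iter_mono[of "\<lambda>_. 0" u n N x] by simp

lemma avg_le_const: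
  assumes "\<And>w. w \<in> N x \<Longrightarrow> u w \<le> c" "0 \<le> c"
  shows "avg N u x \<le> c"
proof (cases "finite (N x) \<and> N x \<noteq> {}")
  case True
  then show ?thesis using avg_mono[of N x u "\<lambda>_. c"] assms avg_const[of N x c] by auto
next
  case False
  then show ?thesis using assms by (auto simp: avg_def)
qed

lemma iter_le_const:
  "(\<And>w. w \<in> reach N n x \<Longrightarrow> u w \<le> c) \<Longrightarrow> 0 \<le> c \<Longrightarrow> iter N n u x \<le> c"
proof (induction n arbitrary: x)
  case (Suc n)
  show ?case unfolding iter_Suc
    by (rule avg_le_const, rule Suc.IH) (use Suc.prems in auto)
qed auto

lemma ker_nonneg: "0 \<le> ker N n x y"
  unfolding ker_def by (rule iter_nonneg) simp

lemma ker_Suc: "ker N (Suc n) x y = avg N (\<lambda>w. ker N n w y) x"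
  by (simp add: ker_def)

lemma finite_reach: "(\<And>x. finite (N x)) \<Longrightarrow> finite (reach N n x)"
  by (induction n arbitrary: x) auto

lemma iter_expand:
  assumes "finite S" "reach N n x \<subseteq> S"
  shows "iter N n u x = (\<Sum>v\<in>S. u v * ker N n x v)"
proof -
  have "iter N n u x = iter N n (\<lambda>w. \<Sum>v\<in>S. u v * indicat_real {v} w) x"
  proof (rule iter_cong_reach)
    fix w assume "w \<in> reach N n x"
    then have "w \<in> S" using assms by auto
    then show "u w = (\<Sum>v\<in>S. u v * indicat_real {v} w)"
      using assms by (simp add: indicator_def if_distrib sum.delta cong: if_cong)
  qed
  also have "\<dots> = (\<Sum>v\<in>S. u v * ker N n x v)"
    by (simp add: iter_sum iter_cmult ker_def)
  finally show ?thesis .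
qed

lemma chapman_kolmogorov:
  assumes "finite S" "reach N m x \<subseteq> S"
  shows "ker N (m + n) x y = (\<Sum>v\<in>S. ker N m x v * ker N n v y)"
  unfolding ker_def iter_add using iter_expand[OF assms, of "iter N n (indicat_real {y})"]
  by (simp add: ker_def mult.commute)

text \<open>One-sided Dynkin formula: the iterates of \<open>\<phi> - avg N \<phi>\<close> telescope
  to boundary terms. The slack \<open>k\<close> admits potentials that solve their equation only up
  to an error.\<close>

lemma sum_iter_le_potential:
  assumes "\<And>n w. n < T \<Longrightarrow> w \<in> reach N n x \<Longrightarrow> u w \<le> \<phi> w - avg N \<phi> w + k w"
  shows "(\<Sum>n<T. iter N n u x) \<le> \<phi> x - iter N T \<phi> x + (\<Sum>n<T. iter N n k x)"
  using assms
proof (induction T)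
  case (Suc T)
  have "iter N T u x \<le> iter N T (\<lambda>w. (\<phi> w - avg N \<phi> w) + k w) x"
    by (rule iter_mono_reach) (use Suc.prems in auto)
  also have "\<dots> = iter N T \<phi> x - iter N (Suc T) \<phi> x + iter N T k x"
    by (simp only: iter_add_fun iter_diff iter_Suc2)
  finally show ?case using Suc.IH Suc.prems by (fastforce simp: less_Suc_eq)
qed simp

lemma sum_iter_ge_potential:
  assumes "\<And>n w. n < T \<Longrightarrow> w \<in> reach N n x \<Longrightarrow> \<phi> w - avg N \<phi> w \<le> u w"
  shows "\<phi> x - iter N T \<phi> x \<le> (\<Sum>n<T. iter N n u x)"
  using assms
proof (induction T)
  case (Suc T)
  have "iter N T (\<lambda>w. \<phi> w - avg N \<phi> w) x \<le> iter N T u x"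
    by (rule iter_mono_reach) (use Suc.prems in auto)
  then have "iter N T \<phi> x - iter N (Suc T) \<phi> x \<le> iter N T u x"
    by (simp only: iter_diff iter_Suc2)
  then show ?case using Suc.IH Suc.prems by (fastforce simp: less_Suc_eq)
qed simp

text \<open>\<open>prodN\<close> is the neighbour function of a pair of independent walks.\<close>

definition prodN :: "('a \<Rightarrow> 'a set) \<Rightarrow> 'a \<times> 'a \<Rightarrow> ('a \<times> 'a) set" where
  "prodN N z = N (fst z) \<times> N (snd z)"

lemma avg_prodN_times:
  "avg (prodN N) (\<lambda>z. \<alpha> (fst z) * \<beta> (snd z)) (x, y) = avg N \<alpha> x * avg N \<beta> y"
  by (simp add: avg_def prodN_def sum_product sum.cartesian_product card_cartesian_product case_prod_beta)

lemma iter_prodN_times: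
  "iter (prodN N) n (\<lambda>z. \<alpha> (fst z) * \<beta> (snd z)) (x, y) = iter N n \<alpha> x * iter N n \<beta> y"
proof (induction n arbitrary: x y)
  case (Suc n)
  have "iter (prodN N) (Suc n) (\<lambda>z. \<alpha> (fst z) * \<beta> (snd z)) (x, y)
     = avg (prodN N) (\<lambda>z. iter N n \<alpha> (fst z) * iter N n \<beta> (snd z)) (x, y)"
    unfolding iter_Suc by (rule avg_cong) (auto simp: Suc.IH)
  then show ?case by (simp add: avg_prodN_times)
qed simp

lemma reach_prodN: "reach (prodN N) n (x, y) \<subseteq> reach N n x \<times> reach N n y"
  by (induction n arbitrary: x y) (fastforce simp: prodN_def)+

text \<open>Averaged \<open>n\<close> times with \<open>prodN N\<close> from \<open>(x, y)\<close>,
  it gives the expected weight of a collision at time \<open>n\<close>.\<close>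

definition diagw :: "('a \<Rightarrow> real) \<Rightarrow> 'a \<times> 'a \<Rightarrow> real" where
  "diagw w z = (if fst z = snd z then w (fst z) else 0)"

lemma iter_diagw:
  assumes "finite S" "reach N n x \<subseteq> S"
  shows "iter (prodN N) n (diagw w) (x, y) = (\<Sum>v\<in>S. w v * (ker N n x v * ker N n y v))"
proof -
  have "iter (prodN N) n (diagw w) (x, y) =
     iter (prodN N) n (\<lambda>z. \<Sum>v\<in>S. w v * (indicat_real {v} (fst z) * indicat_real {v} (snd z))) (x, y)"
  proof (rule iter_cong_reach)
    fix z assume "z \<in> reach (prodN N) n (x, y)"
    then have "fst z \<in> S" using reach_prodN[of N n x y] assms by (auto simp: mem_Times_iff dest!: subsetD[OF reach_prodN])
    then show "diagw w z = (\<Sum>v\<in>S. w v * (indicat_real {v} (fst z) * indicat_real {v} (snd z)))"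
      using assms by (subst sum.remove[of S "fst z"]) (auto simp: diagw_def indicator_def intro!: sum.neutral)
  qed
  also have "\<dots> = (\<Sum>v\<in>S. w v * (ker N n x v * ker N n y v))"
    by (simp add: iter_sum iter_cmult iter_prodN_times ker_def)
  finally show ?thesis .
qed

section \<open>Reversibility and its consequences for return probabilities\<close>

locale sym_nbrs =
  fixes N :: "'a \<Rightarrow> 'a set"
  assumes fin: "finite (N x)" and sym: "w \<in> N x \<longleftrightarrow> x \<in> N w"
begin

abbreviation deg :: "'a \<Rightarrow> real" where "deg x \<equiv> real (card (N x))"

lemma deg_pos: "w \<in> N x \<Longrightarrow> 0 < deg x" "w \<in> N x \<Longrightarrow> 0 < deg w"
  using fin sym by (auto simp: card_gt_0_iff)

text \<open>The induction turns the first step out of \<open>x\<close> into a last step into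
  \<open>x\<close>: symmetry of \<open>N\<close> identifies the sum over \<open>w\<close> with
  \<open>avg N (indicat_real {x})\<close>.\<close>

lemma ker_reversible: "deg x * ker N n x y = deg y * ker N n y x"
proof (induction n arbitrary: x y)
  case 0
  then show ?case by (simp add: ker_def indicator_def)
next
  case (Suc n)
  have "deg x * ker N (Suc n) x y = (\<Sum>w\<in>N x. ker N n w y)"
    using fin[of x] by (auto simp: ker_Suc avg_def)
  also have "\<dots> = (\<Sum>w\<in>N x. deg y * (ker N n y w / deg w))"
  proof (rule sum.cong)
    fix w assume "w \<in> N x"
    then have "0 < deg w" using deg_pos by blast
    then show "ker N n w y = deg y * (ker N n y w / deg w)"
      using Suc[of w y] by (simp add: field_simps)
  qed simp
  also have "\<dots> = deg y * iter N n (\<lambda>v. \<Sum>w\<in>N x. (1 / deg w) * indicat_real {w} v) y"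
    unfolding iter_sum iter_cmult ker_def sum_distrib_left by simp
  also have "(\<lambda>v. \<Sum>w\<in>N x. (1 / deg w) * indicat_real {w} v) = avg N (indicat_real {x})"
  proof
    fix v
    have "(\<Sum>w\<in>N x. (1 / deg w) * indicat_real {w} v) = (\<Sum>w\<in>N x. if w = v then 1 / deg v else 0)"
      by (rule sum.cong) (auto simp: indicator_def)
    moreover have "avg N (indicat_real {x}) v = (\<Sum>w\<in>N v. if w = x then 1 else 0) / deg v"
      unfolding avg_def by (intro arg_cong2[where f = "(/)"] sum.cong) (auto simp: indicator_def)
    ultimately show "(\<Sum>w\<in>N x. (1 / deg w) * indicat_real {w} v) = avg N (indicat_real {x}) v"
      using fin sym[of x v] by (simp add: sum.delta)
  qed
  also have "iter N n (avg N (indicat_real {x})) y = ker N (Suc n) y x"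
    unfolding ker_def iter_Suc2 ..
  finally show ?case .
qed

text \<open>Chapman-Kolmogorov at the midpoint, then reversal of one half: even kernels form a Gram
  matrix for the degree-weighted inner product.\<close>

lemma deg_ker_even:
  assumes "finite S" "reach N n y \<subseteq> S"
  shows "(\<Sum>v\<in>S. deg v * ker N n v x * ker N n v y) = deg y * ker N (2 * n) y x"
proof -
  have "deg y * ker N (n + n) y x = (\<Sum>v\<in>S. deg y * ker N n y v * ker N n v x)"
    by (simp add: chapman_kolmogorov[OF assms] sum_distrib_left mult.assoc)
  also have "\<dots> = (\<Sum>v\<in>S. deg v * ker N n v x * ker N n v y)"
    by (rule sum.cong) (simp_all add: ker_reversible mult_ac)
  finally show ?thesis by (simp add: mult_2)
qed

lemma avg_square_le: "deg x * (avg N u x)\<^sup>2 \<le> (\<Sum>w\<in>N x. (u w)\<^sup>2)"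
proof (cases "N x = {}")
  case False
  then have p: "0 < deg x" using fin by (simp add: card_gt_0_iff)
  have "(\<Sum>w\<in>N x. u w)\<^sup>2 \<le> (\<Sum>w\<in>N x. (u w)\<^sup>2) * deg x"
    using Cauchy_Schwarz_ineq_sum[of "u" "\<lambda>_. 1" "N x"] by simp
  then show ?thesis using p by (simp add: avg_def power_divide field_simps power2_eq_square)
qed (simp add: avg_def)

text \<open>Up to the factor \<open>deg x\<close> the two sides are the squared degree-weighted
  norms of \<open>avg N g\<close> and \<open>g\<close>, and averaging contracts this norm:
  Cauchy-Schwarz at each vertex, then exchange of sums.\<close>

lemma ker_even_decreasing:
  assumes "0 < deg x"
  shows "ker N (2 * Suc n) x x \<le> ker N (2 * n) x x"
proof -
  define g where "g v = ker N n v x" for v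
  define S where "S = reach N (Suc n) x \<union> reach N n x"
  \<comment> \<open>Adding the neighbours of \<open>S\<close> lets the inner sums range over one
    fixed finite set, so that they can be swapped.\<close>
  define S' where "S' = S \<union> (\<Union>u\<in>S. N u)"
  have S: "finite S" "finite S'" "S \<subseteq> S'" using finite_reach[OF fin] fin by (auto simp: S_def S'_def)
  have "deg x * ker N (2 * Suc n) x x = (\<Sum>v\<in>S. deg v * (avg N g v)\<^sup>2)"
    using deg_ker_even[of S "Suc n" x x] S unfolding S_def g_def power2_eq_square ker_Suc[symmetric]
    by (simp only: mult.assoc Un_upper1)
  also have "\<dots> \<le> (\<Sum>v\<in>S. \<Sum>w\<in>N v. (g w)\<^sup>2)" by (intro sum_mono avg_square_le)
  also have "\<dots> = (\<Sum>v\<in>S. \<Sum>w\<in>S'. (if w \<in> N v then (g w)\<^sup>2 else 0))"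
    by (intro sum.cong refl sum.mono_neutral_cong_left) (use S in \<open>auto simp: S'_def\<close>)
  also have "\<dots> = (\<Sum>w\<in>S'. \<Sum>v\<in>S. (if w \<in> N v then (g w)\<^sup>2 else 0))" by (rule sum.swap)
  also have "\<dots> \<le> (\<Sum>w\<in>S'. deg w * (g w)\<^sup>2)"
  proof (rule sum_mono)
    fix w
    have "(\<Sum>v\<in>S. (if w \<in> N v then (g w)\<^sup>2 else 0)) = (\<Sum>v\<in>S \<inter> N w. (g w)\<^sup>2)"
      using S by (intro sum.mono_neutral_cong_right) (auto simp: sym)
    also have "\<dots> \<le> (\<Sum>v\<in>N w. (g w)\<^sup>2)" by (rule sum_mono2) (use fin in auto)
    finally show "(\<Sum>v\<in>S. (if w \<in> N v then (g w)\<^sup>2 else 0)) \<le> deg w * (g w)\<^sup>2" by simp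
  qed
  also have "\<dots> = deg x * ker N (2 * n) x x"
    using deg_ker_even[of S' n x x] S by (simp add: S_def g_def power2_eq_square mult.assoc)
  finally show ?thesis using assms by simp
qed

lemma ker_even_antimono:
  assumes "0 < deg x" "m \<le> n"
  shows "ker N (2 * n) x x \<le> ker N (2 * m) x x"
  using assms(2) ker_even_decreasing[OF assms(1)] by (rule lift_Suc_antimono_le[where f = "\<lambda>n. ker N (2 * n) x x", rotated]) 

text \<open>Expansion of the nonnegative squared norm of the difference of two half-time
  kernels.\<close>

lemma ker_even_le:
  assumes "0 < deg x"
  shows "2 * deg x * ker N (2 * n) x y \<le> deg x * ker N (2 * n) x x + deg y * ker N (2 * n) y y"
proof -
  define S where "S = reach N n x \<union> reach N n y"
  have S: "finite S" "reach N n x \<subseteq> S" "reach N n y \<subseteq> S" using finite_reach[OF fin] by (auto simp: S_def)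
  have "0 \<le> (\<Sum>v\<in>S. deg v * (ker N n v x - ker N n v y)\<^sup>2)" by (intro sum_nonneg) simp
  also have "\<dots> = (\<Sum>v\<in>S. deg v * ker N n v x * ker N n v x) + (\<Sum>v\<in>S. deg v * ker N n v y * ker N n v y)
      - 2 * (\<Sum>v\<in>S. deg v * ker N n v y * ker N n v x)"
    by (simp add: sum_distrib_left sum.distrib[symmetric] sum_subtractf[symmetric] power2_eq_square algebra_simps)
  finally show ?thesis using S by (simp add: deg_ker_even)
qed

end

section \<open>The Markov property of the path law\<close>

abbreviation path_space :: "(nat \<Rightarrow> 'v) measure" where
  "path_space \<equiv> PiM UNIV (\<lambda>_. count_space UNIV)"

text \<open>By countability, an event about coordinate \<open>i\<close> is a countable union of
  cylinders prescribing the whole initial segment. The empty set is added to make the generator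
  intersection-stable.\<close>

lemma sigma_sets_cylinders:
  "sets (path_space :: (nat \<Rightarrow> 'v::countable) measure) =
     sigma_sets UNIV (insert {} {{\<omega>. \<forall>i\<le>n. \<omega> i = p i} | n p. True})" (is "_ = sigma_sets UNIV ?E")
proof -
  have sp: "(\<Pi>\<^sub>E i\<in>(UNIV::nat set). space (count_space (UNIV::'v set))) = UNIV"
    by simp
  have "{\<omega> :: nat \<Rightarrow> 'v. \<omega> i \<in> A} \<in> sigma_sets UNIV ?E" for i A
  proof -
    define B where "B = (\<lambda>l. {\<omega> :: nat \<Rightarrow> 'v. \<forall>j\<le>i. \<omega> j = l ! j}) ` {l. length l = Suc i \<and> l ! i \<in> A}"
    have "{\<omega> :: nat \<Rightarrow> 'v. \<omega> i \<in> A} = \<Union>B"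
    proof (intro set_eqI iffI)
      fix \<omega> :: "nat \<Rightarrow> 'v" assume "\<omega> \<in> {\<omega>. \<omega> i \<in> A}"
      then show "\<omega> \<in> \<Union>B"
        unfolding B_def by (intro UnionI[OF imageI[of "map \<omega> [0..<Suc i]"]]) (auto simp del: upt_Suc)
    qed (auto simp: B_def)
    also have "\<dots> \<in> sigma_sets UNIV ?E"
      by (rule sigma_sets_UNION) (auto simp: B_def intro!: sigma_sets.Basic)
    finally show ?thesis .
  qed
  then have "sets (path_space :: (nat \<Rightarrow> 'v) measure) \<subseteq> sigma_sets UNIV ?E"
    unfolding sets_PiM_single sp by (intro sigma_sets_mono) auto
  moreover have "sigma_sets UNIV ?E \<subseteq> sets (path_space :: (nat \<Rightarrow> 'v) measure)"
  proof -
    have "{\<omega> :: nat \<Rightarrow> 'v. \<forall>i\<le>n. \<omega> i = p i} \<in> sets path_space" for n p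
    proof -
      have "{\<omega> \<in> space (path_space :: (nat \<Rightarrow> 'v) measure). \<forall>i\<le>n. \<omega> i = p i} \<in> sets path_space"
        by measurable
      then show ?thesis by (simp add: space_PiM)
    qed
    then have "?E \<subseteq> sets (path_space :: (nat \<Rightarrow> 'v) measure)" by auto
    from sets.sigma_sets_subset[OF this] show ?thesis by (simp add: space_PiM)
  qed
  ultimately show ?thesis by blast
qed

lemma Int_stable_cylinders:
  "Int_stable (insert {} {{\<omega> :: nat \<Rightarrow> 'v. \<forall>i\<le>n. \<omega> i = p i} | n p. True})" (is "Int_stable ?E")
proof -
  have *: "{\<omega> :: nat \<Rightarrow> 'v. \<forall>i\<le>n. \<omega> i = p i} \<inter> {\<omega>. \<forall>i\<le>m. \<omega> i = q i} \<in> ?E" if "n \<le> m" for n m p q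
  proof (cases "\<forall>i\<le>n. q i = p i")
    case True
    then have "{\<omega> :: nat \<Rightarrow> 'v. \<forall>i\<le>n. \<omega> i = p i} \<inter> {\<omega>. \<forall>i\<le>m. \<omega> i = q i} = {\<omega>. \<forall>i\<le>m. \<omega> i = q i}"
      using that by auto
    then show ?thesis by (simp only:) blast
  next
    case False
    then have "{\<omega> :: nat \<Rightarrow> 'v. \<forall>i\<le>n. \<omega> i = p i} \<inter> {\<omega>. \<forall>i\<le>m. \<omega> i = q i} = {}"
      using that by auto
    then show ?thesis by auto
  qed
  show ?thesis
  proof (rule Int_stableI)
    fix A B assume A: "A \<in> ?E" and B: "B \<in> ?E"
    show "A \<inter> B \<in> ?E"
    proof (cases "A = {} \<or> B = {}")
      case False
      then obtain n p m q where AB: "A = {\<omega>. \<forall>i\<le>n. \<omega> i = p i}" "B = {\<omega>. \<forall>i\<le>m. \<omega> i = q i}"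
        using A B by blast
      show ?thesis
      proof (cases "n \<le> m")
        case True then show ?thesis using *[of n m p q] AB by simp
      next
        case False then show ?thesis using *[of m n q p] AB by (simp add: Int_commute)
      qed
    qed auto
  qed
qed

lemma all_le_Suc0: "(\<forall>i\<le>Suc m. P i) \<longleftrightarrow> P 0 \<and> (\<forall>i\<le>m. P (Suc i))"
  by (metis Suc_le_mono not0_implies_Suc zero_le)

lemma measurable_srw_law: "srw_law G \<in> measurable (measure_pmf p) (subprob_algebra path_space)"
  by (auto simp: measurable_cong_sets[OF sets_measure_pmf_count_space refl] space_subprob_algebra
      sets_srw_law prob_space_imp_subprob_space[OF prob_space_srw_law])

lemma measurable_shift: "case_nat x \<in> measurable path_space path_space"
  by (rule measurable_case_nat') auto

text \<open>Markov property at time 1. The two measures are compared on initial-segment cylinders,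
  where \<open>emeasure_srw_law_path\<close> gives a product whose first factor is the step out of
  \<open>x\<close>.\<close>

lemma srw_law_step:
  fixes G :: "'v::countable ugraph"
  shows "srw_law G x = distr (measure_pmf (srw_step G x) \<bind> srw_law G) path_space (case_nat x)"
    (is "_ = ?R")
proof -
  let ?B = "measure_pmf (srw_step G x) \<bind> srw_law G"
  let ?E = "insert {} {{\<omega> :: nat \<Rightarrow> 'v. \<forall>i\<le>n. \<omega> i = p i} | n p. True}"
  have sB: "sets ?B = sets path_space"
    by (rule sets_bind) (auto simp: sets_srw_law)
  have shift: "case_nat x \<in> measurable ?B path_space"
    by (subst measurable_cong_sets[OF sB refl]) (rule measurable_shift)
  have cyl: "{\<omega> :: nat \<Rightarrow> 'v. \<forall>i\<le>n. \<omega> i = p i} \<in> sets path_space" for n p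
    unfolding sigma_sets_cylinders by (intro sigma_sets.Basic) blast
  have spB: "space ?B = UNIV"
    using sets_eq_imp_space_eq[OF sB] by (simp add: space_PiM)
  have R: "emeasure ?R A = (\<integral>\<^sup>+ y. emeasure (srw_law G y) {\<omega>. case_nat x \<omega> \<in> A} \<partial>srw_step G x)"
    if A: "A \<in> sets path_space" for A
  proof -
    have v: "{\<omega>. case_nat x \<omega> \<in> A} \<in> sets path_space"
      using measurable_sets[OF measurable_shift A] by (simp add: space_PiM vimage_def)
    have "emeasure ?R A = emeasure ?B {\<omega>. case_nat x \<omega> \<in> A}"
      using emeasure_distr[OF shift A] spB by (simp add: vimage_def)
    also have "\<dots> = (\<integral>\<^sup>+ y. emeasure (srw_law G y) {\<omega>. case_nat x \<omega> \<in> A} \<partial>srw_step G x)"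
      by (rule emeasure_bind[OF _ measurable_srw_law v]) auto
    finally show ?thesis .
  qed
  show ?thesis
  proof (rule measure_eqI_generator_eq[OF Int_stable_cylinders, where \<Omega> = UNIV and
        A = "\<lambda>k. {\<omega>. \<forall>i\<le>0. \<omega> i = from_nat k}"])
    show "sets (srw_law G x) = sigma_sets UNIV ?E" "sets ?R = sigma_sets UNIV ?E"
      unfolding sigma_sets_cylinders[symmetric] by (auto simp: sets_srw_law)
    show "range (\<lambda>k. {\<omega> :: nat \<Rightarrow> 'v. \<forall>i\<le>0. \<omega> i = from_nat k}) \<subseteq> ?E"
    proof (rule image_subsetI)
      show "{\<omega> :: nat \<Rightarrow> 'v. \<forall>i\<le>0. \<omega> i = from_nat k} \<in> ?E" for k
        by (rule insertI2, rule CollectI, rule exI[of _ 0], rule exI[of _ "\<lambda>_. from_nat k"]) simp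
    qed
    have "\<omega> \<in> (\<Union>k. {\<omega> :: nat \<Rightarrow> 'v. \<forall>i\<le>0. \<omega> i = from_nat k})" for \<omega> :: "nat \<Rightarrow> 'v"
      by (rule UN_I[of "to_nat (\<omega> 0)"]) simp_all
    then show "(\<Union>k. {\<omega> :: nat \<Rightarrow> 'v. \<forall>i\<le>0. \<omega> i = from_nat k}) = UNIV" by blast
    show "emeasure (srw_law G x) {\<omega>. \<forall>i\<le>0. \<omega> i = from_nat k} \<noteq> \<infinity>" for k
      using finite_measure.emeasure_finite[OF prob_space.finite_measure[OF prob_space_srw_law]] by simp
    fix A assume "A \<in> ?E"
    then consider "A = {}" | n p where "A = {\<omega>. \<forall>i\<le>n. \<omega> i = p i}" by blast
    then show "emeasure (srw_law G x) A = emeasure ?R A"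
    proof cases
      case (2 n p)
      show ?thesis unfolding 2 R[OF cyl]
      proof (cases n)
        case 0
        have "{\<omega>. case_nat x \<omega> \<in> {\<omega>. \<forall>i\<le>0. \<omega> i = p i}} = (if p 0 = x then UNIV else {})" by auto
        moreover have "emeasure (srw_law G y) UNIV = 1" for y
          using prob_space.emeasure_space_1[OF prob_space_srw_law[of G y]] by (simp add: space_srw_law)
        ultimately show "emeasure (srw_law G x) {\<omega>. \<forall>i\<le>n. \<omega> i = p i} =
          (\<integral>\<^sup>+ y. emeasure (srw_law G y) {\<omega>. case_nat x \<omega> \<in> {\<omega>. \<forall>i\<le>n. \<omega> i = p i}} \<partial>srw_step G x)"
          unfolding 0 by (subst emeasure_srw_law_path) simp
      next
        case (Suc m)
        define c where "c = (\<Prod>i<m. ennreal (pmf (srw_step G (p (Suc i))) (p (Suc (Suc i)))))"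
        have "{\<omega>. case_nat x \<omega> \<in> {\<omega>. \<forall>i\<le>n. \<omega> i = p i}} =
            (if p 0 = x then {\<omega>. \<forall>i\<le>m. \<omega> i = p (Suc i)} else {})"
          unfolding Suc by (auto simp: all_le_Suc0)
        moreover have "emeasure (srw_law G y) {\<omega>. \<forall>i\<le>m. \<omega> i = p (Suc i)} = c * indicator {p 1} y" for y
          by (simp add: emeasure_srw_law_path[of G y m "\<lambda>i. p (Suc i)"] c_def indicator_def)
        ultimately have "(\<integral>\<^sup>+ y. emeasure (srw_law G y) {\<omega>. case_nat x \<omega> \<in> {\<omega>. \<forall>i\<le>n. \<omega> i = p i}} \<partial>srw_step G x) =
            (if p 0 = x then (\<integral>\<^sup>+ y. c * indicator {p 1} y \<partial>srw_step G x) else 0)"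
          by simp
        also have "\<dots> = (if p 0 = x then c * ennreal (pmf (srw_step G x) (p 1)) else 0)"
          by (simp add: nn_integral_cmult_indicator emeasure_pmf_single)
        also have "\<dots> = emeasure (srw_law G x) {\<omega>. \<forall>i\<le>n. \<omega> i = p i}"
          unfolding emeasure_srw_law_path Suc prod.lessThan_Suc_shift by (simp add: c_def mult.commute)
        finally show "emeasure (srw_law G x) {\<omega>. \<forall>i\<le>n. \<omega> i = p i} =
          (\<integral>\<^sup>+ y. emeasure (srw_law G y) {\<omega>. case_nat x \<omega> \<in> {\<omega>. \<forall>i\<le>n. \<omega> i = p i}} \<partial>srw_step G x)" ..
      qed
    qed simp
  qed auto
qed

lemma nn_integral_srw_law_step:
  fixes G :: "'v::countable ugraph"
  assumes "finite (nbrs G x)" "nbrs G x \<noteq> {}" and F: "F \<in> borel_measurable path_space"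
  shows "(\<integral>\<^sup>+ \<omega>. F \<omega> \<partial>srw_law G x) =
    (\<Sum>y\<in>nbrs G x. (\<integral>\<^sup>+ \<omega>. F (case_nat x \<omega>) \<partial>srw_law G y)) / of_nat (card (nbrs G x))"
proof -
  let ?B = "measure_pmf (srw_step G x) \<bind> srw_law G"
  have sB: "sets ?B = sets path_space"
    by (rule sets_bind) (auto simp: sets_srw_law)
  have shift: "case_nat x \<in> measurable ?B path_space"
    by (subst measurable_cong_sets[OF sB refl]) (rule measurable_shift)
  have F': "(\<lambda>\<omega>. F (case_nat x \<omega>)) \<in> borel_measurable path_space"
    using measurable_compose[OF measurable_shift F] .
  have "(\<integral>\<^sup>+ \<omega>. F \<omega> \<partial>srw_law G x) = (\<integral>\<^sup>+ \<omega>. F (case_nat x \<omega>) \<partial>?B)"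
    using F by (subst srw_law_step) (simp add: nn_integral_distr[OF shift])
  also have "\<dots> = (\<integral>\<^sup>+ y. \<integral>\<^sup>+ \<omega>. F (case_nat x \<omega>) \<partial>srw_law G y \<partial>srw_step G x)"
    by (rule nn_integral_bind[OF F' measurable_srw_law])
  also have "\<dots> = (\<Sum>y\<in>nbrs G x. (\<integral>\<^sup>+ \<omega>. F (case_nat x \<omega>) \<partial>srw_law G y)) / of_nat (card (nbrs G x))"
    unfolding srw_step_def using assms by (intro nn_integral_pmf_of_set) auto
  finally show ?thesis .
qed

lemma sets_two_walks: "sets (two_walks G x y) = sets (path_space \<Otimes>\<^sub>M path_space)"
  unfolding two_walks_def by (intro sets_pair_measure_cong sets_srw_law)

lemma space_two_walks: "space (two_walks G x y) = UNIV"
  by (simp add: two_walks_def space_pair_measure space_srw_law)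

lemma prob_space_two_walks: "prob_space (two_walks G x y)"
proof -
  interpret X: prob_space "srw_law G x" by (rule prob_space_srw_law)
  interpret Y: prob_space "srw_law G y" by (rule prob_space_srw_law)
  interpret XY: pair_prob_space "srw_law G x" "srw_law G y" ..
  show ?thesis unfolding two_walks_def by (rule XY.prob_space_axioms)
qed

abbreviation shift2 :: "'v \<Rightarrow> 'v \<Rightarrow> (nat \<Rightarrow> 'v) \<times> (nat \<Rightarrow> 'v) \<Rightarrow> (nat \<Rightarrow> 'v) \<times> (nat \<Rightarrow> 'v)" where
  "shift2 x y w \<equiv> (case_nat x (fst w), case_nat y (snd w))"

lemma measurable_shift2:
  "shift2 x y \<in> measurable (path_space \<Otimes>\<^sub>M path_space) (path_space \<Otimes>\<^sub>M path_space)"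
  by (intro measurable_Pair measurable_compose[OF measurable_fst measurable_shift]
      measurable_compose[OF measurable_snd measurable_shift])

lemma nn_integral_two_walks_step:
  fixes G :: "'v::countable ugraph"
  assumes x: "finite (nbrs G x)" "nbrs G x \<noteq> {}" and y: "finite (nbrs G y)" "nbrs G y \<noteq> {}"
    and F: "F \<in> borel_measurable (path_space \<Otimes>\<^sub>M path_space)"
  shows "(\<integral>\<^sup>+ w. F w \<partial>two_walks G x y) =
    (\<Sum>a\<in>nbrs G x. (\<Sum>b\<in>nbrs G y. (\<integral>\<^sup>+ w. F (shift2 x y w) \<partial>two_walks G a b)) / of_nat (card (nbrs G y)))
      / of_nat (card (nbrs G x))"
proof -
  have fub: "(\<integral>\<^sup>+ w. H w \<partial>two_walks G a b) = (\<integral>\<^sup>+ \<omega>. \<integral>\<^sup>+ \<omega>'. H (\<omega>, \<omega>') \<partial>srw_law G b \<partial>srw_law G a)"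
    if "H \<in> borel_measurable (path_space \<Otimes>\<^sub>M path_space)" for H :: "_ \<Rightarrow> ennreal" and a b
  proof -
    interpret Y: prob_space "srw_law G b" by (rule prob_space_srw_law)
    have "H \<in> borel_measurable (srw_law G a \<Otimes>\<^sub>M srw_law G b)"
      using that sets_two_walks[of G a b] measurable_cong_sets unfolding two_walks_def by blast
    from Y.nn_integral_fst[OF this] show ?thesis unfolding two_walks_def ..
  qed
  have sf: "(\<lambda>\<omega>. \<integral>\<^sup>+ \<omega>'. H (\<omega>, \<omega>') \<partial>srw_law G b) \<in> borel_measurable path_space"
    if "H \<in> borel_measurable (path_space \<Otimes>\<^sub>M path_space)" for H :: "_ \<Rightarrow> ennreal" and b
  proof -
    interpret Y: prob_space "srw_law G b" by (rule prob_space_srw_law)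
    have "H \<in> borel_measurable (path_space \<Otimes>\<^sub>M srw_law G b)"
      by (subst measurable_cong_sets[OF sets_pair_measure_cong[OF refl sets_srw_law] refl]) (rule that)
    from Y.borel_measurable_nn_integral_fst[OF this] show ?thesis .
  qed
  have Fs: "(\<lambda>w. F (shift2 a b w)) \<in> borel_measurable (path_space \<Otimes>\<^sub>M path_space)" for a b
    using measurable_compose[OF measurable_shift2 F] .
  have "(\<integral>\<^sup>+ w. F w \<partial>two_walks G x y) = (\<integral>\<^sup>+ \<omega>. \<integral>\<^sup>+ \<omega>'. F (\<omega>, \<omega>') \<partial>srw_law G y \<partial>srw_law G x)"
    by (rule fub[OF F])
  also have "\<dots> = (\<Sum>a\<in>nbrs G x. (\<integral>\<^sup>+ \<omega>. (\<integral>\<^sup>+ \<omega>'. F (case_nat x \<omega>, \<omega>') \<partial>srw_law G y) \<partial>srw_law G a))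
      / of_nat (card (nbrs G x))"
    by (rule nn_integral_srw_law_step[OF x sf[OF F]])
  also have "\<dots> = (\<Sum>a\<in>nbrs G x. (\<integral>\<^sup>+ \<omega>. (\<Sum>b\<in>nbrs G y. \<integral>\<^sup>+ \<omega>'. F (case_nat x \<omega>, case_nat y \<omega>') \<partial>srw_law G b)
      / of_nat (card (nbrs G y)) \<partial>srw_law G a)) / of_nat (card (nbrs G x))"
  proof -
    have "(\<integral>\<^sup>+ \<omega>'. F (\<omega>, \<omega>') \<partial>srw_law G y) = (\<Sum>b\<in>nbrs G y. \<integral>\<^sup>+ \<omega>'. F (\<omega>, case_nat y \<omega>') \<partial>srw_law G b)
      / of_nat (card (nbrs G y))" for \<omega>
      by (rule nn_integral_srw_law_step[OF y measurable_Pair2[OF F]]) (simp add: space_PiM)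
    then show ?thesis by simp
  qed
  also have "\<dots> = (\<Sum>a\<in>nbrs G x. (\<Sum>b\<in>nbrs G y. (\<integral>\<^sup>+ \<omega>. \<integral>\<^sup>+ \<omega>'. F (case_nat x \<omega>, case_nat y \<omega>') \<partial>srw_law G b \<partial>srw_law G a))
      / of_nat (card (nbrs G y))) / of_nat (card (nbrs G x))"
  proof -
    have m: "(\<lambda>\<omega>. \<integral>\<^sup>+ \<omega>'. F (case_nat x \<omega>, case_nat y \<omega>') \<partial>srw_law G b) \<in> borel_measurable (srw_law G a)" for a b
      by (subst measurable_cong_sets[OF sets_srw_law refl]) (use sf[OF Fs[of x y]] in simp)
    show ?thesis
      by (subst nn_integral_divide, use m in measurable) (subst nn_integral_sum, use m in auto)
  qed
  also have "\<dots> = (\<Sum>a\<in>nbrs G x. (\<Sum>b\<in>nbrs G y. (\<integral>\<^sup>+ w. F (shift2 x y w) \<partial>two_walks G a b)) / of_nat (card (nbrs G y)))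
      / of_nat (card (nbrs G x))"
    using fub[OF Fs[of x y]] by simp
  finally show ?thesis .
qed

lemma measure_two_walks_step:
  fixes G :: "'v::countable ugraph"
  assumes x: "finite (nbrs G x)" "nbrs G x \<noteq> {}" and y: "finite (nbrs G y)" "nbrs G y \<noteq> {}"
    and E: "Measurable.pred (path_space \<Otimes>\<^sub>M path_space) E"
  shows "\<P>(w in two_walks G x y. E w) =
    avg (prodN (nbrs G)) (\<lambda>z. \<P>(w in two_walks G (fst z) (snd z). E (shift2 x y w))) (x, y)"
proof -
  have p: "ennreal \<P>(w in two_walks G a b. H w) = (\<integral>\<^sup>+ w. indicator {w. H w} w \<partial>two_walks G a b)"
    if "Measurable.pred (path_space \<Otimes>\<^sub>M path_space) H" for H a b
  proof -
    interpret prob_space "two_walks G a b" by (rule prob_space_two_walks)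
    have "{w. H w} \<in> sets (two_walks G a b)"
      using that by (simp add: pred_def sets_two_walks space_pair_measure space_PiM)
    then show ?thesis by (simp add: space_two_walks emeasure_eq_measure)
  qed
  have E': "Measurable.pred (path_space \<Otimes>\<^sub>M path_space) (\<lambda>w. E (shift2 x y w))"
    using measurable_compose[OF measurable_shift2 E] .
  let ?m = "\<lambda>a b. \<P>(w in two_walks G a b. E (shift2 x y w))"
  have cx: "0 < real (card (nbrs G x))" "0 < real (card (nbrs G y))" using x y by (auto simp: card_gt_0_iff)
  have "ennreal \<P>(w in two_walks G x y. E w) = (\<Sum>a\<in>nbrs G x. (\<Sum>b\<in>nbrs G y. ennreal (?m a b))
      / ennreal (card (nbrs G y))) / ennreal (card (nbrs G x))"
    unfolding p[OF E] using E by (subst nn_integral_two_walks_step[OF x y])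
      (auto simp: p[OF E'] indicator_def ennreal_of_nat_eq_real_of_nat intro!: sum.cong nn_integral_cong arg_cong2[where f="(/)"])
  also have "\<dots> = ennreal ((\<Sum>a\<in>nbrs G x. (\<Sum>b\<in>nbrs G y. ?m a b) / card (nbrs G y)) / card (nbrs G x))"
    using cx by (simp add: sum_ennreal divide_ennreal sum_nonneg)
  finally have "\<P>(w in two_walks G x y. E w) = (\<Sum>a\<in>nbrs G x. (\<Sum>b\<in>nbrs G y. ?m a b) / card (nbrs G y)) / card (nbrs G x)"
    by (subst (asm) ennreal_inj) (auto intro!: divide_nonneg_nonneg sum_nonneg)
  also have "\<dots> = avg (prodN (nbrs G)) (\<lambda>z. ?m (fst z) (snd z)) (x, y)"
    by (simp add: avg_def prodN_def card_cartesian_product sum.cartesian_product sum_divide_distrib[symmetric] case_prod_beta)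
  finally show ?thesis .
qed

section \<open>Criteria for finitely and infinitely many collisions\<close>

text \<open>\<open>hit N n (x, y)\<close> is the probability of a collision up to time \<open>n\<close>, see \<open>prob_hit\<close> below.\<close>

primrec hit :: "('a \<Rightarrow> 'a set) \<Rightarrow> nat \<Rightarrow> 'a \<times> 'a \<Rightarrow> real" where
  "hit N 0 z = (if fst z = snd z then 1 else 0)"
| "hit N (Suc n) z = (if fst z = snd z then 1 else avg (prodN N) (hit N n) z)"

text \<open>First-collision decomposition, with \<open>K\<close> bounding the expected number of collisions from a
  common starting point.\<close>

lemma sum_diagw_le_hit:
  assumes "T \<le> T0" and "\<And>j v. j \<le> T \<Longrightarrow> v \<in> reach N j x \<Longrightarrow>
    (\<Sum>n\<le>T0. iter (prodN N) n (diagw (\<lambda>_. 1)) (v, v)) \<le> K" and "0 \<le> K"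
  shows "(\<Sum>n\<le>T. iter (prodN N) n (diagw (\<lambda>_. 1)) (x, y)) \<le> K * hit N T (x, y)"
  using assms
proof (induction T arbitrary: x y)
  case 0
  have "(\<Sum>n\<le>0. iter (prodN N) n (diagw (\<lambda>_. 1)) (x, x)) \<le> (\<Sum>n\<le>T0. iter (prodN N) n (diagw (\<lambda>_. 1)) (x, x))"
    by (rule sum_mono2) (auto intro!: iter_nonneg simp: diagw_def)
  also have "\<dots> \<le> K" using 0 by simp
  finally show ?case using 0 by (auto simp: diagw_def)
next
  case (Suc T)
  show ?case
  proof (cases "x = y")
    case True
    have "(\<Sum>n\<le>Suc T. iter (prodN N) n (diagw (\<lambda>_. 1)) (x, x)) \<le> (\<Sum>n\<le>T0. iter (prodN N) n (diagw (\<lambda>_. 1)) (x, x))"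
      using Suc.prems by (intro sum_mono2) (auto intro!: iter_nonneg simp: diagw_def)
    also have "\<dots> \<le> K" using Suc.prems(2)[of 0 x] by simp
    finally show ?thesis using True by simp
  next
    case False
    have "(\<Sum>n\<le>Suc T. iter (prodN N) n (diagw (\<lambda>_. 1)) (x, y)) =
        avg (prodN N) (\<lambda>z. \<Sum>n\<le>T. iter (prodN N) n (diagw (\<lambda>_. 1)) z) (x, y)"
      using False by (subst sum.atMost_Suc_shift) (simp add: diagw_def avg_sum)
    also have "\<dots> \<le> avg (prodN N) (\<lambda>z. K * hit N T z) (x, y)"
    proof (rule avg_mono)
      fix z assume "z \<in> prodN N (x, y)"
      then obtain a b where z: "z = (a, b)" "a \<in> N x" by (auto simp: prodN_def)
      \<comment> \<open>The horizon \<open>T0\<close> stays fixed while \<open>T\<close> decreases,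
        and what \<open>a\<close> reaches in \<open>j\<close> steps \<open>x\<close> reaches in
        \<open>Suc j\<close>; so the hypothesis passes to neighbours.\<close>
      have "(\<Sum>n\<le>T0. iter (prodN N) n (diagw (\<lambda>_. 1)) (v, v)) \<le> K" if "j \<le> T" "v \<in> reach N j a" for j v
        using Suc.prems(2)[of "Suc j" v] that z by auto
      then show "(\<Sum>n\<le>T. iter (prodN N) n (diagw (\<lambda>_. 1)) z) \<le> K * hit N T z"
        using Suc z by simp
    qed
    also have "\<dots> = K * hit N (Suc T) (x, y)" using False by (simp add: avg_cmult)
    finally show ?thesis .
  qed
qed

locale walk_graph =
  fixes G :: "'v::countable ugraph"
  assumes nbrs_finite: "finite (nbrs G x)"
    and nbrs_nonempty: "x \<in> verts G \<Longrightarrow> nbrs G x \<noteq> {}"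
    and nbrs_closed: "x \<in> verts G \<Longrightarrow> y \<in> nbrs G x \<Longrightarrow> y \<in> verts G"
begin

abbreviation "NB \<equiv> nbrs G"

lemma avg_prodN_const: "x \<in> verts G \<Longrightarrow> y \<in> verts G \<Longrightarrow> avg (prodN NB) (\<lambda>_. c) (x, y) = c"
  using nbrs_finite nbrs_nonempty by (intro avg_const) (auto simp: prodN_def)

lemma avg_prodN_cong: 
  assumes "x \<in> verts G" "y \<in> verts G" "\<And>a b. a \<in> verts G \<Longrightarrow> b \<in> verts G \<Longrightarrow> u (a, b) = v (a, b)"
  shows "avg (prodN NB) u (x, y) = avg (prodN NB) v (x, y)"
  by (rule avg_cong) (use assms nbrs_closed in \<open>auto simp: prodN_def\<close>)

lemma pred_collision [measurable]:
  "Measurable.pred (path_space \<Otimes>\<^sub>M path_space) (\<lambda>w :: (nat \<Rightarrow> 'v) \<times> (nat \<Rightarrow> 'v). fst w n = snd w n)"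
proof -
  have [measurable]: "(\<lambda>w. fst w n) \<in> measurable (path_space \<Otimes>\<^sub>M path_space) (count_space (UNIV :: 'v set))"
    "(\<lambda>w. snd w n) \<in> measurable (path_space \<Otimes>\<^sub>M path_space) (count_space (UNIV :: 'v set))"
    by measurable
  have "Measurable.pred (path_space \<Otimes>\<^sub>M path_space) (\<lambda>w :: (nat \<Rightarrow> 'v) \<times> (nat \<Rightarrow> 'v). \<exists>v. fst w n = v \<and> snd w n = v)"
    by measurable
  then show ?thesis by (simp add: eq_commute)
qed

lemma events_collisions:
  assumes "Measurable.pred (path_space \<Otimes>\<^sub>M path_space) E"
  shows "{w. E w} \<in> sets (two_walks G x y)"
  using assms by (simp add: pred_def sets_two_walks space_pair_measure space_PiM)

lemma prob_step:
  assumes "x \<in> verts G" "y \<in> verts G" "Measurable.pred (path_space \<Otimes>\<^sub>M path_space) E"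
  shows "\<P>(w in two_walks G x y. E w) =
    avg (prodN NB) (\<lambda>z. \<P>(w in two_walks G (fst z) (snd z). E (shift2 x y w))) (x, y)"
  by (rule measure_two_walks_step) (use assms nbrs_finite nbrs_nonempty in auto)

lemma prob_hit:
  "x \<in> verts G \<Longrightarrow> y \<in> verts G \<Longrightarrow> \<P>(w in two_walks G x y. \<exists>n\<le>T. fst w n = snd w n) = hit NB T (x, y)"
proof (induction T arbitrary: x y)
  case 0
  have "\<P>(w in two_walks G x y. \<exists>n\<le>0. fst w n = snd w n) = avg (prodN NB) (\<lambda>_. if x = y then 1 else 0) (x, y)"
    using 0 by (subst prob_step) (auto simp: prob_space.prob_space[OF prob_space_two_walks] intro!: avg_cong)
  then show ?case using 0 by (simp add: avg_prodN_const)
next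
  case (Suc T)
  have "(\<exists>n\<le>Suc T. fst (shift2 x y w) n = snd (shift2 x y w) n) \<longleftrightarrow> x = y \<or> (\<exists>n\<le>T. fst w n = snd w n)" for w
    using all_le_Suc0[of T "\<lambda>n. fst (shift2 x y w) n \<noteq> snd (shift2 x y w) n"] by auto
  then have "\<P>(w in two_walks G x y. \<exists>n\<le>Suc T. fst w n = snd w n) =
     avg (prodN NB) (\<lambda>z. \<P>(w in two_walks G (fst z) (snd z). x = y \<or> (\<exists>n\<le>T. fst w n = snd w n))) (x, y)"
    using Suc.prems by (subst prob_step) auto
  also have "\<dots> = avg (prodN NB) (\<lambda>z. if x = y then 1 else hit NB T z) (x, y)"
    using Suc by (intro avg_prodN_cong) (auto simp: prob_space.prob_space[OF prob_space_two_walks])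
  finally show ?case using Suc.prems by (simp add: avg_prodN_const)
qed

lemma prob_hit_shift:
  "x \<in> verts G \<Longrightarrow> y \<in> verts G \<Longrightarrow> \<P>(w in two_walks G x y. \<exists>n\<le>T. fst w (M + n) = snd w (M + n)) =
     iter (prodN NB) M (hit NB T) (x, y)"
proof (induction M arbitrary: x y)
  case 0
  then show ?case by (simp add: prob_hit)
next
  case (Suc M)
  have "\<P>(w in two_walks G x y. \<exists>n\<le>T. fst w (Suc M + n) = snd w (Suc M + n)) =
     avg (prodN NB) (\<lambda>z. \<P>(w in two_walks G (fst z) (snd z). \<exists>n\<le>T. fst w (M + n) = snd w (M + n))) (x, y)"
    using Suc.prems by (subst prob_step) auto
  also have "\<dots> = avg (prodN NB) (iter (prodN NB) M (hit NB T)) (x, y)"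
    using Suc by (intro avg_prodN_cong) auto
  finally show ?case by simp
qed

abbreviation never :: "'v \<times> 'v \<Rightarrow> real" where
  "never z \<equiv> \<P>(w in two_walks G (fst z) (snd z). \<forall>n. fst w n \<noteq> snd w n)"

lemma never_step:
  assumes "x \<in> verts G" "y \<in> verts G"
  shows "never (x, y) = (if x = y then 0 else avg (prodN NB) never (x, y))"
proof -
  have "(\<forall>n. fst (shift2 x y w) n \<noteq> snd (shift2 x y w) n) \<longleftrightarrow> x \<noteq> y \<and> (\<forall>n. fst w n \<noteq> snd w n)" for w
    by (metis (no_types, lifting) fst_conv not0_implies_Suc old.nat.simps(4) old.nat.simps(5) snd_conv)
  note * = this
  have m: "Measurable.pred (path_space \<Otimes>\<^sub>M path_space) (\<lambda>w :: (nat \<Rightarrow> 'v) \<times> (nat \<Rightarrow> 'v). \<forall>n. fst w n \<noteq> snd w n)"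
    by measurable
  have "never (x, y) = avg (prodN NB) (\<lambda>z. \<P>(w in two_walks G (fst z) (snd z). x \<noteq> y \<and> (\<forall>n. fst w n \<noteq> snd w n))) (x, y)"
    using prob_step[OF assms m, unfolded *] by simp
  then show ?thesis by (cases "x = y") simp_all
qed

lemma prob_never_shift:
  "x \<in> verts G \<Longrightarrow> y \<in> verts G \<Longrightarrow> \<P>(w in two_walks G x y. \<forall>n. fst w (M + n) \<noteq> snd w (M + n)) =
     iter (prodN NB) M never (x, y)"
proof (induction M arbitrary: x y)
  case (Suc M)
  have "\<P>(w in two_walks G x y. \<forall>n. fst w (Suc M + n) \<noteq> snd w (Suc M + n)) =
     avg (prodN NB) (\<lambda>z. \<P>(w in two_walks G (fst z) (snd z). \<forall>n. fst w (M + n) \<noteq> snd w (M + n))) (x, y)"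
    using Suc.prems by (subst prob_step) auto
  also have "\<dots> = avg (prodN NB) (iter (prodN NB) M never) (x, y)"
    using Suc by (intro avg_prodN_cong) auto
  finally show ?case by simp
qed simp

lemma hit_tendsto_never:
  assumes "x \<in> verts G" "y \<in> verts G"
  shows "(\<lambda>T. 1 - hit NB T (x, y)) \<longlonglongrightarrow> never (x, y)"
proof -
  interpret P: prob_space "two_walks G x y" by (rule prob_space_two_walks)
  let ?A = "\<lambda>T. {w. \<exists>n\<le>T. fst w n = snd w n}"
  have m: "?A T \<in> P.events" for T by (rule events_collisions) measurable
  have "(\<lambda>T. P.prob (?A T)) \<longlonglongrightarrow> P.prob (\<Union>T. ?A T)"
    by (rule P.finite_Lim_measure_incseq) (use m in \<open>auto simp: incseq_def intro: order_trans\<close>)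
  moreover have "P.prob (?A T) = hit NB T (x, y)" for T
    using prob_hit[OF assms, of T] by (simp add: space_two_walks)
  moreover have "P.prob (\<Union>T. ?A T) = 1 - never (x, y)"
  proof -
    have u: "(\<Union>T. ?A T) \<in> P.events" using m by auto
    have "P.prob (space (two_walks G x y) - (\<Union>T. ?A T)) = 1 - P.prob (\<Union>T. ?A T)" by (rule P.prob_compl[OF u])
    moreover have "space (two_walks G x y) - (\<Union>T. ?A T) = {w. \<forall>n. fst w n \<noteq> snd w n}"
      by (auto simp: space_two_walks)
    ultimately show ?thesis by (simp add: space_two_walks)
  qed
  ultimately have "(\<lambda>T. hit NB T (x, y)) \<longlonglongrightarrow> 1 - never (x, y)" by simp
  from tendsto_diff[OF tendsto_const[of 1] this] show ?thesis by simp
qed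

lemma never_le: 
  assumes "x \<in> verts G" "y \<in> verts G"
  shows "never (x, y) \<le> 1 - hit NB T (x, y)"
proof -
  interpret P: prob_space "two_walks G x y" by (rule prob_space_two_walks)
  let ?A = "{w. \<exists>n\<le>T. fst w n = snd w n}"
  have m: "?A \<in> P.events" by (rule events_collisions) measurable
  have "never (x, y) \<le> P.prob (space (two_walks G x y) - ?A)"
    unfolding fst_conv snd_conv by (intro P.finite_measure_mono sets.compl_sets m) (auto simp: space_two_walks)
  also have "\<dots> = 1 - hit NB T (x, y)"
    using prob_hit[OF assms, of T] P.prob_compl[OF m] by (simp add: space_two_walks)
  finally show ?thesis .
qed

text \<open>A uniform lower bound \<open>c\<close> on the collision probability from every pair of a closed
  class amplifies to 1: the probability of never colliding is at most \<open>1 - c\<close> times itself.\<close>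

lemma never_eq_0:
  assumes R: "\<And>x y. R x y \<Longrightarrow> x \<in> verts G \<and> y \<in> verts G"
    and closed: "\<And>x y a b. R x y \<Longrightarrow> a \<in> NB x \<Longrightarrow> b \<in> NB y \<Longrightarrow> R a b"
    and c: "0 < c" "c \<le> 1" "\<And>x y. R x y \<Longrightarrow> \<exists>T. c \<le> hit NB T (x, y)"
    and xy: "R x y"
  shows "never (x, y) = 0"
proof -
  have le: "never (x, y) \<le> 1 - c" if xy: "R x y" for x y
  proof -
    obtain T where "c \<le> hit NB T (x, y)" using c(3)[OF xy] by blast
    then show ?thesis using never_le[of x y T] R[OF xy] by linarith
  qed
  \<comment> \<open>Markov property at time \<open>T\<close>: there must be no collision up to
    \<open>T\<close>, and then none from the pair reached, which has probability at most
    \<open>1 - c\<close>.\<close>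
  have "never (x, y) \<le> (1 - c) * (1 - hit NB T (x, y))" if "R x y" for T x y
    using that
  proof (induction T arbitrary: x y)
    case 0
    then show ?case using le[of x y] never_step[of x y] R[of x y] by auto
  next
    case (Suc T)
    have V: "x \<in> verts G" "y \<in> verts G" using R Suc.prems by auto
    show ?case
    proof (cases "x = y")
      case False
      have "never (x, y) = avg (prodN NB) never (x, y)" using never_step[OF V] False by simp
      also have "\<dots> \<le> avg (prodN NB) (\<lambda>z. (1 - c) * (1 - hit NB T z)) (x, y)"
        by (rule avg_mono) (use Suc closed[OF Suc.prems] in \<open>auto simp: prodN_def\<close>)
      also have "\<dots> = (1 - c) * (1 - hit NB (Suc T) (x, y))"
        using False V by (simp add: avg_cmult avg_diff avg_prodN_const)
      finally show ?thesis .
    qed (use never_step[OF V] in simp)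
  qed
  from this[OF xy] have "never (x, y) \<le> (1 - c) * never (x, y)"
    using R[OF xy] by (intro LIMSEQ_le_const[OF tendsto_mult[OF tendsto_const hit_tendsto_never]]) auto
  then have "c * never (x, y) \<le> 0" by (simp add: algebra_simps)
  then have "never (x, y) \<le> 0" using c by (simp only: mult_le_0_iff) linarith
  then show ?thesis by (rule antisym) (rule measure_nonneg)
qed

text \<open>Closedness keeps the pair at time \<open>M\<close> inside \<open>R\<close>, so having no
  collision from time \<open>M\<close> on is a null event for each of the countably many
  \<open>M\<close>.\<close>

lemma infinite_collisions_criterion:
  assumes R: "\<And>x y. R x y \<Longrightarrow> x \<in> verts G \<and> y \<in> verts G"
    and closed: "\<And>x y a b. R x y \<Longrightarrow> a \<in> NB x \<Longrightarrow> b \<in> NB y \<Longrightarrow> R a b"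
    and c: "0 < c" "c \<le> 1" "\<And>x y. R x y \<Longrightarrow> \<exists>T. c \<le> hit NB T (x, y)"
    and xy: "R x y"
  shows "\<P>(w in two_walks G x y. num_collisions (fst w) (snd w) = \<infinity>) = 1"
proof -
  interpret P: prob_space "two_walks G x y" by (rule prob_space_two_walks)
  have 0: "never (a, b) = 0" if "R a b" for a b
    by (rule never_eq_0[of R c]) (use assms that in auto)
  have reach: "R (fst z) (snd z)" if "z \<in> reach (prodN NB) M (a, b)" "R a b" for z M a b
    using that by (induction M arbitrary: a b) (auto simp: prodN_def dest: closed)
  have "iter (prodN NB) M never (x, y) = iter (prodN NB) M (\<lambda>_. 0) (x, y)" for M
  proof (rule iter_cong_reach)
    fix z assume "z \<in> reach (prodN NB) M (x, y)"
    from 0[OF reach[OF this xy]] show "never z = 0" by simp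
  qed
  then have z: "\<P>(w in two_walks G x y. \<forall>n. fst w (M + n) \<noteq> snd w (M + n)) = 0" for M
    using prob_never_shift[of x y M] R[OF xy] by simp
  have "AE w in two_walks G x y. \<forall>M. \<not> (\<forall>n. fst w (M + n) \<noteq> snd w (M + n))"
    unfolding AE_all_countable
  proof
    fix M
    have "{w. \<forall>n. fst w (M + n) \<noteq> snd w (M + n)} \<in> P.events"
      by (rule events_collisions) measurable
    then show "AE w in two_walks G x y. \<not> (\<forall>n. fst w (M + n) \<noteq> snd w (M + n))"
      using z[of M] by (subst P.prob_Collect_eq_0[symmetric]) (auto simp: space_two_walks)
  qed
  then have "AE w in two_walks G x y. num_collisions (fst w) (snd w) = \<infinity>"
  proof (rule AE_mp, intro AE_I2 impI)
    fix w :: "(nat \<Rightarrow> 'v) \<times> (nat \<Rightarrow> 'v)"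
    assume *: "\<forall>M. \<not> (\<forall>n. fst w (M + n) \<noteq> snd w (M + n))"
    have "infinite {n. fst w n = snd w n}"
      unfolding infinite_nat_iff_unbounded_le
    proof
      fix m
      from * obtain n where "fst w (m + n) = snd w (m + n)" by blast
      then show "\<exists>n\<ge>m. n \<in> {n. fst w n = snd w n}" by (intro exI[of _ "m + n"]) simp
    qed
    then show "num_collisions (fst w) (snd w) = \<infinity>" by (simp add: num_collisions_def)
  qed
  then show ?thesis
    using sets_infinitely_many_collisions[of G x y] by (subst P.prob_Collect_eq_1) auto
qed

text \<open>First-collision decomposition in the other direction: the first collision in the window
  from \<open>M\<close> to \<open>M + T\<close> is followed by mean weight at least
  \<open>c\<close>. Finite sums of unspecified length are used because convergence is available only
  for the original starting pair; finiteness of the neighbourhoods provides a common length.\<close>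

lemma hit_le_sum_diagw:
  assumes w: "\<And>v. 0 \<le> w v"
    and c: "\<And>v. v \<in> verts G \<Longrightarrow> \<exists>J. c \<le> (\<Sum>n<J. iter (prodN NB) n (diagw w) (v, v))"
    and xy: "x \<in> verts G" "y \<in> verts G"
  shows "\<exists>J. c * iter (prodN NB) M (hit NB T) (x, y) \<le> (\<Sum>n<J. iter (prodN NB) (M + n) (diagw w) (x, y))"
proof -
  let ?S = "\<lambda>M J z. \<Sum>n<J. iter (prodN NB) (M + n) (diagw w) z"
  have mono: "?S M J z \<le> ?S M J' z" if "J \<le> J'" for M J J' z
    using that by (intro sum_mono2) (auto intro!: iter_nonneg simp: diagw_def w)
  have step: "\<exists>J. c * avg (prodN NB) u (x, y) \<le> ?S (Suc M) J (x, y)"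
    if u: "\<And>a b. a \<in> verts G \<Longrightarrow> b \<in> verts G \<Longrightarrow> \<exists>J. c * u (a, b) \<le> ?S M J (a, b)"
      and xy: "x \<in> verts G" "y \<in> verts G" for u x y M
  proof -
    have "\<exists>J. c * u z \<le> ?S M J z" if "z \<in> prodN NB (x, y)" for z
      using that u xy nbrs_closed by (auto simp: prodN_def)
    then obtain J where J: "\<And>z. z \<in> prodN NB (x, y) \<Longrightarrow> c * u z \<le> ?S M (J z) z" by metis
    define J' where "J' = Max (J ` prodN NB (x, y))"
    have f: "finite (prodN NB (x, y))" using nbrs_finite by (simp add: prodN_def)
    have "c * avg (prodN NB) u (x, y) \<le> avg (prodN NB) (?S M J') (x, y)"
      unfolding avg_cmult[symmetric]
    proof (rule avg_mono)
      fix z assume z: "z \<in> prodN NB (x, y)"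
      then have "J z \<le> J'" unfolding J'_def using f by simp
      then show "c * u z \<le> ?S M J' z" using J[OF z] mono order_trans by blast
    qed
    also have "\<dots> = ?S (Suc M) J' (x, y)" by (simp add: avg_sum)
    finally show ?thesis by blast
  qed
  have shift: "\<exists>J. c * u (x, y) \<le> ?S 0 J (x, y)" if "\<exists>J. c * u (x, y) \<le> ?S (Suc 0) J (x, y)" for u x y
  proof -
    from that obtain J where J: "c * u (x, y) \<le> ?S (Suc 0) J (x, y)" by blast
    have "?S (Suc 0) J (x, y) \<le> ?S 0 (Suc J) (x, y)"
      by (subst sum.lessThan_Suc_shift) (simp add: diagw_def w)
    then show ?thesis using J by (meson order_trans)
  qed
  have base: "\<exists>J. c * hit NB T (x, y) \<le> ?S 0 J (x, y)" if "x \<in> verts G" "y \<in> verts G" for x y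
    using that
  proof (induction T arbitrary: x y)
    case 0
    show ?case
    proof (cases "x = y")
      case False then show ?thesis by (intro exI[of _ 0]) simp
    qed (use c[of x] 0 in simp)
  next
    case (Suc T)
    show ?case
    proof (cases "x = y")
      case True then show ?thesis using c[of x] Suc.prems by simp
    next
      case False
      have "\<exists>J. c * avg (prodN NB) (hit NB T) (x, y) \<le> ?S (Suc 0) J (x, y)"
        by (rule step) (use Suc in auto)
      then show ?thesis using shift[of "avg (prodN NB) (hit NB T)"] False by simp
    qed
  qed
  show ?thesis using xy
  proof (induction M arbitrary: x y)
    case 0
    then show ?case using base by simp
  next
    case (Suc M)
    show ?case unfolding iter_Suc by (rule step) (use Suc in auto)
  qed
qed

text \<open>Infinitely many collisions force one after every time \<open>M\<close>, and the
  probability of that is at most the tail of the weight series divided by \<open>c\<close>.\<close>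

lemma finite_collisions_criterion:
  assumes w: "\<And>v. 0 \<le> w v" and c0: "0 < c"
    and c: "\<And>v. v \<in> verts G \<Longrightarrow> \<exists>J. c \<le> (\<Sum>n<J. iter (prodN NB) n (diagw w) (v, v))"
    and xy: "x \<in> verts G" "y \<in> verts G"
    and s: "summable (\<lambda>n. iter (prodN NB) n (diagw w) (x, y))"
  shows "\<P>(w in two_walks G x y. num_collisions (fst w) (snd w) < \<infinity>) = 1"
proof -
  interpret P: prob_space "two_walks G x y" by (rule prob_space_two_walks)
  let ?a = "\<lambda>n. iter (prodN NB) n (diagw w) (x, y)"
  let ?I = "{z. num_collisions (fst z) (snd z) = \<infinity>}"
  let ?A = "\<lambda>M T. {z :: (nat \<Rightarrow> 'v) \<times> (nat \<Rightarrow> 'v). \<exists>n\<le>T. fst z (M + n) = snd z (M + n)}"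
  have a: "0 \<le> ?a n" for n by (rule iter_nonneg) (simp add: diagw_def w)
  have I: "?I \<in> P.events" using sets_infinitely_many_collisions[of G x y] by (simp add: space_two_walks)
  have le: "P.prob ?I \<le> (\<Sum>n. ?a (n + M)) / c" for M
  proof -
    have m: "?A M T \<in> P.events" for T by (rule events_collisions) measurable
    have "P.prob (?A M T) \<le> (\<Sum>n. ?a (n + M)) / c" for T
    proof -
      obtain J where J: "c * iter (prodN NB) M (hit NB T) (x, y) \<le> (\<Sum>n<J. ?a (M + n))"
        using hit_le_sum_diagw[of w c x y M T] w c xy by blast
      also have "\<dots> \<le> (\<Sum>n. ?a (n + M))"
        using sum_le_suminf[OF summable_ignore_initial_segment[OF s, of M], of "{..<J}"] a by (simp add: add.commute)
      finally show ?thesis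
        using prob_hit_shift[OF xy, of T M] c0 by (simp add: space_two_walks field_simps)
    qed
    moreover have "(\<lambda>T. P.prob (?A M T)) \<longlonglongrightarrow> P.prob (\<Union>T. ?A M T)"
      by (rule P.finite_Lim_measure_incseq) (use m in \<open>auto simp: incseq_def intro: order_trans\<close>)
    ultimately have "P.prob (\<Union>T. ?A M T) \<le> (\<Sum>n. ?a (n + M)) / c"
      by (intro LIMSEQ_le_const2) auto
    moreover have "P.prob ?I \<le> P.prob (\<Union>T. ?A M T)"
    proof (rule P.finite_measure_mono)
      show "?I \<subseteq> (\<Union>T. ?A M T)"
      proof
        fix z :: "(nat \<Rightarrow> 'v) \<times> (nat \<Rightarrow> 'v)" assume "z \<in> ?I"
        then obtain n where "n \<ge> M" "fst z n = snd z n"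
          by (auto simp: num_collisions_def infinite_nat_iff_unbounded_le split: if_splits)
        then show "z \<in> (\<Union>T. ?A M T)" by (auto intro!: exI[of _ "n - M"])
      qed
    qed (use m in auto)
    ultimately show ?thesis by linarith
  qed
  have "P.prob ?I \<le> 0"
  proof (rule field_le_epsilon)
    fix e :: real assume e: "0 < e"
    obtain M where "norm (\<Sum>n. ?a (n + M)) < e * c"
      using suminf_exist_split[OF _ s, of "e * c"] e c0 by auto
    then have "(\<Sum>n. ?a (n + M)) / c < e" using c0 by (simp add: field_simps)
    then show "P.prob ?I \<le> 0 + e" using le[of M] by linarith
  qed
  then have "P.prob (space (two_walks G x y) - ?I) = 1"
    using P.prob_compl[OF I] measure_nonneg[of "two_walks G x y" ?I] by linarith
  moreover have "space (two_walks G x y) - ?I = {z \<in> space (two_walks G x y). num_collisions (fst z) (snd z) < \<infinity>}"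
    by auto
  ultimately show ?thesis by simp
qed

end

section \<open>The simple random walk on the square lattice\<close>

primrec walk1 :: "nat \<Rightarrow> int \<Rightarrow> real" where
  "walk1 0 j = (if j = 0 then 1 else 0)"
| "walk1 (Suc n) j = (walk1 n (j - 1) + walk1 n (j + 1)) / 2"

lemma walk1_nonneg: "0 \<le> walk1 n j"
  by (induction n arbitrary: j) auto

lemma walk1_far: "int n < \<bar>j\<bar> \<Longrightarrow> walk1 n j = 0"
  by (induction n arbitrary: j) auto

lemma walk1_odd: "odd (int n + j) \<Longrightarrow> walk1 n j = 0"
  by (induction n arbitrary: j) auto

lemma walk1_binomial: "walk1 n (2 * int k - int n) = real (n choose k) / 2 ^ n"
proof (induction n arbitrary: k)
  case 0
  then show ?case by (cases k) auto
next
  case (Suc n)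
  have e: "2 * int k - int (Suc n) + 1 = 2 * int k - int n" by simp
  show ?case
  proof (cases k)
    case 0
    have "walk1 n (2 * int k - int (Suc n) - 1) = 0" using 0 by (intro walk1_far) auto
    then show ?thesis using Suc[of k] 0 unfolding walk1.simps e by simp
  next
    case (Suc k')
    have e': "2 * int k - int (Suc n) - 1 = 2 * int k' - int n" using Suc by simp
    show ?thesis unfolding walk1.simps e e' Suc.IH by (simp add: Suc add_divide_distrib)
  qed
qed

lemma walk1_even_le: "walk1 (2 * n) j \<le> walk1 (2 * n) 0"
proof (cases "odd j \<or> 2 * int n < \<bar>j\<bar>")
  case True
  then have "walk1 (2 * n) j = 0" by (auto intro: walk1_odd walk1_far)
  then show ?thesis using walk1_nonneg by simp
next
  case False
  define k where "k = nat ((j + 2 * int n) div 2)"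
  have j: "j = 2 * int k - int (2 * n)" using False unfolding k_def by auto
  have "real ((2 * n) choose k) \<le> real ((2 * n) choose n)" using binomial_maximum'[of n k] by simp
  moreover have "walk1 (2 * n) 0 = real ((2 * n) choose n) / 2 ^ (2 * n)"
    using walk1_binomial[of "2 * n" n] by simp
  ultimately show ?thesis unfolding j walk1_binomial by (simp add: divide_right_mono)
qed

lemma central_Suc: "walk1 (2 * Suc n) 0 = walk1 (2 * n) 0 * (2 * real n + 1) / (2 * real n + 2)"
proof -
  define A B C where "A = real (Suc (Suc (2 * n)) choose Suc n)" and "B = real (Suc (2 * n) choose Suc n)"
    and "C = real (2 * n choose n)"
  have "(Suc (2 * n) choose n) = (Suc (2 * n) choose Suc n)"
    using binomial_symmetric[of n "Suc (2 * n)"] by (simp add: Suc_diff_le)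
  then have "real (Suc n) * A = real (Suc (Suc (2 * n))) * B"
    unfolding A_def B_def of_nat_mult[symmetric] using Suc_times_binomial[of n "Suc (2 * n)"] by presburger
  then have "real (Suc n) * A = real (Suc n) * (2 * B)" by (simp add: algebra_simps)
  then have "A = 2 * B" by (simp only: mult_cancel_left) simp
  moreover have "real (Suc n) * B = real (Suc (2 * n)) * C"
    unfolding C_def B_def of_nat_mult[symmetric] using Suc_times_binomial[of n "2 * n"] by presburger
  ultimately have AC: "(real n + 1) * A = 2 * (2 * real n + 1) * C" by (simp add: algebra_simps)
  have w0: "walk1 (2 * n) 0 = C / 2 ^ (2 * n)"
    using walk1_binomial[of "2 * n" n] by (simp add: C_def)
  have w1: "walk1 (2 * Suc n) 0 = A / (4 * 2 ^ (2 * n))"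
    using walk1_binomial[of "2 * Suc n" "Suc n"] unfolding A_def by (simp del: binomial_Suc_Suc walk1.simps)
  have A: "A = C * (2 * (2 * real n + 1) / (real n + 1))"
    using AC by (simp add: field_simps)
  show ?thesis
    unfolding w1 w0 A by (simp add: divide_simps) (simp add: algebra_simps)
qed

text \<open>Wallis-type bound: by \<open>central_Suc\<close> each step multiplies the left side by
  \<open>(2n+1)(2n+3)/(2n+2)^2\<close>, which is at most 1. The lower bound that follows uses a
  quantity that increases and equals 1 at its first index.\<close>

lemma central_upper: "(walk1 (2 * n) 0)\<^sup>2 * (2 * real n + 1) \<le> 1"
proof (induction n)
  case (Suc n)
  have "(walk1 (2 * Suc n) 0)\<^sup>2 * (2 * real (Suc n) + 1) =
      ((walk1 (2 * n) 0)\<^sup>2 * (2 * real n + 1)) * ((2 * real n + 1) * (2 * real n + 3) / (2 * real n + 2)\<^sup>2)"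
    unfolding central_Suc by (simp add: power2_eq_square field_simps)
  also have "\<dots> \<le> 1 * 1"
  proof (rule mult_mono[OF Suc])
    show "(2 * real n + 1) * (2 * real n + 3) / (2 * real n + 2)\<^sup>2 \<le> 1"
      by (subst pos_divide_le_eq) (auto simp: power2_eq_square algebra_simps intro!: add_pos_nonneg)
  qed auto
  finally show ?case by simp
qed simp

lemma central_lower: "1 \<le> (walk1 (2 * Suc n) 0)\<^sup>2 * (4 * real (Suc n))"
proof (induction n)
  case 0
  then show ?case by (simp add: numeral_2_eq_2 power2_eq_square)
next
  case (Suc n)
  let ?m = "real (Suc n)"
  have "1 * 1 \<le> ((walk1 (2 * Suc n) 0)\<^sup>2 * (4 * ?m)) * ((2 * ?m + 1)\<^sup>2 * (?m + 1) / ((2 * ?m + 2)\<^sup>2 * ?m))"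
  proof (rule mult_mono[OF Suc])
    show "1 \<le> (2 * ?m + 1)\<^sup>2 * (?m + 1) / ((2 * ?m + 2)\<^sup>2 * ?m)"
      by (subst pos_le_divide_eq) (auto simp: power2_eq_square algebra_simps intro!: add_pos_nonneg)
  qed auto
  also have "\<dots> = (walk1 (2 * Suc (Suc n)) 0)\<^sup>2 * (4 * real (Suc (Suc n)))"
    unfolding central_Suc[of "Suc n"] by (simp add: power2_eq_square divide_simps del: walk1.simps) (simp add: algebra_simps)
  finally show ?case by simp
qed

text \<open>In the coordinates \<open>z\<^sub>1 + z\<^sub>2\<close> and \<open>z\<^sub>1 - z\<^sub>2\<close> the planar walk is a pair of independent
  one-dimensional walks.\<close>

definition walk2 :: "nat \<Rightarrow> int \<times> int \<Rightarrow> real" where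
  "walk2 n z = walk1 n (fst z + snd z) * walk1 n (fst z - snd z)"

definition unit_vecs :: "(int \<times> int) set" where
  "unit_vecs = {(1, 0), (-1, 0), (0, 1), (0, -1)}"

lemma sum_unit_vecs: "(\<Sum>e\<in>unit_vecs. g e) = g (1, 0) + g (-1, 0) + g (0, 1) + g (0, -1)"
  for g :: "int \<times> int \<Rightarrow> real"
  by (simp add: unit_vecs_def)

lemma walk2_nonneg: "0 \<le> walk2 n z"
  by (simp add: walk2_def walk1_nonneg)

lemma walk2_0: "walk2 0 z = (if z = 0 then 1 else 0)"
  by (cases z) (auto simp: walk2_def zero_prod_def)

lemma walk2_Suc: "walk2 (Suc n) z = (\<Sum>e\<in>unit_vecs. walk2 n (z + e)) / 4"
  by (simp add: sum_unit_vecs walk2_def algebra_simps)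

lemma walk2_le: "walk2 n z \<le> 2 / (real n + 1)"
proof -
  have c: "(walk1 (2 * m) 0)\<^sup>2 \<le> 1 / (2 * real m + 1)" for m
    using central_upper[of m] by (simp add: le_divide_eq)
  have *: "walk1 (2 * m + r) j \<le> walk1 (2 * m) 0" if "r \<le> 1" for m r j
  proof (cases "r = 0")
    case False
    then have "r = 1" using that by simp
    then show ?thesis using walk1_even_le[of m "j - 1"] walk1_even_le[of m "j + 1"] by simp
  qed (use walk1_even_le in simp)
  define m r where "m = n div 2" and "r = n mod 2"
  have n: "n = 2 * m + r" "r \<le> 1" by (auto simp: m_def r_def)
  have "walk2 n z \<le> walk1 (2 * m) 0 * walk1 (2 * m) 0"
    unfolding walk2_def n(1) by (intro mult_mono * n walk1_nonneg)
  also have "\<dots> \<le> 1 / (2 * real m + 1)" using c by (simp add: power2_eq_square)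
  also have "\<dots> \<le> 2 / (real n + 1)" using n by (simp add: frac_le divide_simps)
  finally show ?thesis .
qed

lemma walk2_even_le: "walk2 (2 * n) z \<le> walk2 (2 * n) 0"
  unfolding walk2_def by (intro mult_mono) (auto intro!: walk1_even_le walk1_nonneg)

lemma walk2_odd: "odd (int n + fst z + snd z) \<Longrightarrow> walk2 n z = 0"
  by (simp add: walk2_def walk1_odd add.assoc)

lemma walk2_odd_le: "walk2 (Suc (2 * n)) z \<le> walk2 (2 * n) 0"
  unfolding walk2_Suc sum_unit_vecs
  using walk2_even_le[of n "z + (1, 0)"] walk2_even_le[of n "z + (-1, 0)"]
    walk2_even_le[of n "z + (0, 1)"] walk2_even_le[of n "z + (0, -1)"] by simp

lemma sum_walk2_le: "finite S \<Longrightarrow> (\<Sum>z\<in>S. walk2 n (z - c)) \<le> 1"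
proof (induction n arbitrary: S c)
  case 0
  have "(\<Sum>z\<in>S. walk2 0 (z - c)) = (\<Sum>z\<in>S. if z = c then 1 else 0)"
    by (simp add: walk2_0)
  then show ?case using 0 by simp
next
  case (Suc n)
  have "(\<Sum>z\<in>S. walk2 (Suc n) (z - c)) = (\<Sum>e\<in>unit_vecs. \<Sum>z\<in>S. walk2 n (z - (c - e))) / 4"
    unfolding walk2_Suc sum_divide_distrib[symmetric] by (subst sum.swap) (simp add: algebra_simps)
  also have "\<dots> \<le> (\<Sum>e\<in>unit_vecs. 1) / 4"
    by (intro divide_right_mono sum_mono Suc) auto
  also have "\<dots> = 1" by (simp add: unit_vecs_def)
  finally show ?case .
qed

section \<open>Green function of the planar walk truncated at time \<open>M\<close>\<close>

definition pot :: "nat \<Rightarrow> int \<times> int \<Rightarrow> real" where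
  "pot M z = (\<Sum>i<M. walk2 i z)"

lemma pot_nonneg: "0 \<le> pot M z"
  by (simp add: pot_def sum_nonneg walk2_nonneg)

text \<open>Averaging over neighbours advances each \<open>walk2 i\<close> by one time unit, so the
  sum telescopes: the Poisson equation holds up to the last term \<open>walk2 M z\<close>.\<close>

lemma pot_unit_vecs:
  "(\<Sum>e\<in>unit_vecs. pot M (z + e)) / 4 = pot M z - (if z = 0 then 1 else 0) + walk2 M z"
proof -
  have "(\<Sum>e\<in>unit_vecs. pot M (z + e)) / 4 = (\<Sum>i<M. walk2 (Suc i) z)"
    unfolding pot_def walk2_Suc sum_divide_distrib[symmetric] by (subst sum.swap) simp
  also have "\<dots> = pot (Suc M) z - walk2 0 z"
    unfolding pot_def sum.lessThan_Suc_shift by simp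
  finally show ?thesis by (simp add: pot_def walk2_0)
qed

lemma sum_inverse_le_ln:
  assumes "1 \<le> m" "m \<le> M"
  shows "(\<Sum>i\<in>{m..<M}. 1 / (real i + 1)) \<le> ln (real M / real m)"
  using assms(2,1)
proof (induction M rule: dec_induct)
  case base
  then show ?case by simp
next
  case (step M)
  then have M: "0 < real M" by simp
  have "ln (real M / (real M + 1)) \<le> real M / (real M + 1) - 1"
    by (rule ln_le_minus_one) (use M in auto)
  also have "\<dots> = - (1 / (real M + 1))" by (simp add: field_simps)
  finally have "1 / (real M + 1) \<le> ln (real (Suc M)) - ln (real M)" using M by (simp add: ln_div add.commute)
  then show ?case using step by (simp add: ln_div)
qed

lemma sum_inverse_ge_ln: "ln (real M) \<le> (\<Sum>i<M. 1 / (real i + 1))" if "1 \<le> M"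
proof -
  have "ln (real M) \<le> ln (real M + 1)" using that by simp
  also have "\<dots> \<le> harm M" by (rule ln_le_harm)
  also have "\<dots> = (\<Sum>i<M. 1 / (real i + 1))" by (simp add: harm_altdef inverse_eq_divide add.commute)
  finally show ?thesis .
qed

lemma pot_le: "1 \<le> M \<Longrightarrow> pot M z \<le> 2 + 2 * ln (real M)"
proof -
  assume M: "1 \<le> M"
  have "pot M z \<le> (\<Sum>i<M. 2 * (1 / (real i + 1)))"
    unfolding pot_def using walk2_le by (intro sum_mono) simp
  also have "\<dots> = 2 * (\<Sum>i<M. 1 / (real i + 1))" by (simp add: sum_distrib_left)
  also have "(\<Sum>i<M. 1 / (real i + 1)) = 1 + (\<Sum>i\<in>{1..<M}. 1 / (real i + 1))"
    using M by (simp add: lessThan_atLeast0 sum.atLeast_Suc_lessThan)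
  also have "\<dots> \<le> 1 + ln (real M)" using sum_inverse_le_ln[of 1 M] M by simp
  finally show ?thesis by simp
qed

text \<open>The late terms are bounded uniformly in \<open>z\<close>; with \<open>m\<close> a
  polylogarithmic fraction of \<open>M\<close> they cost only a log log.\<close>

lemma pot_split_le: "1 \<le> m \<Longrightarrow> m \<le> M \<Longrightarrow> pot M z \<le> pot m z + 2 * ln (real M / real m)"
proof -
  assume m: "1 \<le> m" "m \<le> M"
  have "pot M z = pot m z + (\<Sum>i\<in>{m..<M}. walk2 i z)"
    unfolding pot_def using m by (simp add: lessThan_atLeast0 sum.atLeastLessThan_concat)
  also have "(\<Sum>i\<in>{m..<M}. walk2 i z) \<le> (\<Sum>i\<in>{m..<M}. 2 * (1 / (real i + 1)))"
    using walk2_le by (intro sum_mono) simp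
  also have "\<dots> = 2 * (\<Sum>i\<in>{m..<M}. 1 / (real i + 1))" by (simp add: sum_distrib_left)
  also have "\<dots> \<le> 2 * ln (real M / real m)" using sum_inverse_le_ln[OF m] by simp
  finally show ?thesis by simp
qed

lemma pot_even: "pot (2 * m) z = (\<Sum>j<m. walk2 (2 * j) z + walk2 (Suc (2 * j)) z)"
  by (induction m) (auto simp: pot_def)

lemma pot_0_ge: "1 \<le> m \<Longrightarrow> ln (real m) / 4 \<le> pot (2 * Suc m) 0"
proof -
  assume m: "1 \<le> m"
  have *: "1 / (real j + 1) / 4 \<le> walk2 (2 * Suc j) 0" for j
    using central_lower[of j] unfolding walk2_def by (simp add: power2_eq_square field_simps del: walk1.simps)
  have "ln (real m) / 4 \<le> (\<Sum>j<m. 1 / (real j + 1)) / 4" using sum_inverse_ge_ln[OF m] by simp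
  also have "\<dots> = (\<Sum>j<m. 1 / (real j + 1) / 4)" by (rule sum_divide_distrib)
  also have "\<dots> \<le> (\<Sum>j<m. walk2 (2 * Suc j) 0)" by (intro sum_mono *)
  also have "\<dots> \<le> (\<Sum>j<Suc m. walk2 (2 * j) 0)" by (subst sum.lessThan_Suc_shift) (simp add: walk2_nonneg)
  also have "\<dots> \<le> pot (2 * Suc m) 0" unfolding pot_even by (intro sum_mono) (simp add: walk2_nonneg)
  finally show ?thesis .
qed

text \<open>The even cutoff pairs the times \<open>2 * j\<close> and \<open>2 * j + 1\<close>.
  Parity kills one of the two at \<open>z\<close>, and the survivor is at most the even return
  probability at 0; an odd time taken alone would violate the comparison.\<close>

lemma pot_le_pot_0: "pot (2 * m) z \<le> pot (2 * m) 0"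
  unfolding pot_even
proof (rule sum_mono)
  fix j
  show "walk2 (2 * j) z + walk2 (Suc (2 * j)) z \<le> walk2 (2 * j) 0 + walk2 (Suc (2 * j)) 0"
  proof (cases "even (fst z + snd z)")
    case True
    then have "walk2 (Suc (2 * j)) z = 0" by (intro walk2_odd) (auto simp: add.assoc)
    then show ?thesis using walk2_even_le[of j z] walk2_nonneg[of "Suc (2 * j)" 0] by simp
  next
    case False
    then have "walk2 (2 * j) z = 0" by (intro walk2_odd) (auto simp: add.assoc)
    then show ?thesis using walk2_odd_le[of j z] walk2_nonneg[of "Suc (2 * j)" 0] by simp
  qed
qed

text \<open>The defect \<open>pot M 0 - pot M z\<close> is nonnegative and its mean over the neighbours of \<open>z\<close>
  exceeds its value at \<open>z\<close> by at most 1, so it is bounded uniformly in \<open>M\<close>.\<close>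

lemma pot_defect_bounded: "\<exists>C. \<forall>m. pot (2 * m) 0 - pot (2 * m) z \<le> C"
proof -
  let ?P = "\<lambda>z. \<exists>C. \<forall>m. pot (2 * m) 0 - pot (2 * m) z \<le> C"
  have step: "?P (z + e)" if e: "e \<in> unit_vecs" and z: "?P z" for z e
  proof -
    from z obtain C where C: "\<And>m. pot (2 * m) 0 - pot (2 * m) z \<le> C" by blast
    have "pot (2 * m) 0 - pot (2 * m) (z + e) \<le> 4 * (C + 1)" for m
    proof -
      let ?D = "\<lambda>w. pot (2 * m) 0 - pot (2 * m) w"
      have "?D (z + e) \<le> (\<Sum>e\<in>unit_vecs. ?D (z + e))"
        by (rule member_le_sum[OF e]) (auto simp: pot_le_pot_0 unit_vecs_def)
      also have "\<dots> = 4 * (pot (2 * m) 0 - (\<Sum>e\<in>unit_vecs. pot (2 * m) (z + e)) / 4)"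
        by (simp add: sum_unit_vecs field_simps)
      also have "\<dots> \<le> 4 * (?D z + 1)"
        unfolding pot_unit_vecs using walk2_nonneg[of "2 * m" z] by auto
      also have "\<dots> \<le> 4 * (C + 1)" using C[of m] by simp
      finally show ?thesis .
    qed
    then show ?thesis by blast
  qed
  have 1: "?P (a, 0)" for a
  proof (induction a rule: int_induct[where k = 0])
    case base
    then show ?case by (intro exI[of _ 0]) (simp add: zero_prod_def)
  next
    case (step1 i)
    then show ?case using step[of "(1, 0)" "(i, 0)"] by (simp add: unit_vecs_def)
  next
    case (step2 i)
    then show ?case using step[of "(-1, 0)" "(i, 0)"] by (simp add: unit_vecs_def)
  qed
  have "?P (a, c)" for a c
  proof (induction c rule: int_induct[where k = 0])
    case base
    then show ?case by (rule 1)
  next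
    case (step1 i)
    then show ?case using step[of "(0, 1)" "(a, i)"] by (simp add: unit_vecs_def)
  next
    case (step2 i)
    then show ?case using step[of "(0, -1)" "(a, i)"] by (simp add: unit_vecs_def)
  qed
  then show ?thesis by (cases z) blast
qed

section \<open>Combs over the square lattice\<close>

lemma edges_Z2: "{z, w} \<in> edges Z2 \<longleftrightarrow> w - z \<in> unit_vecs"
proof -
  have "{z, w} \<in> edges Z2 \<longleftrightarrow> \<bar>fst z - fst w\<bar> + \<bar>snd z - snd w\<bar> = 1"
    by (auto simp: Z2_def doubleton_eq_iff abs_minus_commute simp del: split_paired_Ex)
  also have "\<dots> \<longleftrightarrow> w - z \<in> unit_vecs"
    by (cases z; cases w) (auto simp: unit_vecs_def)
  finally show ?thesis .
qed

lemma finite_unit_vecs [simp]: "finite unit_vecs" and card_unit_vecs: "card unit_vecs = 4"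
  by (simp_all add: unit_vecs_def)

lemma sup_norm_triangle: "sup_norm (z + w) \<le> sup_norm z + sup_norm w"
  by (simp add: sup_norm_def) linarith

lemma sup_norm_unit: "e \<in> unit_vecs \<Longrightarrow> sup_norm e = 1"
  by (auto simp: unit_vecs_def sup_norm_def)

lemma sup_norm_nonneg: "0 \<le> sup_norm z"
  by (simp add: sup_norm_def)

definition zbox :: "nat \<Rightarrow> (int \<times> int) set" where
  "zbox R = {z. sup_norm z \<le> int R}"

lemma zbox_eq: "zbox R = {- int R..int R} \<times> {- int R..int R}"
  by (auto simp: zbox_def sup_norm_def)

lemma finite_zbox [simp]: "finite (zbox R)"
  by (simp add: zbox_eq)

lemma card_zbox: "card (zbox R) = (2 * R + 1)\<^sup>2"
proof -
  have "nat (int R - (- int R) + 1) = 2 * R + 1" by arith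
  then show ?thesis by (simp add: zbox_eq card_cartesian_product power2_eq_square)
qed

locale comb =
  fixes f :: "int \<times> int \<Rightarrow> nat"
begin

abbreviation G :: "((int \<times> int) \<times> nat) ugraph" where "G \<equiv> Comb Z2 (\<lambda>z. enat (f z))"
abbreviation N :: "(int \<times> int) \<times> nat \<Rightarrow> ((int \<times> int) \<times> nat) set" where "N \<equiv> nbrs G"

lemma verts_G: "(z, h) \<in> verts G \<longleftrightarrow> h \<le> f z"
  by (simp add: Comb_def Z2_def)

lemma mem_N: "(w, k) \<in> N (z, h) \<longleftrightarrow>
    h = 0 \<and> k = 0 \<and> w - z \<in> unit_vecs \<or> w = z \<and> \<bar>int h - int k\<bar> = 1 \<and> h \<le> f z \<and> k \<le> f z"
proof -
  have 1: "{(z, h), (w, k)} \<in> {{(u, 0::nat), (v, 0)} | u v. {u, v} \<in> edges Z2} \<longleftrightarrow>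
      h = 0 \<and> k = 0 \<and> {z, w} \<in> edges Z2"
    by (auto simp: doubleton_eq_iff insert_commute simp del: split_paired_Ex)
  have 2: "{(z, h), (w, k)} \<in> {{(v, m), (v, n)} | v m n. v \<in> verts Z2 \<and> \<bar>int m - int n\<bar> = 1 \<and>
                                        enat m \<le> enat (f v) \<and> enat n \<le> enat (f v)} \<longleftrightarrow>
     w = z \<and> \<bar>int h - int k\<bar> = 1 \<and> h \<le> f z \<and> k \<le> f z"
    by (auto simp: doubleton_eq_iff Z2_def abs_minus_commute simp del: split_paired_Ex)
  show ?thesis
    unfolding edges_Z2[symmetric] using 1 2 by (simp add: nbrs_def Comb_def)
qed

lemma N_base: "N (z, 0) = (\<lambda>e. (z + e, 0)) ` unit_vecs \<union> (if 1 \<le> f z then {(z, 1)} else {})"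
proof -
  have "(w, k) \<in> N (z, 0) \<longleftrightarrow> (w, k) \<in> (\<lambda>e. (z + e, 0)) ` unit_vecs \<union> (if 1 \<le> f z then {(z, 1)} else {})" for w k
    unfolding mem_N by (auto simp: image_iff intro!: bexI[of _ "w - z"])
  then show ?thesis by auto
qed

lemma N_mid: "0 < h \<Longrightarrow> h < f z \<Longrightarrow> N (z, h) = {(z, h - 1), (z, h + 1)}"
proof -
  assume h: "0 < h" "h < f z"
  have "(w, k) \<in> N (z, h) \<longleftrightarrow> (w, k) \<in> {(z, h - 1), (z, h + 1)}" for w k
    unfolding mem_N using h by auto
  then show ?thesis by auto
qed

lemma N_top: "0 < h \<Longrightarrow> h = f z \<Longrightarrow> N (z, h) = {(z, h - 1)}"
proof -
  assume h: "0 < h" "h = f z"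
  have "(w, k) \<in> N (z, h) \<longleftrightarrow> (w, k) \<in> {(z, h - 1)}" for w k
    unfolding mem_N using h by auto
  then show ?thesis by auto
qed

lemma vertex_cases:
  assumes "(z, h) \<in> verts G"
  obtains "h = 0" "f z = 0" | "h = 0" "1 \<le> f z" | "0 < h" "h < f z" | "0 < h" "h = f z"
  using assms unfolding verts_G by linarith

lemma sum_image_unit_vecs: "(\<Sum>w\<in>(\<lambda>e. (z + e, 0::nat)) ` unit_vecs. u w) = (\<Sum>e\<in>unit_vecs. u (z + e, 0))"
  for u :: "(int \<times> int) \<times> nat \<Rightarrow> real"
  by (subst sum.reindex) (auto simp: inj_on_def)

lemma card_N_base: "card (N (z, 0)) = (if 1 \<le> f z then 5 else 4)"
proof -
  have c: "card ((\<lambda>e. (z + e, 0::nat)) ` unit_vecs) = 4"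
    by (subst card_image) (auto simp: inj_on_def card_unit_vecs)
  have "(z, 1) \<notin> (\<lambda>e. (z + e, 0::nat)) ` unit_vecs" by auto
  then show ?thesis unfolding N_base using c by simp
qed

lemma avg_base_bare: "f z = 0 \<Longrightarrow> avg N u (z, 0) = (\<Sum>e\<in>unit_vecs. u (z + e, 0)) / 4"
  unfolding avg_def card_N_base by (simp add: N_base sum_image_unit_vecs)

lemma avg_base: "1 \<le> f z \<Longrightarrow> avg N u (z, 0) = ((\<Sum>e\<in>unit_vecs. u (z + e, 0)) + u (z, 1)) / 5"
proof -
  assume f: "1 \<le> f z"
  have "(z, 1) \<notin> (\<lambda>e. (z + e, 0::nat)) ` unit_vecs" by auto
  then show ?thesis
    using f unfolding avg_def card_N_base by (simp add: N_base sum_image_unit_vecs)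
qed

lemma avg_mid: "0 < h \<Longrightarrow> h < f z \<Longrightarrow> avg N u (z, h) = (u (z, h - 1) + u (z, h + 1)) / 2"
  by (simp add: avg_def N_mid)

lemma avg_top: "0 < h \<Longrightarrow> h = f z \<Longrightarrow> avg N u (z, h) = u (z, h - 1)"
  by (simp add: avg_def N_top)

lemmas avg_simps = avg_base_bare avg_base avg_mid avg_top

sublocale walk_graph G
proof
  show "finite (nbrs G x)" for x by (rule finite_nbrs_Comb_Z2)
  show "nbrs G x \<noteq> {}" if "x \<in> verts G" for x using that by (rule nbrs_Comb_Z2_nonempty)
  show "y \<in> verts G" if "x \<in> verts G" "y \<in> nbrs G x" for x y
    using that by (cases x; cases y) (auto simp: verts_G mem_N)
qed

sublocale sym_nbrs N
proof
  show "finite (N x)" for x by (rule finite_nbrs_Comb_Z2)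
  show "w \<in> N x \<longleftrightarrow> x \<in> N w" for w x
    unfolding nbrs_def by (simp add: insert_commute)
qed

lemma deg_bounds:
  assumes "x \<in> verts G"
  shows "1 \<le> deg x" "deg x \<le> 5"
proof -
  obtain z h where x: "x = (z, h)" by (cases x)
  from assms[unfolded x] have "1 \<le> deg x \<and> deg x \<le> 5"
    by (cases rule: vertex_cases) (simp_all add: x card_N_base N_mid N_top)
  then show "1 \<le> deg x" "deg x \<le> 5" by auto
qed

definition bbox :: "nat \<Rightarrow> ((int \<times> int) \<times> nat) set" where
  "bbox R = (SIGMA z:zbox R. {..f z})"

lemma finite_bbox [simp]: "finite (bbox R)"
  by (simp add: bbox_def)

lemma mem_bbox: "(z, h) \<in> bbox R \<longleftrightarrow> sup_norm z \<le> int R \<and> h \<le> f z"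
  by (auto simp: bbox_def zbox_def)

lemma bbox_verts: "x \<in> bbox R \<Longrightarrow> x \<in> verts G"
  by (cases x) (simp add: mem_bbox verts_G)

lemma bbox_mono: "R \<le> R' \<Longrightarrow> bbox R \<subseteq> bbox R'"
  by (auto simp: mem_bbox)

lemma N_bbox: "x \<in> bbox R \<Longrightarrow> y \<in> N x \<Longrightarrow> y \<in> bbox (Suc R)"
proof -
  assume x: "x \<in> bbox R" and y: "y \<in> N x"
  obtain z h w k where [simp]: "x = (z, h)" "y = (w, k)" by (cases x; cases y)
  have "k \<le> f w" using nbrs_closed[of x y] bbox_verts[OF x] y by (simp add: verts_G)
  moreover have "sup_norm w \<le> sup_norm z + 1"
    using y sup_norm_triangle[of z "w - z"] sup_norm_unit[of "w - z"] by (auto simp: mem_N)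
  ultimately show "y \<in> bbox (Suc R)" using x by (simp add: mem_bbox)
qed

lemma reach_bbox: "x \<in> bbox R \<Longrightarrow> reach N n x \<subseteq> bbox (R + n)"
proof (induction n arbitrary: x R)
  case (Suc n)
  have "reach N n w \<subseteq> bbox (R + Suc n)" if "w \<in> N x" for w
    using Suc.IH[of w "Suc R"] N_bbox[OF Suc.prems that] by simp
  then show ?case by auto
qed simp

lemma verts_bbox: "x \<in> verts G \<Longrightarrow> x \<in> bbox (nat (sup_norm (fst x)))"
  by (cases x) (simp add: mem_bbox verts_G sup_norm_nonneg)

lemma reach_verts: "x \<in> verts G \<Longrightarrow> y \<in> reach N n x \<Longrightarrow> y \<in> verts G"
  using reach_bbox[OF verts_bbox, of x n] bbox_verts by blast

lemma iter_const: "x \<in> verts G \<Longrightarrow> iter N n (\<lambda>_. c) x = c"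
proof (induction n arbitrary: x)
  case (Suc n)
  have "avg N (iter N n (\<lambda>_. c)) x = avg N (\<lambda>_. c) x"
    by (rule avg_cong) (use Suc nbrs_closed in auto)
  then show ?case using Suc.prems nbrs_finite nbrs_nonempty by (simp add: avg_const)
qed simp

definition parity :: "(int \<times> int) \<times> nat \<Rightarrow> int" where
  "parity x = fst (fst x) + snd (fst x) + int (snd x)"

text \<open>The comb is bipartite, so two walks can meet only if their starting points have equal
  parity.\<close>

lemma parity_N: "y \<in> N x \<Longrightarrow> odd (parity y + parity x)"
proof -
  assume y: "y \<in> N x"
  obtain a b h a' b' k where [simp]: "x = ((a, b), h)" "y = ((a', b'), k)" by (metis prod.collapse)
  from y consider "h = 0" "k = 0" "(a' - a, b' - b) \<in> unit_vecs" | "a' = a" "b' = b" "\<bar>int h - int k\<bar> = 1"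
    by (auto simp: mem_N)
  then show ?thesis
  proof cases
    case 1
    then have "a' = a + 1 \<and> b' = b \<or> a' = a - 1 \<and> b' = b \<or> a' = a \<and> b' = b + 1 \<or> a' = a \<and> b' = b - 1"
      by (auto simp: unit_vecs_def)
    then show ?thesis using 1 by (auto simp: parity_def)
  next
    case 2
    then have "odd (int k + int h)" by presburger
    moreover have "parity y + parity x = 2 * (a + b) + (int k + int h)" using 2 by (simp add: parity_def)
    ultimately show ?thesis by simp
  qed
qed

lemma ker_parity: "odd (int n + parity x + parity y) \<Longrightarrow> ker N n x y = 0"
proof (induction n arbitrary: x)
  case 0
  then show ?case by (auto simp: ker_def indicator_def)
next
  case (Suc n)
  have "avg N (\<lambda>w. ker N n w y) x = avg N (\<lambda>_. 0) x"
  proof (rule avg_cong)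
    fix w assume "w \<in> N x"
    from parity_N[OF this] Suc.prems show "ker N n w y = 0" by (intro Suc.IH) auto
  qed
  then show ?case by (simp add: ker_Suc)
qed

section \<open>Potentials for the occupation time of a vertex\<close>

definition occ :: "nat \<Rightarrow> (int \<times> int) \<times> nat \<Rightarrow> (int \<times> int) \<times> nat \<Rightarrow> real" where
  "occ T x y = (\<Sum>n<T. ker N n x y)"

lemma occ_mono: "m \<le> T \<Longrightarrow> occ m x y \<le> occ T x y"
  unfolding occ_def by (intro sum_mono2) (auto simp: ker_nonneg)

text \<open>Up to a factor 2, or 1 if \<open>y\<close> is the tip, this is the Green function of the
  tooth of \<open>y\<close> killed at its base.\<close>

definition ramp :: "(int \<times> int) \<times> nat \<Rightarrow> (int \<times> int) \<times> nat \<Rightarrow> real" where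
  "ramp y x = (if fst x = fst y then real (min (snd x) (snd y)) else 0)"

lemma ramp_nonneg: "0 \<le> ramp y x" by (simp add: ramp_def)

lemma ramp_base: "ramp y (z, 0) = 0"
  by (simp add: ramp_def)

text \<open>The function is linear up to the height of \<open>y\<close> and constant above, so only
  the kink and the base contribute; the base has degree 5 and a single neighbour at height
  1.\<close>

lemma ramp_drift:
  assumes "x \<in> verts G" "y \<in> verts G"
  shows "ramp y x - avg N (ramp y) x =
    (if x = y \<and> 0 < snd y then (if snd y = f (fst y) then 1 else 1 / 2) else 0)
     - (if x = (fst y, 0) \<and> 0 < snd y then 1 / 5 else 0)"
proof -
  obtain z h z0 h0 where [simp]: "x = (z, h)" "y = (z0, h0)" by (cases x; cases y)
  have h0: "h0 \<le> f z0" using assms by (simp add: verts_G)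
  from assms(1) have "(z, h) \<in> verts G" by simp
  then show ?thesis
  proof (cases rule: vertex_cases)
    case 3
    then show ?thesis using h0 by (auto simp: avg_mid ramp_def min_def of_nat_diff field_simps)
  qed (use h0 in \<open>auto simp: avg_simps ramp_base, (auto simp: ramp_def min_def of_nat_diff)\<close>)
qed

text \<open>Constancy along the tooth leaves the planar Laplacian, slowed by \<open>4 / 5\<close>
  where one of the five neighbours lies in the tooth.\<close>

lemma pot_drift:
  assumes "(z, h) \<in> verts G"
  shows "pot M (z - c) - avg N (\<lambda>x. pot M (fst x - c)) (z, h) =
    (if 0 < h then 0 else if f z = 0 then 1 else 4 / 5) * ((if z = c then 1 else 0) - walk2 M (z - c))"
proof -
  have s: "(\<Sum>e\<in>unit_vecs. pot M (z + e - c)) = 4 * (pot M (z - c) - (if z = c then 1 else 0) + walk2 M (z - c))"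
    using pot_unit_vecs[of M "z - c"] by (simp add: algebra_simps)
  define \<delta> P W S where "\<delta> = (if z = c then 1 else 0 :: real)" and "P = pot M (z - c)" and "W = walk2 M (z - c)"
    and "S = (\<Sum>e\<in>unit_vecs. pot M (z + e - c))"
  have s: "S = 4 * (P - \<delta> + W)" using s by (simp add: \<delta>_def P_def W_def S_def)
  show ?thesis using assms
    unfolding \<delta>_def[symmetric] P_def[symmetric] W_def[symmetric]
    by (cases rule: vertex_cases)
      (simp_all add: avg_simps S_def[symmetric] P_def[symmetric], simp_all add: s field_simps)
qed

text \<open>The kink of \<open>ramp y\<close> at \<open>y\<close> produces the indicator, at the price of a defect at the base of
  the tooth. The multiple of the potential compensates this defect when bounding from above; when
  bounding from below the factor \<open>1 / 2\<close> makes the two terms at the base cancel exactly.\<close>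

lemma indicator_le_drift:
  fixes M :: nat
  assumes "x \<in> verts G" "y \<in> verts G"
  defines "\<phi> \<equiv> \<lambda>x. 2 * ramp y x + 5 / 4 * pot M (fst x - fst y)"
  shows "indicat_real {y} x \<le> \<phi> x - avg N \<phi> x + 5 / 4 * walk2 M (fst x - fst y)"
proof -
  obtain z h where x: "x = (z, h)" by (cases x)
  have "\<phi> x - avg N \<phi> x = 2 * (ramp y x - avg N (ramp y) x) + 5 / 4 * (pot M (z - fst y) - avg N (\<lambda>x. pot M (fst x - fst y)) x)"
    unfolding \<phi>_def avg_add avg_cmult x fst_conv by (simp add: algebra_simps)
  moreover have "0 \<le> walk2 M (z - fst y)" by (rule walk2_nonneg)
  \<comment> \<open>\<open>5 / 4\<close> inverts the slowing factor \<open>4 / 5\<close>, as a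
    target on the base requires; for a higher target it outweighs the base defect
    \<open>2 / 5\<close> of \<open>2 * ramp y\<close>.\<close>
  ultimately show ?thesis
    using ramp_drift[OF assms(1,2)] pot_drift[of z h M "fst y"] assms(1) assms(2)
    by (cases y) (auto simp: x indicator_def algebra_simps verts_G split: if_splits)
qed

lemma drift_le_indicator:
  fixes M :: nat
  assumes "x \<in> verts G" "y \<in> verts G"
  defines "\<phi> \<equiv> \<lambda>x. 2 * ramp y x + 1 / 2 * pot M (fst x - fst y)"
  shows "\<phi> x - avg N \<phi> x \<le> 2 * indicat_real {y} x"
proof -
  obtain z h where x: "x = (z, h)" by (cases x)
  have "\<phi> x - avg N \<phi> x = 2 * (ramp y x - avg N (ramp y) x) + 1 / 2 * (pot M (z - fst y) - avg N (\<lambda>x. pot M (fst x - fst y)) x)"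
    unfolding \<phi>_def avg_add avg_cmult x fst_conv by (simp add: algebra_simps)
  moreover have "0 \<le> walk2 M (z - fst y)" by (rule walk2_nonneg)
  \<comment> \<open>The factor 2 on the right is attained when \<open>y\<close> is the tip of its
    tooth, where \<open>2 * ramp y\<close> has drift 2.\<close>
  ultimately show ?thesis
    using ramp_drift[OF assms(1,2)] pot_drift[of z h M "fst y"] assms(1) assms(2)
    by (cases y) (auto simp: x indicator_def algebra_simps verts_G split: if_splits)
qed

end

section \<open>Occupation times and heat kernel\<close>

lemma sum_lessThan_double: "(\<Sum>n<2 * T. g n) = (\<Sum>j<T. g (2 * j) + g (Suc (2 * j)))" for g :: "nat \<Rightarrow> real"
  by (induction T) auto

text \<open>With heights at most \<open>F\<close>, the first factor bounds the mean time at one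
  vertex up to \<open>T\<close>, the second the number of vertices of a tooth.\<close>

definition occ_bound :: "nat \<Rightarrow> nat \<Rightarrow> real" where
  "occ_bound F T = (2 * real F + 5 * (1 + ln (real T))) * (real F + 1)"

lemma occ_bound_nonneg: "1 \<le> T \<Longrightarrow> 0 \<le> occ_bound F T"
  by (simp add: occ_bound_def)

context comb
begin

lemma occ_le_potential:
  assumes "x \<in> verts G" "y \<in> verts G"
  shows "occ T x y \<le> 2 * ramp y x + 5 / 4 * pot T (fst x - fst y) + 5 / 2"
proof -
  let ?\<phi> = "\<lambda>x. 2 * ramp y x + 5 / 4 * pot T (fst x - fst y)"
  let ?k = "\<lambda>x. 5 / 4 * walk2 T (fst x - fst y)"
  have "occ T x y \<le> ?\<phi> x - iter N T ?\<phi> x + (\<Sum>n<T. iter N n ?k x)"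
    unfolding occ_def ker_def
    by (rule sum_iter_le_potential, rule indicator_le_drift) (use assms reach_verts in auto)
  moreover have "0 \<le> iter N T ?\<phi> x"
    by (rule iter_nonneg) (simp add: ramp_nonneg pot_nonneg)
  moreover have "(\<Sum>n<T. iter N n ?k x) \<le> (\<Sum>n<T. 5 / 2 / (real T + 1))"
  proof (rule sum_mono, rule iter_le_const)
    fix w show "?k w \<le> 5 / 2 / (real T + 1)" using walk2_le[of T "fst w - fst y"] by (simp add: field_simps)
  qed simp
  moreover have "(\<Sum>n<T. 5 / 2 / (real T + 1)) \<le> 5 / 2" by (simp add: field_simps)
  ultimately show ?thesis by linarith
qed

lemma occ_upper:
  assumes "x \<in> verts G" "y \<in> verts G" "1 \<le> T"
  shows "occ T x y \<le> 2 * real (snd y) + 5 * (1 + ln (real T))"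
proof -
  have "2 * ramp y x \<le> 2 * real (snd y)" by (simp add: ramp_def)
  moreover have "5 / 4 * pot T (fst x - fst y) \<le> 5 / 2 + 5 / 2 * ln (real T)"
    using pot_le[OF assms(3), of "fst x - fst y"] by simp
  moreover have "5 / 2 * ln (real T) \<le> 5 * ln (real T)" using assms(3) by simp
  ultimately show ?thesis
    using occ_le_potential[OF assms(1,2), of T] by (simp add: distrib_left)
qed

text \<open>Exchanging sums charges each base point with the mean time spent in its tooth. The box
  of radius \<open>R\<close> contains all that is reached in \<open>T\<close> steps, as heights are
  bounded only locally.\<close>

lemma sum_iter_base_le:
  assumes x: "x \<in> bbox R0" and R: "R0 + T \<le> R" and T: "1 \<le> T"
    and F: "\<And>z. z \<in> zbox R \<Longrightarrow> f z \<le> F" and g: "\<And>z. 0 \<le> g z"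
  shows "(\<Sum>n<T. iter N n (\<lambda>v. g (fst v)) x) \<le> occ_bound F T * (\<Sum>z\<in>zbox R. g z)"
proof -
  have "(\<Sum>n<T. iter N n (\<lambda>v. g (fst v)) x) = (\<Sum>n<T. \<Sum>v\<in>bbox R. g (fst v) * ker N n x v)"
  proof (rule sum.cong[OF refl], rule iter_expand)
    fix n assume "n \<in> {..<T}"
    then show "reach N n x \<subseteq> bbox R"
      using reach_bbox[OF x, of n] bbox_mono[of "R0 + n" R] R by auto
  qed simp
  also have "\<dots> = (\<Sum>v\<in>bbox R. g (fst v) * occ T x v)"
    unfolding occ_def sum_distrib_left by (rule sum.swap)
  also have "\<dots> \<le> (\<Sum>v\<in>bbox R. g (fst v) * (2 * real F + 5 * (1 + ln (real T))))"
  proof (rule sum_mono, rule mult_left_mono)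
    fix v assume v: "v \<in> bbox R"
    then have "snd v \<le> F" using F[of "fst v"] by (cases v) (force simp: bbox_def)
    then show "occ T x v \<le> 2 * real F + 5 * (1 + ln (real T))"
      using occ_upper[OF bbox_verts[OF x] bbox_verts[OF v] T] by simp
  qed (rule g)
  also have "\<dots> = (2 * real F + 5 * (1 + ln (real T))) * (\<Sum>z\<in>zbox R. real (f z + 1) * g z)"
  proof -
    have *: "(\<Sum>v\<in>bbox R. g (fst v) * c) = (\<Sum>z\<in>zbox R. \<Sum>h\<in>{..f z}. g z * c)" for c
      unfolding bbox_def by (subst sum.Sigma) (auto simp: case_prod_beta)
    show ?thesis unfolding * by (simp add: sum_distrib_left sum_distrib_right mult_ac)
  qed
  also have "\<dots> \<le> (2 * real F + 5 * (1 + ln (real T))) * (\<Sum>z\<in>zbox R. (real F + 1) * g z)"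
    using T F g by (intro mult_left_mono sum_mono mult_right_mono) auto
  also have "\<dots> = occ_bound F T * (\<Sum>z\<in>zbox R. g z)"
    by (simp add: occ_bound_def sum_distrib_left mult.assoc)
  finally show ?thesis .
qed

text \<open>Each \<open>walk2 i\<close> has mass at most 1, so the potential has mass at most
  \<open>M\<close> over the plane; its mean over \<open>T\<close> steps is small once
  \<open>M\<close> is far below \<open>T\<close>.\<close>

lemma sum_iter_pot_le:
  assumes "x \<in> bbox R0" "R0 + T \<le> R" "1 \<le> T" "\<And>z. z \<in> zbox R \<Longrightarrow> f z \<le> F"
  shows "(\<Sum>n<T. iter N n (\<lambda>v. pot M (fst v - c)) x) \<le> occ_bound F T * real M"
proof -
  have "(\<Sum>z\<in>zbox R. pot M (z - c)) = (\<Sum>i<M. \<Sum>z\<in>zbox R. walk2 i (z - c))"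
    unfolding pot_def by (rule sum.swap)
  also have "\<dots> \<le> (\<Sum>i<M. 1)" by (intro sum_mono sum_walk2_le) simp
  finally have "(\<Sum>z\<in>zbox R. pot M (z - c)) \<le> real M" by simp
  from mult_left_mono[OF this occ_bound_nonneg[OF assms(3)], of F] show ?thesis
    using sum_iter_base_le[OF assms, of "\<lambda>z. pot M (z - c)"] pot_nonneg by fastforce
qed

lemma sum_iter_tooth_le:
  assumes "x \<in> bbox R0" "R0 + T \<le> R" "1 \<le> T" "\<And>z. z \<in> zbox R \<Longrightarrow> f z \<le> F"
  shows "(\<Sum>n<T. iter N n (\<lambda>v. indicat_real {c} (fst v)) x) \<le> occ_bound F T"
proof -
  have "(\<Sum>z\<in>zbox R. indicat_real {c} z) \<le> 1"
    using card_mono[of "{c}" "zbox R \<inter> {c}"] by (simp add: indicator_def if_distrib cong: if_cong)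
  from mult_left_mono[OF this occ_bound_nonneg[OF assms(3)], of F] show ?thesis
    using sum_iter_base_le[OF assms, of "indicat_real {c}"] by fastforce
qed

text \<open>Even return probabilities decrease, so \<open>T\<^sup>2 * ker N (4 * T) v v\<close> is at most the occupation time of
  \<open>v\<close> during a window of length \<open>2 * T\<close>, summed over its starting time \<open>k < T\<close>. The part of the
  potential coming from fewer than \<open>m\<close> base steps is negligible after summation over \<open>k\<close>; the rest
  contributes only \<open>ln (2 * T / m)\<close>.\<close>

lemma ker_diag_le:
  assumes v: "v \<in> bbox R0" and R: "R0 + T \<le> R" and T: "1 \<le> T"
    and F: "\<And>z. z \<in> zbox R \<Longrightarrow> f z \<le> F" and m: "1 \<le> m" "m \<le> 2 * T"
  shows "real T * real T * ker N (4 * T) v v \<le>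
    occ_bound F T * (2 * real F + 2 * real m) + 5 / 2 * real T * ln (real (2 * T) / real m) + 5 / 2 * real T"
proof -
  let ?L = "ln (real (2 * T) / real m)"
  have V: "v \<in> verts G" by (rule bbox_verts[OF v])
  have deg: "0 < deg v" using deg_bounds[OF V] by simp
  have hF: "snd v \<le> F" using v F[of "fst v"] R by (cases v) (force simp: bbox_def zbox_def)
  have lower: "real T * ker N (4 * T) v v \<le> iter N k (\<lambda>x. occ (2 * T) x v) v" if k: "k < T" for k
  proof -
    have even: "ker N (4 * T) v v \<le> ker N (2 * i) v v" if "2 * i \<le> 4 * T" for i
      using ker_even_antimono[OF deg, of i "2 * T"] that by simp
    have "real T * ker N (4 * T) v v = (\<Sum>j<T. ker N (4 * T) v v)" by simp
    \<comment> \<open>Of two consecutive times one is even, and all times here lie below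
      \<open>4 * T\<close> because \<open>k\<close> and \<open>j\<close> are below
      \<open>T\<close>.\<close>
    also have "\<dots> \<le> (\<Sum>j<T. ker N (k + 2 * j) v v + ker N (k + Suc (2 * j)) v v)"
    proof (rule sum_mono)
      fix j assume j: "j \<in> {..<T}"
      show "ker N (4 * T) v v \<le> ker N (k + 2 * j) v v + ker N (k + Suc (2 * j)) v v"
      proof (cases "even k")
        case True
        then obtain i where "k = 2 * i" by (elim evenE)
        then have "ker N (4 * T) v v \<le> ker N (k + 2 * j) v v" using even[of "i + j"] j k by simp
        then show ?thesis using ker_nonneg[of N "k + Suc (2 * j)" v v] by linarith
      next
        case False
        then obtain i where "k = 2 * i + 1" by (elim oddE)
        then have "ker N (4 * T) v v \<le> ker N (k + Suc (2 * j)) v v" using even[of "i + j + 1"] j k by simp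
        then show ?thesis using ker_nonneg[of N "k + 2 * j" v v] by linarith
      qed
    qed
    also have "\<dots> = (\<Sum>n<2 * T. ker N (k + n) v v)" by (simp add: sum_lessThan_double)
    also have "\<dots> = iter N k (\<lambda>x. occ (2 * T) x v) v"
      unfolding occ_def iter_sum ker_def iter_add ..
    finally show ?thesis .
  qed
  have upper: "iter N k (\<lambda>x. occ (2 * T) x v) v \<le> 2 * real F * iter N k (\<lambda>x. indicat_real {fst v} (fst x)) v
      + 5 / 4 * iter N k (\<lambda>x. pot m (fst x - fst v)) v + (5 / 2 * ?L + 5 / 2)" for k
  proof -
    have "iter N k (\<lambda>x. occ (2 * T) x v) v \<le> iter N k (\<lambda>x. (2 * real F * indicat_real {fst v} (fst x)
      + 5 / 4 * pot m (fst x - fst v)) + (5 / 2 * ?L + 5 / 2)) v"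
    proof (rule iter_mono_reach)
      fix w assume "w \<in> reach N k v"
      then have w: "w \<in> verts G" by (rule reach_verts[OF V])
      have "ramp v w \<le> real F * indicat_real {fst v} (fst w)" using hF by (simp add: ramp_def indicator_def min.coboundedI2)
      then show "occ (2 * T) w v \<le> (2 * real F * indicat_real {fst v} (fst w)
          + 5 / 4 * pot m (fst w - fst v)) + (5 / 2 * ?L + 5 / 2)"
        using occ_le_potential[OF w V, of "2 * T"] pot_split_le[OF m, of "fst w - fst v"] by linarith
    qed
    also have "\<dots> = 2 * real F * iter N k (\<lambda>x. indicat_real {fst v} (fst x)) v
      + 5 / 4 * iter N k (\<lambda>x. pot m (fst x - fst v)) v + (5 / 2 * ?L + 5 / 2)"
      unfolding iter_add_fun iter_cmult iter_const[OF V] ..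
    finally show ?thesis .
  qed
  have "real T * real T * ker N (4 * T) v v = (\<Sum>k<T. real T * ker N (4 * T) v v)" by simp
  also have "\<dots> \<le> (\<Sum>k<T. 2 * real F * iter N k (\<lambda>x. indicat_real {fst v} (fst x)) v
      + 5 / 4 * iter N k (\<lambda>x. pot m (fst x - fst v)) v + (5 / 2 * ?L + 5 / 2))"
    using order_trans[OF lower upper] by (intro sum_mono) simp
  also have "\<dots> = 2 * real F * (\<Sum>k<T. iter N k (\<lambda>x. indicat_real {fst v} (fst x)) v)
      + 5 / 4 * (\<Sum>k<T. iter N k (\<lambda>x. pot m (fst x - fst v)) v) + real T * (5 / 2 * ?L + 5 / 2)"
    by (simp only: sum.distrib sum_distrib_left[symmetric] sum_constant card_lessThan) (simp add: distrib_left)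
  also have "\<dots> \<le> 2 * real F * occ_bound F T + 5 / 4 * (occ_bound F T * real m) + real T * (5 / 2 * ?L + 5 / 2)"
    by (intro add_mono mult_left_mono order_refl sum_iter_tooth_le[OF v R T F] sum_iter_pot_le[OF v R T F]) auto
  also have "\<dots> \<le> occ_bound F T * (2 * real F + 2 * real m) + 5 / 2 * real T * ?L + 5 / 2 * real T"
    using occ_bound_nonneg[OF T, of F] by (simp add: algebra_simps mult_right_mono)
  finally show ?thesis .
qed

text \<open>\<open>ker_even_le\<close> with degrees between 1 and 5 gives the factor
  \<open>(1 + 5) / 2 = 3\<close>. An odd time is reduced to an even one by a first step, so the
  neighbours of \<open>x\<close> must lie in the box too.\<close>

lemma ker_le_diag:
  assumes H: "\<And>w. w \<in> bbox R \<Longrightarrow> ker N (4 * T) w w \<le> H"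
    and x: "x \<in> bbox R0" "Suc R0 \<le> R" and v: "v \<in> bbox R" and n: "4 * T \<le> n"
  shows "ker N n x v \<le> 3 * H"
proof -
  have H0: "0 \<le> H" using H[OF v] ker_nonneg[of N "4 * T" v v] by linarith
  have diag: "ker N (2 * j) w w \<le> H" if "w \<in> bbox R" "2 * T \<le> j" for w j
    using ker_even_antimono[of w "2 * T" j] H[OF that(1)] that deg_bounds[OF bbox_verts, of w R] by simp
  have even: "ker N (2 * j) w v \<le> 3 * H" if w: "w \<in> bbox R" and j: "2 * T \<le> j" for w j
  proof -
    have d: "1 \<le> deg w" "deg w \<le> 5" "deg v \<le> 5"
      using deg_bounds[OF bbox_verts[OF w]] deg_bounds[OF bbox_verts[OF v]] by auto
    have "2 * deg w * ker N (2 * j) w v \<le> deg w * ker N (2 * j) w w + deg v * ker N (2 * j) v v"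
      using d by (intro ker_even_le) simp
    also have "\<dots> \<le> deg w * H + (deg w * 5) * H"
    proof (rule add_mono)
      show "deg w * ker N (2 * j) w w \<le> deg w * H" using diag[OF w j] by (intro mult_left_mono) auto
      have "deg v * ker N (2 * j) v v \<le> 5 * H"
        using diag[OF v j] d ker_nonneg by (intro mult_mono) auto
      also have "\<dots> \<le> (deg w * 5) * H" using d H0 by (intro mult_right_mono) auto
      finally show "deg v * ker N (2 * j) v v \<le> (deg w * 5) * H" .
    qed
    also have "\<dots> = 2 * deg w * (3 * H)" by simp
    finally show ?thesis using d by (subst (asm) mult_le_cancel_left_pos) auto
  qed
  show ?thesis
  proof (cases "even n")
    case True
    then obtain j where "n = 2 * j" by (elim evenE)
    then show ?thesis using even[of x j] n x bbox_mono[of R0 R] by auto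
  next
    case False
    then obtain j where j: "n = Suc (2 * j)" by (elim oddE) simp
    then have "2 * T \<le> j" using n by presburger
    then show ?thesis unfolding j ker_Suc
      by (intro avg_le_const even) (use N_bbox[OF x(1)] bbox_mono[OF x(2)] H0 in auto)
  qed
qed

text \<open>Bounding one of the two kernels in the collision sum by \<open>H\<close> leaves the mean
  weight seen by a single walk.\<close>

lemma iter_diagw_le:
  assumes H: "\<And>v. v \<in> bbox R \<Longrightarrow> ker N n x v \<le> H"
    and x: "x \<in> bbox R0" "R0 + n \<le> R" and w: "\<And>v. 0 \<le> w v"
  shows "iter (prodN N) n (diagw w) (x, x) \<le> H * iter N n w x"
proof -
  have r: "reach N n x \<subseteq> bbox R" using reach_bbox[OF x(1), of n] bbox_mono[OF x(2)] by auto
  have "iter (prodN N) n (diagw w) (x, x) = (\<Sum>v\<in>bbox R. w v * (ker N n x v * ker N n x v))"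
    by (rule iter_diagw[OF finite_bbox r])
  also have "\<dots> \<le> (\<Sum>v\<in>bbox R. H * (w v * ker N n x v))"
  proof (rule sum_mono)
    fix v assume v: "v \<in> bbox R"
    have "ker N n x v * (w v * ker N n x v) \<le> H * (w v * ker N n x v)"
      by (intro mult_right_mono H[OF v] mult_nonneg_nonneg w ker_nonneg)
    then show "w v * (ker N n x v * ker N n x v) \<le> H * (w v * ker N n x v)" by (simp add: mult_ac)
  qed
  also have "\<dots> = H * iter N n w x"
    unfolding iter_expand[OF finite_bbox r] by (simp add: sum_distrib_left)
  finally show ?thesis .
qed

text \<open>Here the potential at the final time cannot be dropped. Averaging over the final times
  \<open>k < T\<close> replaces it by a time average, which the crude occupation bounds
  control.\<close>

lemma occ_lower:
  assumes x: "x \<in> bbox R0" and y: "y \<in> bbox R0" and R: "R0 + T \<le> R" and T: "1 \<le> T"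
    and F: "\<And>z. z \<in> zbox R \<Longrightarrow> f z \<le> F"
  shows "1 / 2 * pot M (fst x - fst y) - occ_bound F T * (2 * real F + real M) / real T \<le> 2 * occ T x y"
proof -
  let ?\<phi> = "\<lambda>x. 2 * ramp y x + 1 / 2 * pot M (fst x - fst y)"
  have V: "x \<in> verts G" "y \<in> verts G" using bbox_verts x y by auto
  have hF: "snd y \<le> F" using y F[of "fst y"] R by (cases y) (force simp: bbox_def zbox_def)
  have "?\<phi> x - iter N k ?\<phi> x \<le> 2 * occ T x y" if "k < T" for k
  proof -
    have "?\<phi> x - iter N k ?\<phi> x \<le> (\<Sum>n<k. iter N n (\<lambda>w. 2 * indicat_real {y} w) x)"
      by (rule sum_iter_ge_potential, rule drift_le_indicator) (use V reach_verts in auto)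
    also have "\<dots> = 2 * occ k x y" by (simp add: iter_cmult occ_def ker_def sum_distrib_left)
    finally show ?thesis using occ_mono[of k T x y] that by linarith
  qed
  then have "(\<Sum>k<T. ?\<phi> x - iter N k ?\<phi> x) \<le> (\<Sum>k<T. 2 * occ T x y)" by (intro sum_mono) auto
  then have "real T * ?\<phi> x - (\<Sum>k<T. iter N k ?\<phi> x) \<le> real T * (2 * occ T x y)"
    by (simp only: sum_subtractf sum_constant card_lessThan)
  moreover have "(\<Sum>k<T. iter N k ?\<phi> x) \<le> occ_bound F T * (2 * real F + real M)"
  proof -
    have "(\<Sum>k<T. iter N k ?\<phi> x) \<le> (\<Sum>k<T. iter N k (\<lambda>w. 2 * real F * indicat_real {fst y} (fst w)
        + 1 / 2 * pot M (fst w - fst y)) x)"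
      using hF by (intro sum_mono iter_mono) (simp add: ramp_def indicator_def min.coboundedI2)
    also have "\<dots> = 2 * real F * (\<Sum>k<T. iter N k (\<lambda>w. indicat_real {fst y} (fst w)) x)
        + 1 / 2 * (\<Sum>k<T. iter N k (\<lambda>w. pot M (fst w - fst y)) x)"
      unfolding iter_add_fun iter_cmult sum.distrib sum_distrib_left ..
    also have "\<dots> \<le> 2 * real F * occ_bound F T + 1 / 2 * (occ_bound F T * real M)"
      by (intro add_mono mult_left_mono sum_iter_tooth_le[OF x R T F] sum_iter_pot_le[OF x R T F]) auto
    also have "\<dots> \<le> occ_bound F T * (2 * real F + real M)"
      using occ_bound_nonneg[OF T, of F] by (simp add: algebra_simps)
    finally show ?thesis .
  qed
  ultimately have "real T * ?\<phi> x - occ_bound F T * (2 * real F + real M) \<le> real T * (2 * occ T x y)" by linarith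
  then have "?\<phi> x - occ_bound F T * (2 * real F + real M) / real T \<le> 2 * occ T x y"
    using T by (simp add: field_simps)
  then show ?thesis using ramp_nonneg[of y x] by linarith
qed

definition weight :: "(int \<times> int) \<times> nat \<Rightarrow> real" where
  "weight v = 1 / (real (snd v) + 1)"

lemma weight_nonneg: "0 \<le> weight v"
  by (simp add: weight_def)

text \<open>A collision at height \<open>h\<close> is followed by order \<open>h\<close> collisions in the same tooth, at heights
  below \<open>2 * h\<close>: the walk stays there for order \<open>h\<^sup>2\<close> steps.\<close>

lemma weight_collisions_ge:
  assumes v: "v \<in> verts G"
  shows "\<exists>J. 1 / 32 \<le> (\<Sum>n<J. iter (prodN N) n (diagw weight) (v, v))"
proof -
  obtain z h where [simp]: "v = (z, h)" by (cases v)
  have hf: "h \<le> f z" using v by (simp add: verts_G)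
  show ?thesis
  proof (cases "h = 0")
    case True
    then show ?thesis by (intro exI[of _ 1]) (simp add: diagw_def weight_def)
  next
    case False
    \<comment> \<open>Squared displacement from the starting height, frozen at \<open>h^2\<close>
      off the tooth. Its mean grows by at most 1 per step, and it is at least \<open>h^2\<close>
      outside the heights from 1 to \<open>2 * h - 1\<close>.\<close>
    define u where "u x = (if fst x = z then (real (snd x) - real h)\<^sup>2 else (real h)\<^sup>2)" for x :: "(int \<times> int) \<times> nat"
    have drift: "avg N u x \<le> u x + 1" if "x \<in> verts G" for x
    proof -
      obtain z' k where x: "x = (z', k)" by (cases x)
      have b: "u (z' + e, 0) = (real h)\<^sup>2" "u (z', 0) = (real h)\<^sup>2" for e by (auto simp: u_def)
      from that[unfolded x] show ?thesis
      proof (cases rule: vertex_cases)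
        case 1
        then show ?thesis by (simp add: x avg_base_bare b card_unit_vecs)
      next
        case 2
        have "u (z', 1) \<le> (real h)\<^sup>2 + 1" by (simp add: u_def power2_eq_square algebra_simps)
        then show ?thesis using 2 by (simp add: x avg_base b card_unit_vecs)
      next
        case 3
        then have "real (k - 1) = real k - 1" by (simp add: of_nat_diff)
        then show ?thesis using 3 by (simp add: x avg_mid u_def power2_eq_square) (simp add: algebra_simps)
      next
        case 4
        then have "real (k - 1) = real k - 1" by (simp add: of_nat_diff)
        then show ?thesis using 4 hf by (auto simp: x avg_top u_def power2_eq_square algebra_simps)
      qed
    qed
    have iter_u: "iter N n u x \<le> u x + real n" if "x \<in> verts G" for n x
      using that
    proof (induction n arbitrary: x)
      case (Suc n)
      have "iter N (Suc n) u x \<le> avg N (\<lambda>w. u w + real n) x"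
        unfolding iter_Suc by (rule avg_mono) (use Suc nbrs_closed in auto)
      also have "\<dots> = avg N u x + real n"
        using Suc.prems nbrs_finite nbrs_nonempty by (simp add: avg_add avg_const)
      finally show ?case using drift[OF Suc.prems] by simp
    qed simp
    define U where "U = (\<lambda>k. (z, k)) ` {1..<2 * h}"
    have cU: "card U = 2 * h - 1" unfolding U_def by (subst card_image) (auto simp: inj_on_def)
    have fU: "finite U" by (simp add: U_def)
    have stay: "1 / 2 \<le> iter N n (indicat_real U) v" if n: "2 * n \<le> h * h" for n
    proof -
      \<comment> \<open>Markov's inequality for \<open>u\<close>, as a pointwise lower bound on an
        indicator.\<close>
      have "iter N n (\<lambda>x. 1 - 1 / (real h)\<^sup>2 * u x) v \<le> iter N n (indicat_real U) v"
      proof (rule iter_mono)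
        fix x show "1 - 1 / (real h)\<^sup>2 * u x \<le> indicat_real U x"
        proof (cases "x \<in> U")
          case True
          then show ?thesis using False by (simp add: u_def)
        next
          case nU: False
          have "(real h)\<^sup>2 \<le> u x"
          proof (cases "fst x = z")
            case True
            then have "snd x = 0 \<or> 2 * h \<le> snd x" using nU by (cases x) (force simp: U_def)
            then show ?thesis
            proof
              assume "2 * h \<le> snd x"
              then show ?thesis using True by (simp add: u_def power_mono)
            qed (use True in \<open>simp add: u_def\<close>)
          qed (simp add: u_def)
          then show ?thesis using False nU by (simp add: field_simps)
        qed
      qed
      moreover have "iter N n (\<lambda>x. 1 - 1 / (real h)\<^sup>2 * u x) v = 1 - 1 / (real h)\<^sup>2 * iter N n u v"
        using v by (simp only: iter_diff iter_cmult iter_const)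
      moreover have "1 / (real h)\<^sup>2 * iter N n u v \<le> 1 / (real h)\<^sup>2 * real n"
        using iter_u[OF v, of n] by (intro mult_left_mono) (simp_all add: u_def)
      moreover have "1 / (real h)\<^sup>2 * real n \<le> 1 / 2"
      proof -
        have "real (2 * n) \<le> real (h * h)" using n by (simp only: of_nat_le_iff)
        then show ?thesis using False by (simp add: field_simps power2_eq_square)
      qed
      ultimately show ?thesis by linarith
    qed
    have bound: "1 / (16 * (real h)\<^sup>2) \<le> iter (prodN N) n (diagw weight) (v, v)" if n: "2 * n \<le> h * h" for n
    proof -
      define S where "S = reach N n v \<union> U"
      have S: "finite S" "reach N n v \<subseteq> S" "U \<subseteq> S" using finite_reach[OF fin] fU by (auto simp: S_def)
      have h: "0 < real h" using False by simp
      have "iter N n (indicat_real U) v = (\<Sum>w\<in>S. indicat_real U w * ker N n v w)"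
        by (rule iter_expand[OF S(1,2)])
      also have "\<dots> = (\<Sum>w\<in>U. ker N n v w)"
        using S by (intro sum.mono_neutral_cong_right) auto
      finally have "1 / 2 \<le> (\<Sum>w\<in>U. ker N n v w)" using stay[OF n] by simp
      \<comment> \<open>Cauchy-Schwarz over fewer than \<open>2 * h\<close> vertices: both walks are
        in \<open>U\<close> with probability at least \<open>1 / 4\<close>, so they coincide there
        with probability at least \<open>1 / (8 * h)\<close>. The weight on \<open>U\<close> is at
        least \<open>1 / (2 * h)\<close>.\<close>
      then have "(1 / 2)\<^sup>2 \<le> (\<Sum>w\<in>U. ker N n v w)\<^sup>2" by (intro power_mono) auto
      also have "\<dots> \<le> (\<Sum>w\<in>U. (ker N n v w)\<^sup>2) * real (card U)"
        using Cauchy_Schwarz_ineq_sum[of "ker N n v" "\<lambda>_. 1" U] by simp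
      also have "\<dots> \<le> (\<Sum>w\<in>U. (ker N n v w)\<^sup>2) * (2 * real h)"
        by (intro mult_left_mono sum_nonneg) (auto simp: cU)
      finally have "1 / (8 * real h) \<le> (\<Sum>w\<in>U. (ker N n v w)\<^sup>2)" using h by (simp add: field_simps power2_eq_square)
      then have "1 / (2 * real h) * (1 / (8 * real h)) \<le> 1 / (2 * real h) * (\<Sum>w\<in>U. (ker N n v w)\<^sup>2)"
        using h by (intro mult_left_mono) auto
      also have "\<dots> = (\<Sum>w\<in>U. 1 / (2 * real h) * (ker N n v w)\<^sup>2)" by (simp add: sum_distrib_left)
      also have "\<dots> \<le> (\<Sum>w\<in>U. weight w * (ker N n v w * ker N n v w))"
      proof (rule sum_mono)
        fix w assume "w \<in> U"
        then have "real (snd w) + 1 \<le> 2 * real h" by (auto simp: U_def)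
        then have "1 / (2 * real h) \<le> weight w" using h unfolding weight_def by (intro divide_left_mono) auto
        then show "1 / (2 * real h) * (ker N n v w)\<^sup>2 \<le> weight w * (ker N n v w * ker N n v w)"
          unfolding power2_eq_square by (intro mult_right_mono) auto
      qed
      also have "\<dots> \<le> (\<Sum>w\<in>S. weight w * (ker N n v w * ker N n v w))"
        using S by (intro sum_mono2) (auto simp: weight_nonneg)
      also have "\<dots> = iter (prodN N) n (diagw weight) (v, v)" by (rule iter_diagw[OF S(1,2), symmetric])
      finally show ?thesis by (simp add: power2_eq_square)
    qed
    \<comment> \<open>At least \<open>h^2 / 2\<close> times, each contributing
      \<open>1 / (16 * h^2)\<close>, give the constant \<open>1 / 32\<close>.\<close>
    define J where "J = Suc (h * h div 2)"
    have "h * h \<le> 2 * J" unfolding J_def by presburger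
    then have "real (h * h) \<le> real (2 * J)" by (simp only: of_nat_le_iff)
    then have "1 / 32 \<le> real J * (1 / (16 * (real h)\<^sup>2))" using False by (simp add: field_simps power2_eq_square)
    also have "\<dots> = (\<Sum>n<J. 1 / (16 * (real h)\<^sup>2))" by simp
    also have "\<dots> \<le> (\<Sum>n<J. iter (prodN N) n (diagw weight) (v, v))"
      by (intro sum_mono bound) (auto simp: J_def)
    finally show ?thesis by blast
  qed
qed

end

section \<open>The mean weight along a walk\<close>

definition inv_sum :: "nat \<Rightarrow> real" where
  "inv_sum k = (\<Sum>i\<in>{1..<k}. 1 / (real i + 1))"

lemma inv_sum_Suc: "1 \<le> k \<Longrightarrow> inv_sum (Suc k) = inv_sum k + 1 / (real k + 1)"
  by (simp add: inv_sum_def)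

lemma inv_sum_nonneg: "0 \<le> inv_sum k"
  by (simp add: inv_sum_def sum_nonneg)

lemma inv_sum_le: "inv_sum (Suc k) \<le> real k / 2"
proof -
  have "inv_sum (Suc k) \<le> (\<Sum>i\<in>{1..<Suc k}. 1 / 2)"
    unfolding inv_sum_def by (intro sum_mono divide_left_mono) auto
  then show ?thesis by simp
qed

lemma inv_sum_le_ln: "inv_sum (Suc k) \<le> ln (real k + 1)"
  unfolding inv_sum_def using sum_inverse_le_ln[of 1 "Suc k"] by (simp add: add.commute)

text \<open>On a tooth of height \<open>k\<close> the weight \<open>1 / (h + 1)\<close> exceeds \<open>tooth_mean k\<close>, which is of the order of
  its mean, by at most the drift of a function vanishing at the base; the increments of that function
  are \<open>tooth_slope\<close>. The constant 5 is the degree of the base vertex.\<close>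

definition tooth_mean :: "nat \<Rightarrow> real" where
  "tooth_mean k = (if k = 0 then 1 else (5 + 2 * inv_sum (Suc k)) / (2 * real k - 1))"

definition tooth_slope :: "nat \<Rightarrow> nat \<Rightarrow> real" where
  "tooth_slope k j = - 5 - 2 * inv_sum j + 2 * tooth_mean k * (real j - 1)"

definition tooth_fun :: "nat \<Rightarrow> nat \<Rightarrow> real" where
  "tooth_fun k h = (\<Sum>j\<in>{1..h}. tooth_slope k j)"

lemma tooth_mean_nonneg: "0 \<le> tooth_mean k"
  using inv_sum_nonneg[of "Suc k"] by (simp add: tooth_mean_def)

lemma tooth_mean_le_7: "tooth_mean k \<le> 7"
proof (cases "k = 0")
  case False
  then have k: "1 \<le> real k" by simp
  have "5 + 2 * inv_sum (Suc k) \<le> 7 * (2 * real k - 1)" using inv_sum_le[of k] k by (simp add: algebra_simps)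
  then show ?thesis using False k by (simp add: tooth_mean_def divide_le_eq)
qed (simp add: tooth_mean_def)

text \<open>The logarithm hidden in \<open>inv_sum\<close> is traded for an arbitrarily small power
  \<open>a\<close> by \<open>ln_powr_bound\<close>, and \<open>2 * k - 1\<close> is at least
  \<open>k\<close>.\<close>

lemma tooth_mean_le_powr:
  assumes k: "1 \<le> k" and a: "0 < a" "a < 1"
  shows "tooth_mean k \<le> (5 + 4 / a) * real k powr (a - 1)"
proof -
  have k1: "1 \<le> real k" using k by simp
  have "ln (real k + 1) \<le> (real k + 1) powr a / a" using k1 a by (intro ln_powr_bound) auto
  also have "\<dots> \<le> (2 * real k) powr a / a" using k1 a by (intro divide_right_mono powr_mono2) auto
  also have "\<dots> = 2 powr a * real k powr a / a" by (simp add: powr_mult)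
  also have "\<dots> \<le> 2 * real k powr a / a"
    using a powr_mono[of a 1 2] by (intro divide_right_mono mult_right_mono) auto
  finally have "2 * inv_sum (Suc k) \<le> 4 / a * real k powr a" using inv_sum_le_ln[of k] by simp
  moreover have "1 \<le> real k powr a" using k1 a by (simp add: ge_one_powr_ge_zero)
  ultimately have "5 + 2 * inv_sum (Suc k) \<le> (5 + 4 / a) * real k powr a" by (simp add: distrib_right)
  then have "tooth_mean k \<le> ((5 + 4 / a) * real k powr a) / (2 * real k - 1)"
    using k k1 by (simp add: tooth_mean_def divide_right_mono)
  also have "\<dots> \<le> ((5 + 4 / a) * real k powr a) / real k"
    using k1 a by (intro divide_left_mono) auto
  also have "\<dots> = (5 + 4 / a) * real k powr (a - 1)" using k1 by (simp add: powr_diff)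
  finally show ?thesis .
qed

lemma abs_tooth_fun_le: "\<bar>tooth_fun k h\<bar> \<le> 21 * (real h)\<^sup>2"
proof -
  have "\<bar>tooth_slope k j\<bar> \<le> 21 * real h" if "j \<in> {1..h}" for j
  proof -
    have j: "1 \<le> j" "j \<le> h" using that by auto
    then obtain i where i: "j = Suc i" by (cases j) auto
    define t where "t = 2 * tooth_mean k * (real j - 1)"
    have "t \<le> 14 * (real j - 1)"
      unfolding t_def using tooth_mean_le_7[of k] j by (intro mult_right_mono) auto
    then have "t \<le> 14 * real j - 14" by (simp add: algebra_simps)
    moreover have "0 \<le> t" unfolding t_def using tooth_mean_nonneg[of k] j by simp
    moreover have "inv_sum j \<le> real i / 2" "0 \<le> inv_sum j" using inv_sum_le[of i] inv_sum_nonneg i by auto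
    moreover have "1 \<le> real j" "real j \<le> real h" "real j = real i + 1" using j i by auto
    ultimately show ?thesis unfolding tooth_slope_def t_def[symmetric] by linarith
  qed
  then have "(\<Sum>j\<in>{1..h}. \<bar>tooth_slope k j\<bar>) \<le> (\<Sum>j\<in>{1..h}. 21 * real h)" by (intro sum_mono)
  also have "\<dots> = 21 * (real h)\<^sup>2" by (simp add: power2_eq_square)
  finally show ?thesis using sum_abs[of "tooth_slope k" "{1..h}"] unfolding tooth_fun_def by linarith
qed

context comb
begin

text \<open>The slope is -5 at height 1, so that a base of degree 5 has drift 1, which is its
  weight. Inside the tooth the second difference gives equality, and \<open>tooth_mean\<close> is
  the value for which the slope at the tip is \<open>2 / (h + 1) - tooth_mean\<close>, enough for
  the single downward step there.\<close>

lemma weight_le_drift: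
  assumes "x \<in> verts G"
  defines "\<phi> \<equiv> \<lambda>x :: (int \<times> int) \<times> nat. tooth_fun (f (fst x)) (snd x)"
  shows "weight x \<le> \<phi> x - avg N \<phi> x + tooth_mean (f (fst x))"
proof -
  obtain z h where x: "x = (z, h)" by (cases x)
  have 0: "tooth_fun k 0 = 0" for k by (simp add: tooth_fun_def)
  have 1: "tooth_fun k (Suc 0) = - 5" for k by (simp add: tooth_fun_def tooth_slope_def inv_sum_def)
  have S: "tooth_fun k (Suc j) = tooth_fun k j + tooth_slope k (Suc j)" for k j
    by (simp add: tooth_fun_def)
  from assms(1)[unfolded x] show ?thesis
  proof (cases rule: vertex_cases)
    case 1
    then show ?thesis by (simp add: x \<phi>_def weight_def avg_base_bare 0 tooth_mean_def)
  next
    case 2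
    then show ?thesis
      using tooth_mean_nonneg[of "f z"] by (simp add: x \<phi>_def weight_def avg_base 0 \<open>\<And>k. tooth_fun k (Suc 0) = - 5\<close>)
  next
    case 3
    then obtain j where j: "h = Suc j" by (cases h) auto
    have "tooth_slope (f z) (Suc h) = tooth_slope (f z) h - 2 / (real h + 1) + 2 * tooth_mean (f z)"
      using 3 by (simp add: tooth_slope_def inv_sum_Suc algebra_simps)
    then show ?thesis
      using 3 S[of "f z" h] S[of "f z" j] unfolding x \<phi>_def weight_def by (simp add: avg_mid j field_simps)
  next
    case 4
    then obtain j where j: "h = Suc j" using gr0_implies_Suc by blast
    have "2 * real h - 1 \<noteq> 0" using 4 by auto
    then have "tooth_mean (f z) * (2 * real h - 1) = 5 + 2 * inv_sum (Suc h)"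
      using 4 by (simp add: tooth_mean_def)
    then have "tooth_slope (f z) h = - 5 - 2 * inv_sum h + (5 + 2 * inv_sum (Suc h)) - tooth_mean (f z)"
      by (simp add: tooth_slope_def algebra_simps)
    then have "tooth_slope (f z) h = 2 / (real h + 1) - tooth_mean (f z)"
      using 4 by (simp add: inv_sum_Suc)
    moreover have "1 / (real h + 1) \<le> 2 / (real h + 1)" by (intro divide_right_mono) auto
    moreover have "avg N \<phi> (z, h) = \<phi> (z, h - 1)" by (rule avg_top) (use 4 in auto)
    moreover have "\<phi> (z, h - 1) = tooth_fun (f z) j" by (simp add: \<phi>_def j)
    moreover have "\<phi> (z, h) = tooth_fun (f z) j + tooth_slope (f z) h"
      using S[of "f z" j] by (simp add: \<phi>_def j)
    ultimately show ?thesis unfolding x weight_def fst_conv snd_conv by linarith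
  qed
qed

text \<open>The boundary values of \<open>tooth_fun\<close> cost \<open>2 * 21 * F^2\<close>. Teeth
  over \<open>zbox \<rho>\<close> are charged the global bound 7 on the mean, times the expected
  time spent there; all others are charged \<open>\<kappa>\<close> per step.\<close>

lemma sum_weight_le:
  assumes x: "x \<in> bbox R0" and R: "R0 + T \<le> R" and T: "1 \<le> T"
    and F: "\<And>z. z \<in> zbox R \<Longrightarrow> f z \<le> F"
    and \<kappa>: "0 \<le> \<kappa>" "\<And>z. z \<notin> zbox \<rho> \<Longrightarrow> tooth_mean (f z) \<le> \<kappa>"
  shows "(\<Sum>n<T. iter N n weight x) \<le>
    42 * (real F)\<^sup>2 + real T * \<kappa> + 7 * (occ_bound F T * (2 * real \<rho> + 1)\<^sup>2)"
proof -
  let ?\<phi> = "\<lambda>x :: (int \<times> int) \<times> nat. tooth_fun (f (fst x)) (snd x)"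
  have V: "x \<in> verts G" by (rule bbox_verts[OF x])
  have \<phi>: "\<bar>?\<phi> w\<bar> \<le> 21 * (real F)\<^sup>2" if "w \<in> bbox R" for w
  proof -
    have "snd w \<le> F" using that F[of "fst w"] by (cases w) (force simp: bbox_def)
    then have "(real (snd w))\<^sup>2 \<le> (real F)\<^sup>2" by (intro power_mono) auto
    then show ?thesis using abs_tooth_fun_le[of "f (fst w)" "snd w"] by linarith
  qed
  have "(\<Sum>n<T. iter N n weight x) \<le> ?\<phi> x - iter N T ?\<phi> x + (\<Sum>n<T. iter N n (\<lambda>x. tooth_mean (f (fst x))) x)"
    by (rule sum_iter_le_potential, rule weight_le_drift) (use V reach_verts in auto)
  moreover have "?\<phi> x \<le> 21 * (real F)\<^sup>2" using \<phi>[of x] x bbox_mono[of R0 R] R by auto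
  moreover have "- (21 * (real F)\<^sup>2) \<le> iter N T ?\<phi> x"
  proof -
    have "iter N T (\<lambda>_. - (21 * (real F)\<^sup>2)) x \<le> iter N T ?\<phi> x"
    proof (rule iter_mono_reach)
      fix w assume "w \<in> reach N T x"
      then have "w \<in> bbox R" using reach_bbox[OF x, of T] bbox_mono[OF R] by auto
      then show "- (21 * (real F)\<^sup>2) \<le> ?\<phi> w" using \<phi>[of w] by linarith
    qed
    then show ?thesis using iter_const[OF V, of T] by simp
  qed
  moreover have "(\<Sum>n<T. iter N n (\<lambda>x. tooth_mean (f (fst x))) x) \<le>
      real T * \<kappa> + 7 * (occ_bound F T * (2 * real \<rho> + 1)\<^sup>2)"
  proof -
    have "(\<Sum>n<T. iter N n (\<lambda>x. tooth_mean (f (fst x))) x) \<le>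
        (\<Sum>n<T. iter N n (\<lambda>x. \<kappa> + 7 * indicat_real (zbox \<rho>) (fst x)) x)"
    proof (intro sum_mono iter_mono)
      fix w :: "(int \<times> int) \<times> nat"
      show "tooth_mean (f (fst w)) \<le> \<kappa> + 7 * indicat_real (zbox \<rho>) (fst w)"
        using \<kappa>(1) \<kappa>(2)[of "fst w"] tooth_mean_le_7[of "f (fst w)"] by (simp add: indicator_def)
    qed
    also have "\<dots> = real T * \<kappa> + 7 * (\<Sum>n<T. iter N n (\<lambda>x. indicat_real (zbox \<rho>) (fst x)) x)"
      unfolding iter_add_fun iter_cmult iter_const[OF V] sum.distrib sum_distrib_left by simp
    also have "\<dots> \<le> real T * \<kappa> + 7 * (occ_bound F T * (2 * real \<rho> + 1)\<^sup>2)"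
    proof -
      have "(\<Sum>z\<in>zbox R. indicat_real (zbox \<rho>) z) = real (card (zbox R \<inter> zbox \<rho>))"
        by (simp add: indicator_def if_distrib sum.If_cases cong: if_cong)
      also have "\<dots> \<le> real (card (zbox \<rho>))" by (simp add: card_mono)
      also have "\<dots> = (2 * real \<rho> + 1)\<^sup>2" by (simp add: card_zbox)
      finally have "occ_bound F T * (\<Sum>z\<in>zbox R. indicat_real (zbox \<rho>) z) \<le> occ_bound F T * (2 * real \<rho> + 1)\<^sup>2"
        by (intro mult_left_mono occ_bound_nonneg[OF T])
      then show ?thesis
        using sum_iter_base_le[OF x R T F, of "indicat_real (zbox \<rho>)"] by simp
    qed
    finally show ?thesis .
  qed
  ultimately show ?thesis by linarith
qed

text \<open>Reversal turns the collision sum over \<open>v\<close> into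
  \<open>ker N (2 * n) y x\<close>, and the degrees of \<open>x\<close> and \<open>y\<close> cost
  \<open>5 * 5 = 25\<close>. Equal parity makes the odd times in \<open>occ\<close> vanish, so the
  even ones carry all of it.\<close>

lemma sum_iter_diagw_ge:
  assumes x: "x \<in> verts G" and y: "y \<in> verts G" and par: "even (parity x + parity y)"
  shows "occ T y x / 25 \<le> (\<Sum>n\<le>T. iter (prodN N) n (diagw (\<lambda>_. 1)) (x, y))"
proof -
  have "ker N (2 * n) y x / 25 \<le> iter (prodN N) n (diagw (\<lambda>_. 1)) (x, y)" for n
  proof -
    define S where "S = reach N n x \<union> reach N n y"
    have S: "finite S" "reach N n x \<subseteq> S" "reach N n y \<subseteq> S" using finite_reach[OF fin] by (auto simp: S_def)
    have SV: "v \<in> verts G" if "v \<in> S" for v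
      using that reach_verts[OF x, of v n] reach_verts[OF y, of v n] by (auto simp: S_def)
    have dx: "1 \<le> deg x" "deg x \<le> 5" and dy: "1 \<le> deg y" "deg y \<le> 5" using deg_bounds x y by auto
    have "ker N (2 * n) y x \<le> deg y * ker N (2 * n) y x"
      using dy ker_nonneg[of N "2 * n" y x] mult_right_mono[of 1 "deg y" "ker N (2 * n) y x"] by simp
    also have "\<dots> = (\<Sum>v\<in>S. deg v * ker N n v x * ker N n v y)"
      by (rule deg_ker_even[OF S(1,3), symmetric])
    also have "\<dots> \<le> (\<Sum>v\<in>S. 25 * (1 * (ker N n x v * ker N n y v)))"
    proof (rule sum_mono)
      fix v assume v: "v \<in> S"
      have dv: "1 \<le> deg v" using deg_bounds SV[OF v] by auto
      have "deg v * ker N n v x * ker N n v y \<le> (deg v * ker N n v x) * (deg v * ker N n v y)"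
        using dv ker_nonneg[of N n v y] mult_right_mono[of 1 "deg v" "ker N n v y"]
        by (intro mult_left_mono mult_nonneg_nonneg ker_nonneg) auto
      also have "\<dots> = (deg x * ker N n x v) * (deg y * ker N n y v)"
        using ker_reversible[of v n x] ker_reversible[of v n y] by simp
      also have "\<dots> \<le> (5 * ker N n x v) * (5 * ker N n y v)"
        using dx dy by (intro mult_mono mult_right_mono mult_nonneg_nonneg ker_nonneg) auto
      finally show "deg v * ker N n v x * ker N n v y \<le> 25 * (1 * (ker N n x v * ker N n y v))" by simp
    qed
    also have "\<dots> = 25 * iter (prodN N) n (diagw (\<lambda>_. 1)) (x, y)"
      unfolding iter_diagw[OF S(1,2)] by (simp add: sum_distrib_left)
    finally show ?thesis by simp
  qed
  then have "(\<Sum>n\<le>T. ker N (2 * n) y x / 25) \<le> (\<Sum>n\<le>T. iter (prodN N) n (diagw (\<lambda>_. 1)) (x, y))"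
    by (intro sum_mono)
  moreover have "occ T y x \<le> (\<Sum>n\<le>T. ker N (2 * n) y x)"
  proof -
    have odd: "ker N (Suc (2 * n)) y x = 0" for n
      by (rule ker_parity) (use par in auto)
    have "occ T y x \<le> occ (2 * Suc T) y x" by (rule occ_mono) simp
    also have "\<dots> = (\<Sum>n<Suc T. ker N (2 * n) y x)"
      unfolding occ_def sum_lessThan_double odd by simp
    finally show ?thesis by (simp add: lessThan_Suc_atMost)
  qed
  ultimately show ?thesis by (simp add: sum_divide_distrib[symmetric])
qed

lemma sum_iter_diagw_le:
  assumes v: "v \<in> verts G"
  shows "(\<Sum>n\<le>T. iter (prodN N) n (diagw (\<lambda>_. 1)) (v, v)) \<le> 5 * occ (2 * Suc T) v v"
proof -
  have "iter (prodN N) n (diagw (\<lambda>_. 1)) (v, v) \<le> 5 * ker N (2 * n) v v" for n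
  proof -
    define S where "S = reach N n v"
    have S: "finite S" "reach N n v \<subseteq> S" using finite_reach[OF fin] by (auto simp: S_def)
    have SV: "u \<in> verts G" if "u \<in> S" for u
      using that reach_verts[OF v, of u n] by (simp add: S_def)
    have d: "1 \<le> deg v" using deg_bounds v by auto
    have "iter (prodN N) n (diagw (\<lambda>_. 1)) (v, v) = (\<Sum>u\<in>S. ker N n v u * ker N n v u)"
      by (simp add: iter_diagw[OF S])
    also have "\<dots> \<le> (\<Sum>u\<in>S. 5 * (ker N n v u * ker N n u v))"
    proof (rule sum_mono)
      fix u assume u: "u \<in> S"
      have "ker N n v u \<le> deg v * ker N n v u"
        using d ker_nonneg[of N n v u] mult_right_mono[of 1 "deg v" "ker N n v u"] by simp
      also have "\<dots> = deg u * ker N n u v" by (rule ker_reversible)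
      also have "\<dots> \<le> 5 * ker N n u v" using deg_bounds(2)[OF SV[OF u]] by (intro mult_right_mono ker_nonneg)
      finally have "ker N n v u * ker N n v u \<le> ker N n v u * (5 * ker N n u v)"
        by (intro mult_left_mono ker_nonneg)
      then show "ker N n v u * ker N n v u \<le> 5 * (ker N n v u * ker N n u v)" by simp
    qed
    also have "\<dots> = 5 * ker N (n + n) v v"
      unfolding chapman_kolmogorov[OF S] by (simp add: sum_distrib_left)
    finally show ?thesis by (simp add: mult_2)
  qed
  then have "(\<Sum>n\<le>T. iter (prodN N) n (diagw (\<lambda>_. 1)) (v, v)) \<le> (\<Sum>n\<le>T. 5 * ker N (2 * n) v v)"
    by (intro sum_mono)
  also have "\<dots> = 5 * (\<Sum>n<Suc T. ker N (2 * n) v v)" by (simp add: sum_distrib_left lessThan_Suc_atMost)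
  also have "(\<Sum>n<Suc T. ker N (2 * n) v v) \<le> (\<Sum>n<Suc T. ker N (2 * n) v v + ker N (Suc (2 * n)) v v)"
    by (intro sum_mono) (simp add: ker_nonneg)
  also have "\<dots> = occ (2 * Suc T) v v" by (simp only: occ_def sum_lessThan_double)
  finally show ?thesis by simp
qed

end

section \<open>Logarithmic heights\<close>

text \<open>The blocks start at \<open>4 * 2 ^ k\<close> because the kernel bounds at scale
  \<open>T = 2 ^ k\<close> hold from time \<open>4 * T\<close> on.\<close>

lemma summable_dyadic:
  fixes a b :: "nat \<Rightarrow> real"
  assumes a: "\<And>n. 0 \<le> a n" and b: "summable b"
    and ab: "eventually (\<lambda>k. (\<Sum>n\<in>{4 * 2 ^ k..<8 * 2 ^ k}. a n) \<le> b k) sequentially"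
  shows "summable a"
proof -
  obtain k0 where k0: "\<And>k. k0 \<le> k \<Longrightarrow> (\<Sum>n\<in>{4 * 2 ^ k..<8 * 2 ^ k}. a n) \<le> b k"
    using ab by (auto simp: eventually_sequentially)
  have b0: "0 \<le> b (k0 + i)" for i
    using k0[of "k0 + i"] sum_nonneg[of "{4 * 2 ^ (k0 + i)..<8 * 2 ^ (k0 + i)}" a] a by (meson le_add1 order_trans)
  have s: "summable (\<lambda>i. b (k0 + i))" using b by (simp add: add.commute)
  have le: "(\<Sum>n<4 * 2 ^ (k0 + i). a n) \<le> (\<Sum>n<4 * 2 ^ k0. a n) + (\<Sum>j<i. b (k0 + j))" for i
  proof (induction i)
    case (Suc i)
    have "(\<Sum>n<4 * 2 ^ (k0 + Suc i). a n) = (\<Sum>n<4 * 2 ^ (k0 + i). a n) + (\<Sum>n\<in>{4 * 2 ^ (k0 + i)..<8 * 2 ^ (k0 + i)}. a n)"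
      by (simp add: lessThan_atLeast0 sum.atLeastLessThan_concat)
    then show ?case using Suc k0[of "k0 + i"] by simp
  qed simp
  show ?thesis
  proof (rule bounded_imp_summable)
    show "0 \<le> a n" for n by (rule a)
    show "(\<Sum>k\<le>n. a k) \<le> (\<Sum>n<4 * 2 ^ k0. a n) + (\<Sum>j. b (k0 + j))" for n
    proof -
      have "n < 2 ^ n" by (rule less_exp)
      also have "(2::nat) ^ n \<le> 4 * 2 ^ (k0 + n)" by (simp add: power_add)
      finally have "(\<Sum>k\<le>n. a k) \<le> (\<Sum>n<4 * 2 ^ (k0 + n). a n)"
        using a by (intro sum_mono2) auto
      also have "\<dots> \<le> (\<Sum>n<4 * 2 ^ k0. a n) + (\<Sum>j<n. b (k0 + j))" by (rule le)
      also have "(\<Sum>j<n. b (k0 + j)) \<le> (\<Sum>j. b (k0 + j))"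
        by (rule sum_le_suminf[OF s]) (use b0 in auto)
      finally show ?thesis by simp
    qed
  qed
qed

lemma ln_two_bounds: "1 / 2 \<le> ln (2::real)" "ln (2::real) \<le> 1"
  using ln_le_minus_one[of "1 / 2"] ln_le_minus_one[of 2] by (simp_all add: ln_div)

lemma ln_two_power_le: "ln (2 ^ k :: real) \<le> real k"
  using ln_two_bounds by (simp add: ln_realpow mult_left_le)

lemma ln_two_power_ge: "real k / 2 \<le> ln (2 ^ k :: real)"
  using mult_left_mono[OF ln_two_bounds(1), of "real k"] by (simp add: ln_realpow)

definition hgt :: "real \<Rightarrow> int \<times> int \<Rightarrow> nat" where
  "hgt \<gamma> z = nat \<lfloor>(ln (max (real_of_int (sup_norm z)) 1)) powr \<gamma>\<rfloor>"

lemma comb_height_eq: "comb_height \<gamma> = (\<lambda>z. enat (hgt \<gamma> z))"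
  by (simp add: comb_height_def hgt_def fun_eq_iff)

lemma hgt_le:
  assumes "0 < \<gamma>" "sup_norm z \<le> int R" "1 \<le> R"
  shows "real (hgt \<gamma> z) \<le> ln (real R) powr \<gamma>"
proof -
  have m: "max (real_of_int (sup_norm z)) 1 \<le> real R" using assms by (simp add: of_int_le_iff[symmetric] del: of_int_le_iff)
  have "real (hgt \<gamma> z) \<le> ln (max (real_of_int (sup_norm z)) 1) powr \<gamma>"
    unfolding hgt_def by (rule of_nat_floor) simp
  also have "\<dots> \<le> ln (real R) powr \<gamma>"
    using m assms by (intro powr_mono2) (auto simp: ln_ge_zero)
  finally show ?thesis .
qed

lemma hgt_ge:
  assumes "0 < \<gamma>" "z \<notin> zbox R" "1 \<le> R"
  shows "ln (real R) powr \<gamma> - 1 \<le> real (hgt \<gamma> z)"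
proof -
  have "int R \<le> sup_norm z" using assms(2) by (simp add: zbox_def)
  then have m: "real R \<le> max (real_of_int (sup_norm z)) 1" by linarith
  have "ln (real R) powr \<gamma> \<le> ln (max (real_of_int (sup_norm z)) 1) powr \<gamma>"
    using m assms by (intro powr_mono2) (auto simp: ln_ge_zero)
  also have "\<dots> \<le> real (hgt \<gamma> z) + 1"
    unfolding hgt_def by linarith
  finally show ?thesis by simp
qed

text \<open>The radius \<open>16 * 2 ^ k\<close> encloses all that is met at scale \<open>k\<close>;
  an integer exponent \<open>g\<close> makes the height bound a polynomial in
  \<open>k\<close>.\<close>

lemma hgt_le_dyadic:
  assumes "0 < \<gamma>" "\<gamma> \<le> real g" "z \<in> zbox (16 * 2 ^ k)"
  shows "hgt \<gamma> z \<le> (k + 4) ^ g"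
proof -
  have "real (hgt \<gamma> z) \<le> ln (real (16 * 2 ^ k)) powr \<gamma>"
    using assms by (intro hgt_le) (auto simp: zbox_def)
  also have "ln (real (16 * 2 ^ k)) \<le> real k + 4"
    using ln_two_power_le[of "k + 4"] by (simp add: power_add mult.commute)
  then have "ln (real (16 * 2 ^ k)) powr \<gamma> \<le> (real k + 4) powr \<gamma>"
    using assms by (intro powr_mono2 ln_ge_zero) (auto intro: order_trans[of 1 16])
  also have "\<dots> \<le> (real k + 4) powr (real g)" using assms by (intro powr_mono) auto
  also have "\<dots> = real ((k + 4) ^ g)" by (simp add: powr_realpow)
  finally show ?thesis by (simp only: of_nat_le_iff)
qed

lemma occ_bound_dyadic:
  assumes "1 \<le> g" "i \<le> k + 3"
  shows "occ_bound ((k + 4) ^ g) (2 ^ i) \<le> 14 * (real k + 4) ^ (2 * g)"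
proof -
  define F where "F = (real k + 4) ^ g"
  have F: "real k + 4 \<le> F" using self_le_power[of "real k + 4" g] assms by (simp add: F_def)
  have "ln (2 ^ i :: real) \<le> real i" by (rule ln_two_power_le)
  then have "1 + ln (2 ^ i :: real) \<le> F" using F assms(2) by linarith
  then have "(2 * F + 5 * (1 + ln (2 ^ i :: real))) * (F + 1) \<le> (7 * F) * (2 * F)"
    using F by (intro mult_mono) auto
  also have "\<dots> = 14 * (F * F)" by simp
  also have "F * F = (real k + 4) ^ (2 * g)" by (simp only: F_def mult_2 power_add)
  finally show ?thesis unfolding occ_bound_def F_def by simp
qed

locale height_comb =
  fixes \<gamma> :: real
  assumes \<gamma>_pos: "0 < \<gamma>"
begin

sublocale comb "hgt \<gamma>" .

lemma mem_bbox_dyadic: "x \<in> verts G \<Longrightarrow> eventually (\<lambda>k. x \<in> bbox (2 ^ k)) sequentially"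
proof -
  assume x: "x \<in> verts G"
  define R where "R = nat (sup_norm (fst x))"
  have "x \<in> bbox (2 ^ k)" if "R \<le> k" for k
  proof -
    have "R \<le> 2 ^ k" using that less_exp[of k] by linarith
    then show ?thesis using verts_bbox[OF x] bbox_mono[of R "2 ^ k"] unfolding R_def by blast
  qed
  then show ?thesis unfolding eventually_sequentially by blast
qed

section \<open>The case \<gamma> \<le> 1: collision probabilities bounded below\<close>

lemma occ_ge_dyadic:
  assumes \<gamma>1: "\<gamma> \<le> 1" and x: "x \<in> verts G" and y: "y \<in> verts G"
  shows "eventually (\<lambda>k. real k / 100 \<le> occ (2 ^ k) x y) sequentially"
proof -
  obtain C where C: "\<And>m. pot (2 * m) 0 - pot (2 * m) (fst x - fst y) \<le> C"
    using pot_defect_bounded[of "fst x - fst y"] by blast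
  have lim: "eventually (\<lambda>k. real k / 50 \<le> real k / 32 - 1 / 16 - C / 2 -
      14 * (real k + 4)\<^sup>2 * (2 * (real k + 4) + (2 + 2 * 2 powr (real k / 2))) / 2 ^ k) sequentially"
    by real_asymp
  show ?thesis using mem_bbox_dyadic[OF x] mem_bbox_dyadic[OF y] lim eventually_ge_at_top[of 2]
  proof eventually_elim
    case (elim k)
    \<comment> \<open>The cutoff \<open>2 * Suc ?m\<close> is near the square root of
      \<open>?T\<close>: the potential is still of order \<open>k\<close>, while the error is
      polynomial in \<open>k\<close> times \<open>2 powr (- k / 2)\<close>. It is even because
      \<open>pot_defect_bounded\<close> is about even cutoffs.\<close>
    let ?m = "2 ^ (k div 2) :: nat" and ?T = "2 ^ k :: nat"
    have F: "hgt \<gamma> z \<le> k + 4" if "z \<in> zbox (16 * 2 ^ k)" for z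
      using hgt_le_dyadic[OF \<gamma>_pos _ that, of 1] \<gamma>1 by simp
    have bnd: "occ_bound (k + 4) ?T \<le> 14 * (real k + 4)\<^sup>2"
      using occ_bound_dyadic[of 1 k k] by simp
    have "1 / 2 * pot (2 * Suc ?m) (fst x - fst y) -
        occ_bound (k + 4) ?T * (2 * real (k + 4) + real (2 * Suc ?m)) / real ?T \<le> 2 * occ ?T x y"
      by (rule occ_lower[OF elim(1,2), where R = "16 * 2 ^ k"]) (use F in auto)
    moreover have "occ_bound (k + 4) ?T * (2 * real (k + 4) + real (2 * Suc ?m)) / real ?T \<le>
        14 * (real k + 4)\<^sup>2 * (2 * (real k + 4) + (2 + 2 * 2 powr (real k / 2))) / 2 ^ k"
    proof -
      have "(2::real) ^ (k div 2) = 2 powr real (k div 2)" by (simp add: powr_realpow)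
      also have "\<dots> \<le> 2 powr (real k / 2)" by (intro powr_mono) auto
      finally have "real (2 * Suc ?m) \<le> 2 + 2 * 2 powr (real k / 2)" by simp
      then show ?thesis using bnd
        by (simp only: of_nat_power of_nat_numeral) (intro divide_right_mono mult_mono, auto)
    qed
    moreover have "real k / 16 - 1 / 8 - C \<le> pot (2 * Suc ?m) (fst x - fst y)"
    proof -
      have "ln (real ?m) / 4 \<le> pot (2 * Suc ?m) 0" by (rule pot_0_ge) simp
      moreover have "real (k div 2) / 2 \<le> ln (real ?m)" using ln_two_power_ge[of "k div 2"] by simp
      moreover have "real k / 2 - 1 / 2 \<le> real (k div 2)" by linarith
      ultimately show ?thesis using C[of "Suc ?m"] by linarith
    qed
    ultimately show ?case using elim(3) by linarith
  qed
qed

text \<open>Since \<gamma> \<le> 1, heights are at most \<open>k + 4\<close>, of the order of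
  \<open>ln T\<close>. So at most \<open>150 * k\<close> collisions are expected from
  \<open>(v, v)\<close>, against at least \<open>k / 2500\<close> from \<open>(x, y)\<close>; the
  quotient is \<open>1 / 375000\<close>.\<close>

lemma hit_ge:
  assumes \<gamma>1: "\<gamma> \<le> 1" and x: "x \<in> verts G" and y: "y \<in> verts G" and par: "even (parity x + parity y)"
  shows "\<exists>T. 1 / 375000 \<le> hit N T (x, y)"
proof -
  have "eventually (\<lambda>k. 1 / 375000 \<le> hit N (2 ^ k) (x, y)) sequentially"
    using occ_ge_dyadic[OF \<gamma>1 y x] mem_bbox_dyadic[OF x] eventually_ge_at_top[of 1]
  proof eventually_elim
    case (elim k)
    let ?T = "2 ^ k :: nat"
    have "(\<Sum>n\<le>?T. iter (prodN N) n (diagw (\<lambda>_. 1)) (x, y)) \<le> (150 * real k) * hit N ?T (x, y)"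
    proof (rule sum_diagw_le_hit[OF order_refl])
      fix j v assume j: "j \<le> ?T" and v: "v \<in> reach N j x"
      then have vb: "v \<in> bbox (2 * 2 ^ k)" using reach_bbox[OF elim(2), of j] bbox_mono[of "2 ^ k + j" "2 * 2 ^ k"] by auto
      then have V: "v \<in> verts G" by (rule bbox_verts)
      have "fst v \<in> zbox (16 * 2 ^ k)" using subsetD[OF bbox_mono vb, of "16 * 2 ^ k"] by (cases v) (simp add: mem_bbox zbox_def)
      moreover have "snd v \<le> hgt \<gamma> (fst v)" using vb by (cases v) (simp add: mem_bbox)
      ultimately have h: "real (snd v) \<le> real k + 4" using hgt_le_dyadic[OF \<gamma>_pos, of 1 "fst v" k] \<gamma>1 by simp
      have "real (2 * Suc ?T) \<le> 2 ^ (k + 2)" by (simp add: power_add)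
      then have "ln (real (2 * Suc ?T)) \<le> ln (2 ^ (k + 2))" by (intro ln_mono) (auto intro!: add_pos_pos)
      also have "\<dots> \<le> real (k + 2)" by (rule ln_two_power_le)
      finally have l: "ln (real (2 * Suc ?T)) \<le> real k + 2" by simp
      have "(\<Sum>n\<le>?T. iter (prodN N) n (diagw (\<lambda>_. 1)) (v, v)) \<le> 5 * occ (2 * Suc ?T) v v"
        by (rule sum_iter_diagw_le[OF V])
      also have "\<dots> \<le> 5 * (2 * real (snd v) + 5 * (1 + ln (real (2 * Suc ?T))))"
        by (intro mult_left_mono occ_upper V) auto
      also have "\<dots> \<le> 5 * (2 * (real k + 4) + 5 * (1 + (real k + 2)))"
        using h l by (intro mult_left_mono add_mono) auto
      also have "\<dots> \<le> 150 * real k" using elim(3) by simp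
      finally show "(\<Sum>n\<le>?T. iter (prodN N) n (diagw (\<lambda>_. 1)) (v, v)) \<le> 150 * real k" by simp
    qed simp
    moreover have "occ ?T y x / 25 \<le> (\<Sum>n\<le>?T. iter (prodN N) n (diagw (\<lambda>_. 1)) (x, y))"
      by (rule sum_iter_diagw_ge[OF x y par])
    ultimately have "real k * (1 / 2500) \<le> real k * (150 * hit N ?T (x, y))" using elim(1) by linarith
    then have "1 / 2500 \<le> 150 * hit N ?T (x, y)" using elim(3) by (subst (asm) mult_le_cancel_left_pos) auto
    then show ?case by simp
  qed
  then show ?thesis by (auto simp: eventually_sequentially)
qed

lemma infinite_collisions:
  assumes "\<gamma> \<le> 1"
  shows "infinite_collision_property G"
  unfolding infinite_collision_property_def
proof
  fix x assume x: "x \<in> verts G"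
  show "\<P>(w in two_walks G x x. num_collisions (fst w) (snd w) = \<infinity>) = 1"
  \<comment> \<open>Pairs of equal parity form a closed class, as each step flips the parity of both
    walks, and the class contains \<open>(x, x)\<close>.\<close>
  proof (rule infinite_collisions_criterion[where c = "1 / 375000" and
        R = "\<lambda>x y. x \<in> verts G \<and> y \<in> verts G \<and> even (parity x + parity y)"])
    fix x y a b
    assume R: "x \<in> verts G \<and> y \<in> verts G \<and> even (parity x + parity y)" and a: "a \<in> N x" and b: "b \<in> N y"
    have "odd (parity a + parity x)" "odd (parity b + parity y)" using parity_N a b by auto
    then show "a \<in> verts G \<and> b \<in> verts G \<and> even (parity a + parity b)"
      using R nbrs_closed[OF _ a] nbrs_closed[OF _ b] by auto
  qed (use x hit_ge[OF assms] in auto)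
qed

section \<open>The case \<gamma> > 1: heat kernel and mean weight on dyadic blocks\<close>

definition ker_const :: "nat \<Rightarrow> nat \<Rightarrow> real" where
  "ker_const g k = 28 * (real k + 4) ^ (3 * g) / 2 ^ k + 28 * (real k + 4) ^ (2 * g) / real k ^ (2 * g)
     + 28 * (real k + 4) ^ (2 * g) / 2 ^ k + 5 / 2 * (1 + 2 * real g * ln (real k)) + 5 / 2"

text \<open>\<open>ker_const g k\<close> is the bound of \<open>ker_diag_le\<close> at
  \<open>T = 2 ^ k\<close>, divided by \<open>T\<close>. Its only unbounded term is the one with
  \<open>ln (real k)\<close>, which is the log log in time.\<close>

lemma ker_diag_dyadic:
  assumes g: "\<gamma> \<le> real g" "1 \<le> g" and k: "1 \<le> k" and w: "w \<in> bbox (15 * 2 ^ k)"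
  shows "ker N (4 * 2 ^ k) w w \<le> ker_const g k / 2 ^ k"
proof -
  define T :: nat where "T = 2 ^ k"
  \<comment> \<open>The fraction \<open>1 / k ^ (2 * g)\<close> offsets the growth of
    \<open>occ_bound\<close> and costs only order \<open>ln k\<close> in the logarithm. Adding 1
    makes up for the rounding and keeps \<open>m\<close> positive.\<close>
  define m where "m = T div k ^ (2 * g) + 1"
  define A where "A = (real k + 4) ^ g"
  define P where "P = real k ^ (2 * g)"
  have rT: "real T = 2 ^ k" by (simp add: T_def)
  have T: "1 \<le> T" "0 < real T" by (simp_all add: T_def)
  have A1: "1 \<le> A" by (simp add: A_def)
  have P1: "1 \<le> P" using k by (simp add: P_def)
  have m: "1 \<le> m" "m \<le> 2 * T" using T div_le_dividend[of T "k ^ (2 * g)"] unfolding m_def by linarith+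
  have mu: "real m \<le> real T / P + 1"
    using of_nat_div_le_of_nat[of T "k ^ (2 * g)"] by (simp add: m_def P_def)
  have ml: "real T / P \<le> real m"
  proof -
    have "real (T mod k ^ (2 * g)) \<le> real (k ^ (2 * g))"
      using k by (simp only: of_nat_le_iff) (simp add: less_imp_le)
    then have "real (T mod k ^ (2 * g)) / real (k ^ (2 * g)) \<le> 1"
      using k by (simp add: divide_le_eq_1)
    then have "real T / real (k ^ (2 * g)) \<le> real (T div k ^ (2 * g)) + 1"
      using of_nat_of_nat_div_aux[of T "k ^ (2 * g)", where 'a = real] by linarith
    then show ?thesis by (simp add: m_def P_def)
  qed
  have "real (2 * T) / real m \<le> real (2 * T) / (real T / P)"
    using ml m T P1 by (intro divide_left_mono mult_pos_pos divide_pos_pos) auto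
  also have "\<dots> = 2 * P" using T by simp
  finally have "ln (real (2 * T) / real m) \<le> ln (2 * P)"
    using m T by (intro ln_mono) auto
  also have "\<dots> \<le> 1 + 2 * real g * ln (real k)"
    using k P1 ln_two_bounds(2) by (simp add: ln_mult P_def ln_realpow)
  finally have lm: "ln (real (2 * T) / real m) \<le> 1 + 2 * real g * ln (real k)" .
  have "real T * real T * ker N (4 * T) w w \<le>
    occ_bound ((k + 4) ^ g) T * (2 * real ((k + 4) ^ g) + 2 * real m)
      + 5 / 2 * real T * ln (real (2 * T) / real m) + 5 / 2 * real T"
    by (rule ker_diag_le[OF w _ T(1) _ m, where R = "16 * 2 ^ k"])
      (use hgt_le_dyadic[OF \<gamma>_pos g(1)] in \<open>auto simp: T_def\<close>)
  also have "\<dots> \<le> 14 * A\<^sup>2 * (2 * A + 2 * (real T / P + 1)) + 5 / 2 * real T * (1 + 2 * real g * ln (real k)) + 5 / 2 * real T"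
  proof (intro add_mono mult_mono mult_left_mono lm order_refl)
    show "occ_bound ((k + 4) ^ g) T \<le> 14 * A\<^sup>2"
      using occ_bound_dyadic[OF g(2), of k k] by (simp only: T_def A_def mult_2 power_add power2_eq_square)
  qed (use mu A1 m in \<open>auto simp: A_def\<close>)
  also have "\<dots> = real T * ker_const g k"
  proof -
    have "(real k + 4) ^ (2 * g) = A\<^sup>2" by (simp only: A_def mult_2 power_add power2_eq_square)
    moreover have "(real k + 4) ^ (3 * g) = A\<^sup>2 * A"
      by (simp only: A_def power2_eq_square power_add[symmetric]) simp
    ultimately show ?thesis
      unfolding ker_const_def P_def[symmetric] rT[symmetric] using T P1 by (simp add: field_simps)
  qed
  finally have "real T * ker N (4 * T) w w \<le> ker_const g k" using T by (simp add: mult.assoc)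
  then show ?thesis using T by (simp add: rT[symmetric] T_def[symmetric] field_simps)
qed

lemma tooth_mean_dyadic:
  assumes \<gamma>1: "1 \<le> \<gamma>" and a: "0 < a" "a < 1" and k: "32 \<le> k" and z: "z \<notin> zbox (2 ^ (k div 4))"
  shows "tooth_mean (hgt \<gamma> z) \<le> (5 + 4 / a) * (real k / 32) powr (\<gamma> * (a - 1))"
proof -
  have k1: "1 \<le> real k / 32" using k by simp
  have one: "1 \<le> (real k / 32) powr \<gamma>" using k1 \<gamma>_pos by (simp add: ge_one_powr_ge_zero)
  have "(real k / 16) powr \<gamma> \<le> ln (real (2 ^ (k div 4))) powr \<gamma>"
  proof (rule powr_mono2)
    have "real k / 16 \<le> real (k div 4) / 2" using k by linarith
    also have "\<dots> \<le> ln (real (2 ^ (k div 4)))" using ln_two_power_ge[of "k div 4"] by simp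
    finally show "real k / 16 \<le> ln (real (2 ^ (k div 4)))" .
  qed (use \<gamma>_pos in auto)
  then have h: "(real k / 16) powr \<gamma> - 1 \<le> real (hgt \<gamma> z)"
    using hgt_ge[OF \<gamma>_pos z] by simp
  \<comment> \<open>Halving the base gains the factor \<open>2 powr \<gamma>\<close>, which is at
    least 2; the second copy absorbs the 1 lost to the floor.\<close>
  have "2 * (real k / 32) powr \<gamma> \<le> 2 powr \<gamma> * (real k / 32) powr \<gamma>"
    using powr_mono[OF \<gamma>1, of 2] by (intro mult_right_mono) auto
  also have "\<dots> = (2 * (real k / 32)) powr \<gamma>" by (rule powr_mult[symmetric]) 
  also have "2 * (real k / 32) = real k / 16" by simp
  finally have hX: "(real k / 32) powr \<gamma> \<le> real (hgt \<gamma> z)" using h one by linarith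
  then have "1 \<le> hgt \<gamma> z" using one by linarith
  from tooth_mean_le_powr[OF this a]
  have "tooth_mean (hgt \<gamma> z) \<le> (5 + 4 / a) * real (hgt \<gamma> z) powr (a - 1)" .
  also have "\<dots> \<le> (5 + 4 / a) * ((real k / 32) powr \<gamma>) powr (a - 1)"
    using hX one a k by (intro mult_left_mono powr_mono2') auto
  finally show ?thesis by (simp add: powr_powr)
qed

text \<open>Base points within \<open>2 ^ (k div 4)\<close> are of order
  \<open>2 powr (k / 2)\<close> at most, so the time spent over them is negligible against
  \<open>2 ^ k\<close>, while beyond them the logarithm of the norm is still at least of order
  \<open>k\<close>. The constant 882 is \<open>7 * 14 * 9\<close>.\<close>

lemma block_sum_le:
  assumes g: "\<gamma> \<le> real g" "1 \<le> g" and k: "1 \<le> k" and x: "x \<in> bbox (2 ^ k)"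
    and \<kappa>: "0 \<le> \<kappa>" "\<And>z. z \<notin> zbox (2 ^ (k div 4)) \<Longrightarrow> tooth_mean (hgt \<gamma> z) \<le> \<kappa>"
  shows "(\<Sum>n\<in>{4 * 2 ^ k..<8 * 2 ^ k}. iter (prodN N) n (diagw weight) (x, x)) \<le>
    3 * (ker_const g k / 2 ^ k) * (42 * (real k + 4) ^ (2 * g) + 8 * 2 ^ k * \<kappa>
      + 882 * (real k + 4) ^ (2 * g) * 2 powr (real k / 2))"
proof -
  define H where "H = ker_const g k / 2 ^ k"
  have H0: "0 \<le> H" using k by (auto simp: H_def ker_const_def intro!: divide_nonneg_nonneg add_nonneg_nonneg)
  have "(\<Sum>n\<in>{4 * 2 ^ k..<8 * 2 ^ k}. iter (prodN N) n (diagw weight) (x, x)) \<le>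
      (\<Sum>n\<in>{4 * 2 ^ k..<8 * 2 ^ k}. 3 * H * iter N n weight x)"
  proof (rule sum_mono)
    fix n :: nat assume n: "n \<in> {4 * 2 ^ k..<8 * 2 ^ k}"
    show "iter (prodN N) n (diagw weight) (x, x) \<le> 3 * H * iter N n weight x"
    proof (rule iter_diagw_le[OF _ x _ weight_nonneg])
      show "2 ^ k + n \<le> 15 * 2 ^ k" using n by simp
      show "ker N n x v \<le> 3 * H" if "v \<in> bbox (15 * 2 ^ k)" for v
      proof (rule ker_le_diag[where T = "2 ^ k" and R = "15 * 2 ^ k", OF _ x _ that])
        show "ker N (4 * 2 ^ k) w w \<le> H" if "w \<in> bbox (15 * 2 ^ k)" for w
          unfolding H_def by (rule ker_diag_dyadic[OF g k that])
        have "(1::nat) \<le> 2 ^ k" by simp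
        then show "Suc (2 ^ k) \<le> 15 * 2 ^ k" by linarith
      qed (use n in simp)
    qed
  qed
  also have "\<dots> \<le> (\<Sum>n<8 * 2 ^ k. 3 * H * iter N n weight x)"
    using H0 by (intro sum_mono2) (auto intro!: mult_nonneg_nonneg iter_nonneg weight_nonneg)
  also have "\<dots> = 3 * H * (\<Sum>n<8 * 2 ^ k. iter N n weight x)" by (simp add: sum_distrib_left)
  also have "\<dots> \<le> 3 * H * (42 * (real k + 4) ^ (2 * g) + 8 * 2 ^ k * \<kappa>
      + 882 * (real k + 4) ^ (2 * g) * 2 powr (real k / 2))"
  proof (rule mult_left_mono)
    let ?F = "(k + 4) ^ g" and ?\<rho> = "2 ^ (k div 4) :: nat"
    have "(\<Sum>n<8 * 2 ^ k. iter N n weight x) \<le>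
      42 * (real ?F)\<^sup>2 + real (8 * 2 ^ k) * \<kappa> + 7 * (occ_bound ?F (8 * 2 ^ k) * (2 * real ?\<rho> + 1)\<^sup>2)"
      by (rule sum_weight_le[OF x, where R = "16 * 2 ^ k"]) (use \<kappa> hgt_le_dyadic[OF \<gamma>_pos g(1)] in auto)
    moreover have "(real ?F)\<^sup>2 = (real k + 4) ^ (2 * g)"
      by (simp only: of_nat_power of_nat_add of_nat_numeral mult_2 power_add power2_eq_square)
    moreover have "occ_bound ?F (8 * 2 ^ k) * (2 * real ?\<rho> + 1)\<^sup>2 \<le> 14 * (real k + 4) ^ (2 * g) * (9 * 2 powr (real k / 2))"
    proof (rule mult_mono)
      show "occ_bound ?F (8 * 2 ^ k) \<le> 14 * (real k + 4) ^ (2 * g)"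
        using occ_bound_dyadic[OF g(2), of "k + 3" k] by (simp add: power_add mult.commute)
      have "(2 * real ?\<rho> + 1)\<^sup>2 \<le> (3 * real ?\<rho>)\<^sup>2"
        by (intro power_mono) auto
      also have "\<dots> = 9 * 2 ^ (2 * (k div 4))" by (simp add: power_mult_distrib power_mult[symmetric] mult.commute)
      also have "(2::real) ^ (2 * (k div 4)) = 2 powr real (2 * (k div 4))" by (rule powr_realpow[symmetric]) simp
      also have "\<dots> \<le> 2 powr (real k / 2)"
      proof (rule powr_mono)
        have "4 * (k div 4) \<le> k" by simp
        then show "real (2 * (k div 4)) \<le> real k / 2" by linarith
      qed simp
      finally show "(2 * real ?\<rho> + 1)\<^sup>2 \<le> 9 * 2 powr (real k / 2)" by simp
    qed auto
    ultimately show "(\<Sum>n<8 * 2 ^ k. iter N n weight x) \<le> 42 * (real k + 4) ^ (2 * g) + 8 * 2 ^ k * \<kappa>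
      + 882 * (real k + 4) ^ (2 * g) * 2 powr (real k / 2)"
      by simp
  qed (use H0 in simp)
  finally show ?thesis by (simp only: H_def)
qed

lemma finite_collisions:
  assumes \<gamma>1: "1 < \<gamma>"
  shows "finite_collision_property G"
  unfolding finite_collision_property_def
proof
  fix x assume x: "x \<in> verts G"
  define g where "g = nat \<lceil>\<gamma>\<rceil>"
  have g: "\<gamma> \<le> real g" "1 \<le> g" using \<gamma>1 by (auto simp: g_def le_nat_iff)
  \<comment> \<open>Chosen so that \<open>\<gamma> * (1 - a)\<close> equals \<open>q\<close>, which
    still exceeds 1. The exponent \<open>p\<close> is the midpoint of 1 and \<open>q\<close>: the
    gap \<open>q - p\<close> pays for the factor \<open>ln k\<close> of the kernel, and
    \<open>p > 1\<close> gives summability over \<open>k\<close>.\<close>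
  define a where "a = (\<gamma> - 1) / (2 * \<gamma>)"
  define p q where "p = (\<gamma> + 3) / 4" and "q = (\<gamma> + 1) / 2"
  have a: "0 < a" "a < 1" using \<gamma>1 by (auto simp: a_def field_simps)
  have q: "\<gamma> * (a - 1) = - q" using \<gamma>1 by (simp add: a_def q_def field_simps)
  have pq: "1 < p" "p < q" using \<gamma>1 by (auto simp: p_def q_def field_simps)
  define K where "K = 5 + 4 / a"
  have K: "0 < K" using a by (simp add: K_def add_pos_pos)
  have lim: "((\<lambda>k. 3 * (ker_const g k / 2 ^ k) * (42 * (real k + 4) ^ (2 * g) + 8 * 2 ^ k * (K * (real k / 32) powr (- q))
      + 882 * (real k + 4) ^ (2 * g) * 2 powr (real k / 2)) * real k powr p) \<longlongrightarrow> 0) sequentially"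
    unfolding ker_const_def using pq K by real_asymp
  have sm: "summable (\<lambda>n. iter (prodN N) n (diagw weight) (x, x))"
  proof (rule summable_dyadic)
    show "summable (\<lambda>k. real k powr (- p))" using pq by (simp add: summable_real_powr_iff)
    show "0 \<le> iter (prodN N) n (diagw weight) (x, x)" for n
      by (rule iter_nonneg) (simp add: diagw_def weight_nonneg)
    show "\<forall>\<^sub>F k in sequentially. (\<Sum>n\<in>{4 * 2 ^ k..<8 * 2 ^ k}. iter (prodN N) n (diagw weight) (x, x)) \<le> real k powr - p"
      using order_tendstoD(2)[OF lim zero_less_one] mem_bbox_dyadic[OF x] eventually_ge_at_top[of 32]
    proof eventually_elim
      case (elim k)
      have k0: "0 < real k" using elim(3) by simp
      have "(\<Sum>n\<in>{4 * 2 ^ k..<8 * 2 ^ k}. iter (prodN N) n (diagw weight) (x, x)) \<le>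
        3 * (ker_const g k / 2 ^ k) * (42 * (real k + 4) ^ (2 * g) + 8 * 2 ^ k * (K * (real k / 32) powr (- q))
          + 882 * (real k + 4) ^ (2 * g) * 2 powr (real k / 2))"
      proof (rule block_sum_le[OF g _ elim(2)])
        show "tooth_mean (hgt \<gamma> z) \<le> K * (real k / 32) powr (- q)" if "z \<notin> zbox (2 ^ (k div 4))" for z
          using tooth_mean_dyadic[OF _ a elim(3) that] \<gamma>1 by (simp add: q K_def)
      qed (use K elim(3) in auto)
      also have "\<dots> \<le> 1 / real k powr p"
        using elim(1) k0 by (subst pos_le_divide_eq) auto
      also have "\<dots> = real k powr - p" by (simp add: powr_minus_divide)
      finally show ?case .
    qed
  qed
  show "\<P>(w in two_walks G x x. num_collisions (fst w) (snd w) < \<infinity>) = 1"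
    by (rule finite_collisions_criterion[OF weight_nonneg _ weight_collisions_ge x x sm]) simp_all
qed

end

theorem theorem4p1:
  fixes \<gamma> :: real
  assumes "\<gamma> > 0"
  shows "(\<gamma> \<le> 1 \<longrightarrow> infinite_collision_property (Comb Z2 (comb_height \<gamma>))) \<and>
         (\<gamma> > 1 \<longrightarrow> finite_collision_property (Comb Z2 (comb_height \<gamma>)))"
proof -
  interpret height_comb \<gamma> by unfold_locales (rule assms)
  show ?thesis using infinite_collisions finite_collisions by (simp add: comb_height_eq)
qed

end
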